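(* For any two quantum channels $\mathcal{T}:\mathcal{M}_d\to\mathcal{M}_d$ and $\mathcal{S}:\mathcal{M}_{d'}\to\mathcal{M}_{d'}$, $$C_0^\infty(\mathcal{T}\otimes\mathcal{S}) = C_0^\infty(\mathcal{T})+C_0^\infty(\mathcal{S}),\qquad Q_0^\infty(\mathcal{T}\otimes\mathcal{S}) = Q_0^\infty(\mathcal{T})+Q_0^\infty(\mathcal{S}).$$
   Context: A quantum channel is a completely positive trace-preserving linear map. For a channel $\mathcal{T}:\mathcal{M}_d\to\mathcal{M}_d$, a channel $\mathcal{E}:\mathcal{M}_D\to\mathcal{M}_d$ is a $(D,\delta)$ classical code for $\mathcal{T}$ if there is a channel $\mathcal{R}:\mathcal{M}_d\to\mathcal{M}_D$ with $\frac1D\sum_{i=1}^D\langle i|\mathcal{R}\circ\mathcal{T}\circ\mathcal{E}(|i\rangle\langle i|)|i\rangle\ge 1-\delta$ for a fixed orthonormal basis $\{|i\rangle\}$ of $\mathbb{C}^D$; it is a $(D,\delta)$ quantum code if there is a channel $\mathcal{R}$ with $\langle\Phi^+|(\mathcal{I}\otimes(\mathcal{R}\circ\mathcal{T}\circ\mathcal{E}))(|\Phi^+\rangle\langle\Phi^+|)|\Phi^+\rangle\ge1-\delta$, where $|\Phi^+\rangle=\frac{1}{\sqrt D}\sum_{i=1}^D|i\rangle\otimes|i\rangle$. $C_\delta(\mathcal{T})=\sup\log D$ over $(D,\delta)$ classical codes, $Q_\delta(\mathcal{T})=\sup\log D$ over $(D,\delta)$ quantum codes, and $C^\infty_\delta(\mathcal{T})=\lim_{t\to\infty}C_\delta(\mathcal{T}^t)$,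 $Q^\infty_\delta(\mathcal{T})=\lim_{t\to\infty}Q_\delta(\mathcal{T}^t)$ with $\mathcal{T}^t$ the $t$-fold composition. $C_0^\infty, Q_0^\infty$ are the case $\delta=0$. *)

theory Defs
  imports "Jordan_Normal_Form.Matrix" "Jordan_Normal_Form.Conjugate"
begin

(* M_n is represented by  carrier_mat n n  of  complex mat.  A map M_d -> M_e is a
   function  complex mat => complex mat  whose behaviour is only relevant on carrier_mat d d. *)

definition mtrace :: "complex mat \<Rightarrow> complex" where
  "mtrace A = (\<Sum>i<dim_row A. A $$ (i, i))"

definition psd :: "nat \<Rightarrow> complex mat \<Rightarrow> bool" where
  "psd n A \<longleftrightarrow> A \<in> carrier_mat n n \<and>
     (\<forall>v \<in> carrier_vec n. Im (conjugate v \<bullet> (A *\<^sub>v v)) = 0 \<and> Re (conjugate v \<bullet> (A *\<^sub>v v)) \<ge> 0)"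

definition unit_mat :: "nat \<Rightarrow> nat \<Rightarrow> nat \<Rightarrow> complex mat" where
  "unit_mat n i j = mat n n (\<lambda>(a, b). if a = i \<and> b = j then 1 else 0)"

definition lin_map :: "nat \<Rightarrow> nat \<Rightarrow> (complex mat \<Rightarrow> complex mat) \<Rightarrow> bool" where
  "lin_map d e T \<longleftrightarrow>
     (\<forall>A \<in> carrier_mat d d. T A \<in> carrier_mat e e) \<and>
     (\<forall>A \<in> carrier_mat d d. \<forall>B \<in> carrier_mat d d. T (A + B) = T A + T B) \<and>
     (\<forall>A \<in> carrier_mat d d. \<forall>c. T (c \<cdot>\<^sub>m A) = c \<cdot>\<^sub>m T A)"

definition blk :: "nat \<Rightarrow> complex mat \<Rightarrow> nat \<Rightarrow> nat \<Rightarrow> complex mat" where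
  "blk d X i j = mat d d (\<lambda>(a, b). X $$ (i * d + a, j * d + b))"

definition id_tensor :: "nat \<Rightarrow> nat \<Rightarrow> nat \<Rightarrow> (complex mat \<Rightarrow> complex mat) \<Rightarrow> complex mat \<Rightarrow> complex mat" where
  "id_tensor n d e T X = mat (n * e) (n * e)
     (\<lambda>(r, c). T (blk d X (r div e) (c div e)) $$ (r mod e, c mod e))"

definition channel :: "nat \<Rightarrow> nat \<Rightarrow> (complex mat \<Rightarrow> complex mat) \<Rightarrow> bool" where
  "channel d e T \<longleftrightarrow> lin_map d e T \<and>
     (\<forall>A \<in> carrier_mat d d. mtrace (T A) = mtrace A) \<and>
     (\<forall>n. \<forall>X. psd (n * d) X \<longrightarrow> psd (n * e) (id_tensor n d e T X))"

(* tensor product T \<otimes> S : M_{d*d'} -> M_{d*d'} of T : M_d -> M_d and S : M_{d'} -> M_{d'},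
   the linear extension of  A \<otimes> B \<mapsto> T A \<otimes> S B  (Kronecker ordering: index (i,k) \<mapsto> i*d'+k) *)
definition tensor_chan :: "nat \<Rightarrow> nat \<Rightarrow> (complex mat \<Rightarrow> complex mat) \<Rightarrow> (complex mat \<Rightarrow> complex mat)
    \<Rightarrow> complex mat \<Rightarrow> complex mat" where
  "tensor_chan d d' T S X = mat (d * d') (d * d') (\<lambda>(r, c).
     \<Sum>i<d. \<Sum>j<d. \<Sum>k<d'. \<Sum>l<d'. X $$ (i * d' + k, j * d' + l) *
        T (unit_mat d i j) $$ (r div d', c div d') * S (unit_mat d' k l) $$ (r mod d', c mod d'))"

definition classical_code :: "nat \<Rightarrow> (complex mat \<Rightarrow> complex mat) \<Rightarrow> nat \<Rightarrow> real \<Rightarrow> bool" where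
  "classical_code d T D \<delta> \<longleftrightarrow> D \<ge> 1 \<and> (\<exists>E R. channel D d E \<and> channel d D R \<and>
     (1 / real D) * (\<Sum>i<D. Re ((R \<circ> T \<circ> E) (unit_mat D i i) $$ (i, i))) \<ge> 1 - \<delta>)"

definition phi_plus :: "nat \<Rightarrow> complex vec" where
  "phi_plus D = vec (D * D) (\<lambda>r. if r div D = r mod D then complex_of_real (1 / sqrt (real D)) else 0)"

definition proj_vec :: "complex vec \<Rightarrow> complex mat" where
  "proj_vec v = mat (dim_vec v) (dim_vec v) (\<lambda>(a, b). v $ a * cnj (v $ b))"

definition quantum_code :: "nat \<Rightarrow> (complex mat \<Rightarrow> complex mat) \<Rightarrow> nat \<Rightarrow> real \<Rightarrow> bool" where
  "quantum_code d T D \<delta> \<longleftrightarrow> D \<ge> 1 \<and> (\<exists>E R. channel D d E \<and> channel d D R \<and>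
     Re (conjugate (phi_plus D) \<bullet>
          (id_tensor D D D (R \<circ> T \<circ> E) (proj_vec (phi_plus D)) *\<^sub>v phi_plus D)) \<ge> 1 - \<delta>)"

definition C_cap :: "real \<Rightarrow> nat \<Rightarrow> (complex mat \<Rightarrow> complex mat) \<Rightarrow> real" where
  "C_cap \<delta> d T = Sup {log 2 (real D) | D. classical_code d T D \<delta>}"

definition Q_cap :: "real \<Rightarrow> nat \<Rightarrow> (complex mat \<Rightarrow> complex mat) \<Rightarrow> real" where
  "Q_cap \<delta> d T = Sup {log 2 (real D) | D. quantum_code d T D \<delta>}"

definition C_inf :: "real \<Rightarrow> nat \<Rightarrow> (complex mat \<Rightarrow> complex mat) \<Rightarrow> real" where
  "C_inf \<delta> d T = lim (\<lambda>t. C_cap \<delta> d (T ^^ t))"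

definition Q_inf :: "real \<Rightarrow> nat \<Rightarrow> (complex mat \<Rightarrow> complex mat) \<Rightarrow> real" where
  "Q_inf \<delta> d T = lim (\<lambda>t. Q_cap \<delta> d (T ^^ t))"

end

theory Submission
  imports Defs "HOL-Computational_Algebra.Fundamental_Theorem_Algebra" "HOL-Analysis.L2_Norm"
    "HOL-Library.Nat_Bijection"
begin

text \<open>
  Along suitable times \<open>n k\<close> the powers \<open>T ^^ n k\<close> converge to an idempotent channel \<open>P\<close>, the projection
  onto the peripheral space of \<open>T\<close>, and \<open>P = T ^^ t \<circ> G t\<close> for suitable channels \<open>G t\<close>; hence
  codes for \<open>P\<close> are codes for every power of \<open>T\<close>, and codes for large powers are approximate codes for \<open>P\<close>.
  On the support of \<open>P 1\<close> the commutant of the Kraus operators of \<open>P\<close> is a *-algebra. Its matrix units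
  factor \<open>P\<close> as \<open>J \<circ> F\<close> through block diagonal \<open>r \<times> r\<close> matrices, and \<open>F \<circ> J\<close> is the identity
  on these. By Cauchy-Schwarz applied to Kraus operators, a code of size \<open>D\<close> sent through such a block
  algebra has classical success probability at most \<open>r / D\<close> and entanglement fidelity at most
  \<open>M / D\<close>, where \<open>M\<close> is the size of the largest block. So the two capacities are \<open>log r\<close> and \<open>log M\<close>.
  Choosing the times for \<open>T\<close> and \<open>S\<close> simultaneously, the block structure of \<open>T \<otimes> S\<close> is the product
  of the two block structures, and both \<open>r\<close> and \<open>M\<close> are multiplicative.
\<close>

section \<open>Finitely supported matrices\<close>

text \<open>Code sizes are integers at most \<open>d\<close>. Hence the limits in
  \<open>C_inf\<close> and \<open>Q_inf\<close> are reached after finitely many steps: once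
  \<open>T ^^ n k\<close> is entrywise within 1 / (2 d^5) of its limit, the success bounds read D <=
  r + 1/2 and D <= M + 1/2. No spectral theory of \<open>T\<close> enters. All powers have transfer
  matrices with entries of modulus at most 1, so they converge along a subsequence, and differences
  of its times lead to an idempotent limit. \<open>T\<close> and \<open>S\<close> must use the same
  times, because then the limit for the tensor product is the tensor product of the two limits. The
  obstacle in the structure theory is that \<open>P 1\<close> may be singular. The fixed points of
  the dual map need not be closed under products then; they are so only after compression to the
  support of \<open>P 1\<close>. The relations on the support are obtained by multiplying with
  \<open>P 1\<close>, where further Kraus operators become available, and cancelling it
  again.\<close>

text \<open>Infinite matrices with finite support contain the matrices of all sizes, so products of matrices
  of varying dimensions can be computed in a single (non-unital) ring.\<close>

definition supported :: "nat \<Rightarrow> (nat \<Rightarrow> nat \<Rightarrow> complex) \<Rightarrow> bool" where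
  "supported N f \<longleftrightarrow> (\<forall>i j. f i j \<noteq> 0 \<longrightarrow> i < N \<and> j < N)"

typedef fmat = "{f :: nat \<Rightarrow> nat \<Rightarrow> complex. \<exists>N. supported N f}"
  morphisms ent Fmat
  by (rule exI[of _ "\<lambda>_ _. 0"]) (simp add: supported_def)

setup_lifting type_definition_fmat

lemma fmat_eqI: "(\<And>i j. ent x i j = ent y i j) \<Longrightarrow> x = y"
  by (metis ent_inject ext)

lemma supported_mono: "supported N f \<Longrightarrow> N \<le> M \<Longrightarrow> supported M f"
  by (force simp: supported_def)

lemma supported_ex: "\<exists>N. supported N (ent x)"
  using ent[of x] by simp

lemma supported_ex2: "\<exists>N. supported N (ent x) \<and> supported N (ent y)"
proof -
  obtain N M where "supported N (ent x)" "supported M (ent y)"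
    using supported_ex by blast
  then show ?thesis
    by (meson supported_mono max.cobounded1 max.cobounded2)
qed

lemma supported_ex3: "\<exists>N. supported N (ent x) \<and> supported N (ent y) \<and> supported N (ent z)"
proof -
  obtain N M where "supported N (ent x) \<and> supported N (ent y)" "supported M (ent z)"
    using supported_ex supported_ex2 by blast
  then show ?thesis
    by (meson supported_mono max.cobounded1 max.cobounded2)
qed

text \<open>Summing over the nonzero entries of a row of \<open>f\<close> avoids any dimension
  parameter; the index set is finite as soon as \<open>f\<close> has finite support.\<close>

definition fprod :: "(nat \<Rightarrow> nat \<Rightarrow> complex) \<Rightarrow> (nat \<Rightarrow> nat \<Rightarrow> complex) \<Rightarrow> nat \<Rightarrow> nat \<Rightarrow> complex" where
  "fprod f g i j = (\<Sum>k | f i k \<noteq> 0. f i k * g k j)"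

lemma fprod_supported:
  assumes "supported N f"
  shows "fprod f g i j = (\<Sum>k<N. f i k * g k j)"
  unfolding fprod_def
  by (rule sum.mono_neutral_left) (use assms in \<open>auto simp: supported_def\<close>)

lemma supported_fprod:
  assumes "supported N f" "supported N g"
  shows "supported N (fprod f g)"
  unfolding supported_def
proof (intro allI impI)
  fix i j assume "fprod f g i j \<noteq> 0"
  then have "(\<Sum>k<N. f i k * g k j) \<noteq> 0" using fprod_supported[OF assms(1)] by simp
  then obtain k where "f i k * g k j \<noteq> 0" by (meson sum.neutral)
  then show "i < N \<and> j < N" using assms by (auto simp: supported_def)
qed

instantiation fmat :: ring
begin

lift_definition zero_fmat :: fmat is "\<lambda>_ _. 0"
  by (simp add: supported_def)

lift_definition plus_fmat :: "fmat \<Rightarrow> fmat \<Rightarrow> fmat" is "\<lambda>f g i j. f i j + g i j"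
proof -
  fix f g :: "nat \<Rightarrow> nat \<Rightarrow> complex"
  assume "\<exists>N. supported N f" "\<exists>N. supported N g"
  then obtain N M where "supported N f" "supported M g" by blast
  then have "supported (max N M) (\<lambda>i j. f i j + g i j)"
    unfolding supported_def by (metis add.right_neutral less_max_iff_disj)
  then show "\<exists>N. supported N (\<lambda>i j. f i j + g i j)" by blast
qed

lift_definition uminus_fmat :: "fmat \<Rightarrow> fmat" is "\<lambda>f i j. - f i j"
  by (simp add: supported_def)

definition minus_fmat :: "fmat \<Rightarrow> fmat \<Rightarrow> fmat" where
  "minus_fmat x y = x + (- y)"

lift_definition times_fmat :: "fmat \<Rightarrow> fmat \<Rightarrow> fmat" is fprod
proof -
  fix f g :: "nat \<Rightarrow> nat \<Rightarrow> complex"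
  assume "\<exists>N. supported N f" "\<exists>N. supported N g"
  then obtain N M where "supported N f" "supported M g" by blast
  then have "supported (max N M) (fprod f g)"
    by (meson supported_fprod supported_mono max.cobounded1 max.cobounded2)
  then show "\<exists>N. supported N (fprod f g)" by blast
qed

instance
proof
  fix a b c :: fmat
  show "a + b + c = a + (b + c)" by transfer (simp add: add.assoc)
  show "a + b = b + a" by transfer (simp add: add.commute)
  show "0 + a = a" by transfer simp
  show "- a + a = 0" by transfer simp
  show "a - b = a + - b" by (rule minus_fmat_def)
  obtain N where N: "supported N (ent a)" "supported N (ent b)" "supported N (ent c)"
    using supported_ex3 by blast
  show "a * b * c = a * (b * c)"
  proof (rule fmat_eqI)
    fix i j
    have "ent (a * b * c) i j = (\<Sum>k<N. (\<Sum>l<N. ent a i l * ent b l k) * ent c k j)"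
      by (simp add: times_fmat.rep_eq fprod_supported[OF N(1)]
          fprod_supported[OF supported_fprod[OF N(1,2)]])
    also have "\<dots> = (\<Sum>l<N. ent a i l * (\<Sum>k<N. ent b l k * ent c k j))"
      unfolding sum_distrib_left sum_distrib_right mult.assoc by (rule sum.swap)
    also have "\<dots> = ent (a * (b * c)) i j"
      by (simp add: times_fmat.rep_eq fprod_supported[OF N(1)] fprod_supported[OF N(2)])
    finally show "ent (a * b * c) i j = ent (a * (b * c)) i j" .
  qed
  obtain M where M: "supported M (ent (a + b))" "supported M (ent a)" "supported M (ent b)"
    using supported_ex3 by blast
  show "(a + b) * c = a * c + b * c"
  proof (rule fmat_eqI)
    fix i j
    show "ent ((a + b) * c) i j = ent (a * c + b * c) i j"
      unfolding times_fmat.rep_eq plus_fmat.rep_eq[of "a * c"] fprod_supported[OF M(1)]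
        fprod_supported[OF M(2)] fprod_supported[OF M(3)]
      by (simp add: plus_fmat.rep_eq sum.distrib distrib_right)
  qed
  show "a * (b + c) = a * b + a * c"
    by (rule fmat_eqI) (simp add: times_fmat.rep_eq plus_fmat.rep_eq fprod_supported[OF N(1)]
        sum.distrib distrib_left)
qed

end

section \<open>Entries, sizes, adjoint and trace\<close>

lemma ent_zero [simp]: "ent 0 i j = 0" by (simp add: zero_fmat.rep_eq)
lemma ent_add [simp]: "ent (x + y) i j = ent x i j + ent y i j" by (simp add: plus_fmat.rep_eq)
lemma ent_uminus [simp]: "ent (- x) i j = - ent x i j" by (simp add: uminus_fmat.rep_eq)
lemma ent_diff [simp]: "ent (x - y) i j = ent x i j - ent y i j"
  unfolding minus_fmat_def ent_add ent_uminus by simp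
lemma ent_sum [simp]: "ent (sum f A) i j = (\<Sum>a\<in>A. ent (f a) i j)"
  by (induction A rule: infinite_finite_induct) auto

lift_definition scl :: "complex \<Rightarrow> fmat \<Rightarrow> fmat" is "\<lambda>c f i j. c * f i j"
  by (auto simp: supported_def)

lift_definition adj :: "fmat \<Rightarrow> fmat" is "\<lambda>f i j. cnj (f j i)"
  by (auto simp: supported_def)

lift_definition idm :: "nat \<Rightarrow> fmat" is "\<lambda>n i j. if i < n \<and> i = j then 1 else 0"
  by (auto simp: supported_def)

lift_definition munit :: "nat \<Rightarrow> nat \<Rightarrow> fmat" is "\<lambda>a b i j. if i = a \<and> j = b then 1 else 0"
proof -
  fix a b :: nat
  have "supported (Suc (max a b)) (\<lambda>i j. if i = a \<and> j = b then 1 else 0)"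
    by (auto simp: supported_def)
  then show "\<exists>N. supported N (\<lambda>i j. if i = a \<and> j = b then 1 else (0::complex))" by blast
qed

definition trc :: "fmat \<Rightarrow> complex" where
  "trc x = (\<Sum>i | ent x i i \<noteq> 0. ent x i i)"

text \<open>Size is a predicate, not part of the type: a matrix of size m x n also lies in every
  larger \<open>Mat\<close>, padded by zeros.\<close>

definition Mat :: "nat \<Rightarrow> nat \<Rightarrow> fmat set" where
  "Mat m n = {x. \<forall>i j. ent x i j \<noteq> 0 \<longrightarrow> i < m \<and> j < n}"

lemma ent_scl [simp]: "ent (scl c x) i j = c * ent x i j" by (simp add: scl.rep_eq)
lemma ent_adj [simp]: "ent (adj x) i j = cnj (ent x j i)" by (simp add: adj.rep_eq)
lemma ent_idm: "ent (idm n) i j = (if i < n \<and> i = j then 1 else 0)" by (simp add: idm.rep_eq)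
lemma ent_munit: "ent (munit a b) i j = (if i = a \<and> j = b then 1 else 0)" by (simp add: munit.rep_eq)

lemma supported_Mat: "supported N (ent x) \<longleftrightarrow> x \<in> Mat N N"
  by (auto simp: supported_def Mat_def)

lemma Mat_ex: "\<exists>N. x \<in> Mat N N" using supported_ex supported_Mat by blast

lemma Mat_ex2: "\<exists>N. x \<in> Mat N N \<and> y \<in> Mat N N" using supported_ex2 supported_Mat by simp

lemma ent_mult_left:
  assumes "x \<in> Mat m n" shows "ent (x * y) i j = (\<Sum>k<n. ent x i k * ent y k j)"
  unfolding times_fmat.rep_eq fprod_def
  by (rule sum.mono_neutral_left) (use assms in \<open>auto simp: Mat_def\<close>)

lemma ent_mult_right:
  assumes "y \<in> Mat n m" shows "ent (x * y) i j = (\<Sum>k<n. ent x i k * ent y k j)"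
proof -
  obtain N where N: "x \<in> Mat N N" using Mat_ex by blast
  have "ent (x * y) i j = (\<Sum>k<N. ent x i k * ent y k j)" by (rule ent_mult_left[OF N])
  also have "\<dots> = (\<Sum>k<n. ent x i k * ent y k j)"
    by (rule sum.mono_neutral_cong) (use N assms in \<open>auto simp: Mat_def not_less[symmetric]\<close>)
  finally show ?thesis .
qed

lemma trc_Mat: "x \<in> Mat m n \<Longrightarrow> trc x = (\<Sum>i<m. ent x i i)"
  unfolding trc_def by (rule sum.mono_neutral_left) (auto simp: Mat_def)

lemma Mat_zero [simp]: "0 \<in> Mat m n" by (simp add: Mat_def)
lemma Mat_add: "x \<in> Mat m n \<Longrightarrow> y \<in> Mat m n \<Longrightarrow> x + y \<in> Mat m n"
  unfolding Mat_def mem_Collect_eq ent_add by (metis add.right_neutral)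
lemma Mat_uminus: "x \<in> Mat m n \<Longrightarrow> - x \<in> Mat m n"
  by (simp add: Mat_def)
lemma Mat_diff: "x \<in> Mat m n \<Longrightarrow> y \<in> Mat m n \<Longrightarrow> x - y \<in> Mat m n"
  unfolding minus_fmat_def by (intro Mat_add Mat_uminus)
lemma Mat_scl: "x \<in> Mat m n \<Longrightarrow> scl c x \<in> Mat m n"
  by (auto simp: Mat_def)
lemma Mat_adj: "x \<in> Mat m n \<Longrightarrow> adj x \<in> Mat n m"
  by (auto simp: Mat_def)
lemma Mat_mult: "x \<in> Mat m n \<Longrightarrow> y \<in> Mat n k \<Longrightarrow> x * y \<in> Mat m k"
proof -
  assume a: "x \<in> Mat m n" "y \<in> Mat n k"
  show ?thesis unfolding Mat_def
  proof (safe, goal_cases)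
    case (1 i j)
    then show ?case unfolding ent_mult_left[OF a(1)] using a(1) by (auto simp: Mat_def elim!: sum.not_neutral_contains_not_neutral)
  next
    case (2 i j)
    then show ?case unfolding ent_mult_left[OF a(1)] using a(2) by (auto simp: Mat_def elim!: sum.not_neutral_contains_not_neutral)
  qed
qed
lemma Mat_sum: "(\<And>a. a \<in> A \<Longrightarrow> f a \<in> Mat m n) \<Longrightarrow> sum f A \<in> Mat m n"
  by (induction A rule: infinite_finite_induct) (auto intro: Mat_add)
lemma Mat_idm: "idm n \<in> Mat n n"
  by (auto simp: Mat_def ent_idm split: if_splits)

lemma idm_mult [simp]: "x \<in> Mat m n \<Longrightarrow> idm m * x = x"
proof (rule fmat_eqI)
  fix i j assume x: "x \<in> Mat m n"
  have "ent (idm m * x) i j = (if i < m then ent x i j else 0)"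
    by (simp add: ent_mult_left[OF Mat_idm] ent_idm if_distrib if_distribR cong: if_cong)
  then show "ent (idm m * x) i j = ent x i j" using x by (auto simp: Mat_def)
qed
lemma mult_idm [simp]: "x \<in> Mat m n \<Longrightarrow> x * idm n = x"
  by (rule fmat_eqI) (auto simp: ent_mult_right[OF Mat_idm] ent_idm Mat_def if_distrib if_distribR cong: if_cong)

lemma scl_add_right: "scl c (x + y) = scl c x + scl c y"
  by (rule fmat_eqI) (simp add: distrib_left)
lemma scl_add_left: "scl (a + b) x = scl a x + scl b x"
  by (rule fmat_eqI) (simp add: distrib_right)
lemma scl_scl [simp]: "scl a (scl b x) = scl (a * b) x"
  by (rule fmat_eqI) simp
lemma scl_one [simp]: "scl 1 x = x"
  by (rule fmat_eqI) simp
lemma scl_zero_left [simp]: "scl 0 x = 0"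
  by (rule fmat_eqI) simp
lemma scl_zero_right [simp]: "scl c 0 = 0"
  by (rule fmat_eqI) simp
lemma scl_minus_left: "scl (- c) x = - scl c x"
  by (rule fmat_eqI) simp
lemma scl_eq_0_iff [simp]: "scl c x = 0 \<longleftrightarrow> c = 0 \<or> x = 0"
proof
  assume "scl c x = 0"
  moreover have "scl (inverse c) (scl c x) = x" if "c \<noteq> 0" using that by simp
  ultimately show "c = 0 \<or> x = 0" by (metis scl_zero_right)
qed auto
lemma scl_mult_left [simp]: "scl c x * y = scl c (x * y)"
proof (rule fmat_eqI)
  fix i j
  obtain N where "x \<in> Mat N N" using Mat_ex by blast
  then show "ent (scl c x * y) i j = ent (scl c (x * y)) i j"
    by (simp add: ent_mult_left[of _ N N] Mat_scl sum_distrib_left mult.assoc)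
qed
lemma scl_mult_right [simp]: "x * scl c y = scl c (x * y)"
proof (rule fmat_eqI)
  fix i j
  obtain N where "x \<in> Mat N N" using Mat_ex by blast
  then show "ent (x * scl c y) i j = ent (scl c (x * y)) i j"
    by (simp add: ent_mult_left[of _ N N] sum_distrib_left mult.left_commute)
qed

lemma adj_adj [simp]: "adj (adj x) = x" by (rule fmat_eqI) simp
lemma adj_zero [simp]: "adj 0 = 0" by (rule fmat_eqI) simp
lemma adj_add [simp]: "adj (x + y) = adj x + adj y" by (rule fmat_eqI) simp
lemma adj_diff [simp]: "adj (x - y) = adj x - adj y" by (rule fmat_eqI) simp
lemma adj_scl [simp]: "adj (scl c x) = scl (cnj c) (adj x)" by (rule fmat_eqI) simp
lemma adj_idm [simp]: "adj (idm n) = idm n" by (rule fmat_eqI) (auto simp: ent_idm)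
lemma adj_sum: "adj (sum f A) = (\<Sum>a\<in>A. adj (f a))" by (rule fmat_eqI) simp
lemma adj_mult [simp]: "adj (x * y) = adj y * adj x"
proof (rule fmat_eqI)
  fix i j
  obtain N where N: "x \<in> Mat N N" "y \<in> Mat N N" using Mat_ex2 by blast
  show "ent (adj (x * y)) i j = ent (adj y * adj x) i j"
    by (simp add: ent_mult_left[OF N(1)] ent_mult_left[OF Mat_adj[OF N(2)]] mult.commute)
qed

lemma trc_zero [simp]: "trc 0 = 0" by (simp add: trc_def)
lemma trc_add: "trc (x + y) = trc x + trc y"
proof -
  obtain N where N: "x \<in> Mat N N" "y \<in> Mat N N" using Mat_ex2 by blast
  show ?thesis
    by (simp add: trc_Mat[OF N(1)] trc_Mat[OF N(2)]
       trc_Mat[OF Mat_add[OF N]] sum.distrib)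
qed
lemma trc_sum: "trc (sum f A) = (\<Sum>a\<in>A. trc (f a))"
  by (induction A rule: infinite_finite_induct) (auto simp: trc_add)
lemma trc_scl [simp]: "trc (scl c x) = c * trc x"
proof -
  obtain N where N: "x \<in> Mat N N" using Mat_ex by blast
  show ?thesis
    by (simp add: trc_Mat[OF N] trc_Mat[OF Mat_scl[OF N]] sum_distrib_left)
qed
lemma trc_uminus: "trc (- x) = - trc x"
  by (metis scl_minus_left scl_one trc_scl mult_minus1)
lemma trc_diff: "trc (x - y) = trc x - trc y"
  unfolding minus_fmat_def trc_add trc_uminus by simp
lemma trc_mult_commute: "trc (x * y) = trc (y * x)"
proof -
  obtain N where N: "x \<in> Mat N N" "y \<in> Mat N N" using Mat_ex2 by blast
  have "trc (x * y) = (\<Sum>i<N. \<Sum>k<N. ent x i k * ent y k i)"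
    by (simp add: trc_Mat[OF Mat_mult[OF N]] ent_mult_left[OF N(1)])
  also have "\<dots> = (\<Sum>k<N. \<Sum>i<N. ent y k i * ent x i k)"
    by (subst sum.swap) (simp add: mult.commute)
  also have "\<dots> = trc (y * x)"
    by (simp add: trc_Mat[OF Mat_mult[OF N(2,1)]] ent_mult_left[OF N(2)])
  finally show ?thesis .
qed

section \<open>The squared Hilbert-Schmidt norm\<close>

lemma trc_adj_mult_self:
  assumes "x \<in> Mat m n"
  shows "trc (adj x * x) = of_real (\<Sum>j<n. \<Sum>i<m. (cmod (ent x i j))\<^sup>2)"
proof -
  have "trc (adj x * x) = (\<Sum>j<n. \<Sum>i<m. cnj (ent x i j) * ent x i j)"
    by (simp add: trc_Mat[OF Mat_mult[OF Mat_adj[OF assms] assms]] ent_mult_right[OF assms])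
  also have "\<dots> = of_real (\<Sum>j<n. \<Sum>i<m. (cmod (ent x i j))\<^sup>2)"
    unfolding of_real_sum complex_norm_square by (simp add: mult.commute)
  finally show ?thesis .
qed

text \<open>The Hilbert-Schmidt norm without the root. On projections it is the trace, and so it
  measures rank.\<close>

definition nrm :: "fmat \<Rightarrow> real" where "nrm x = Re (trc (adj x * x))"

lemma trc_adj_mult: "trc (adj x * x) = of_real (nrm x)"
proof -
  obtain N where N: "x \<in> Mat N N" using Mat_ex by blast
  show ?thesis by (simp add: trc_adj_mult_self[OF N] nrm_def del: of_real_sum)
qed

lemma nrm_Mat: "x \<in> Mat m n \<Longrightarrow> nrm x = (\<Sum>j<n. \<Sum>i<m. (cmod (ent x i j))\<^sup>2)"
  by (simp add: nrm_def trc_adj_mult_self)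

lemma nrm_nonneg: "nrm x \<ge> 0"
proof -
  obtain N where N: "x \<in> Mat N N" using Mat_ex by blast
  show ?thesis unfolding nrm_Mat[OF N] by (intro sum_nonneg) auto
qed

lemma nrm_eq_0_iff: "nrm x = 0 \<longleftrightarrow> x = 0"
proof
  assume a: "nrm x = 0"
  obtain N where N: "x \<in> Mat N N" using Mat_ex by blast
  have "\<forall>j<N. \<forall>i<N. ent x i j = 0"
    using a unfolding nrm_Mat[OF N] by (simp add: sum_nonneg_eq_0_iff sum_nonneg)
  then have "ent x i j = 0" for i j using N unfolding Mat_def by blast
  then show "x = 0" by (intro fmat_eqI) simp
qed (simp add: nrm_def)

lemma adj_mult_self_eq_0: "adj x * x = 0 \<Longrightarrow> x = 0"
  using nrm_eq_0_iff[of x] by (simp add: nrm_def)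

text \<open>The traces of the summands are nonnegative and add up to 0. This turns one operator
  identity into an identity for each single Kraus operator.\<close>

lemma sum_adj_mult_self_eq_0:
  assumes "finite A" "(\<Sum>a\<in>A. adj (f a) * f a) = 0" "a \<in> A"
  shows "f a = 0"
proof -
  have "(\<Sum>a\<in>A. nrm (f a)) = Re (trc (\<Sum>a\<in>A. adj (f a) * f a))"
    by (simp add: nrm_def trc_sum)
  then have "(\<Sum>a\<in>A. nrm (f a)) = 0" using assms(2) by simp
  then show ?thesis using assms(1,3) by (simp add: sum_nonneg_eq_0_iff nrm_nonneg nrm_eq_0_iff)
qed

lemma complex_Cauchy_Schwarz_sum:
  fixes f g :: "'a \<Rightarrow> complex"
  shows "(cmod (\<Sum>k\<in>A. f k * g k))\<^sup>2 \<le> (\<Sum>k\<in>A. (cmod (f k))\<^sup>2) * (\<Sum>k\<in>A. (cmod (g k))\<^sup>2)"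
proof -
  have "cmod (\<Sum>k\<in>A. f k * g k) \<le> (\<Sum>k\<in>A. \<bar>cmod (f k)\<bar> * \<bar>cmod (g k)\<bar>)"
    by (rule order.trans[OF norm_sum]) (simp add: norm_mult)
  also have "\<dots> \<le> L2_set (\<lambda>k. cmod (f k)) A * L2_set (\<lambda>k. cmod (g k)) A"
    by (rule L2_set_mult_ineq)
  finally have "(cmod (\<Sum>k\<in>A. f k * g k))\<^sup>2
      \<le> (L2_set (\<lambda>k. cmod (f k)) A * L2_set (\<lambda>k. cmod (g k)) A)\<^sup>2"
    by (simp add: power_mono)
  then show ?thesis
    by (simp add: power_mult_distrib L2_set_def sum_nonneg)
qed

lemma nrm_mult_le: "nrm (x * y) \<le> nrm x * nrm y"
proof -
  obtain N where N: "x \<in> Mat N N" "y \<in> Mat N N" using Mat_ex2 by blast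
  have "nrm (x * y) = (\<Sum>j<N. \<Sum>i<N. (cmod (\<Sum>k<N. ent x i k * ent y k j))\<^sup>2)"
    by (simp add: nrm_Mat[OF Mat_mult[OF N]] ent_mult_left[OF N(1)])
  also have "\<dots> \<le> (\<Sum>j<N. \<Sum>i<N. (\<Sum>k<N. (cmod (ent x i k))\<^sup>2) * (\<Sum>k<N. (cmod (ent y k j))\<^sup>2))"
    by (intro sum_mono complex_Cauchy_Schwarz_sum)
  also have "\<dots> = (\<Sum>i<N. \<Sum>k<N. (cmod (ent x i k))\<^sup>2) * (\<Sum>j<N. \<Sum>k<N. (cmod (ent y k j))\<^sup>2)"
    by (subst sum_product) (rule sum.swap)
  also have "(\<Sum>i<N. \<Sum>k<N. (cmod (ent x i k))\<^sup>2) = nrm x"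
    unfolding nrm_Mat[OF N(1)] by (rule sum.swap)
  also have "(\<Sum>j<N. \<Sum>k<N. (cmod (ent y k j))\<^sup>2) = nrm y"
    unfolding nrm_Mat[OF N(2)] ..
  finally show ?thesis .
qed

section \<open>Eigenprojections of Hermitian matrices\<close>

interpretation fmat: vector_space scl
  by unfold_locales (simp_all add: scl_add_right scl_add_left)

text \<open>Polynomial evaluation at \<open>x\<close> with \<open>p\<close> in the place of 1, as
  the ring has no unit. For a projection \<open>p\<close> this is the polynomial calculus in the
  corner with unit \<open>p\<close>.\<close>

definition pev :: "fmat \<Rightarrow> fmat \<Rightarrow> complex poly \<Rightarrow> fmat" where
  "pev p x q = fold_coeffs (\<lambda>a z. scl a p + x * z) q 0"

lemma pev_0 [simp]: "pev p x 0 = 0"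
  by (simp add: pev_def)

lemma pev_pCons [simp]: "pev p x (pCons a q) = scl a p + x * pev p x q"
proof (cases "a = 0 \<and> q = 0")
  case False
  then show ?thesis unfolding pev_def by auto
qed simp

lemma pev_add: "pev p x (q + r) = pev p x q + pev p x r"
  by (induction q r rule: poly_induct2) (simp_all add: scl_add_left algebra_simps)

lemma pev_smult: "pev p x (smult c q) = scl c (pev p x q)"
  by (induction q) (simp_all add: scl_add_right)

lemma pev_sum: "pev p x (sum f A) = (\<Sum>a\<in>A. pev p x (f a))"
  by (induction A rule: infinite_finite_induct) (simp_all add: pev_add)

lemma pev_diff: "pev p x (q - r) = pev p x q - pev p x r"
proof -
  have "pev p x q = pev p x (q - r) + pev p x r" by (simp flip: pev_add)
  then show ?thesis by simp
qed

lemma pev_linear_mult: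
  assumes "p * p = p" "p * x = x"
  shows "pev p x ([:- c, 1:] * q) = (x - scl c p) * pev p x q"
proof -
  have "p * pev p x q = pev p x q"
    by (induction q) (simp_all add: assms distrib_left flip: mult.assoc)
  then show ?thesis
    by (simp add: pev_add pev_smult pev_diff left_diff_distrib scl_minus_left)
qed

lemma pev_eigen:
  assumes "p * z = z" "x * z = scl c z"
  shows "pev p x q * z = scl (poly q c) z"
  by (induction q) (simp_all add: assms distrib_right mult.assoc scl_add_left mult.commute)

text \<open>Eigenprojections are produced as polynomials in \<open>x\<close>; this keeps them inside
  the algebra that contains \<open>p\<close> and \<open>x\<close>.\<close>

lemma pev_closed:
  assumes "p \<in> A" "x \<in> A" "0 \<in> A" "\<And>a b. a \<in> A \<Longrightarrow> b \<in> A \<Longrightarrow> a + b \<in> A"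
    "\<And>a b. a \<in> A \<Longrightarrow> b \<in> A \<Longrightarrow> a * b \<in> A" "\<And>c a. a \<in> A \<Longrightarrow> scl c a \<in> A"
  shows "pev p x q \<in> A"
  by (induction q) (simp_all add: assms)

lemma pev_commute:
  assumes "p * x = x" "x * p = x"
  shows "x * pev p x q = pev p x q * x"
proof (induction q)
  case (pCons a q)
  have "x * (x * pev p x q) = (x * pev p x q) * x" using pCons.IH by (metis mult.assoc)
  then show ?case by (simp add: assms distrib_left distrib_right)
qed simp

lemma Mat_subset_span: "Mat d d \<subseteq> fmat.span ((\<lambda>(i, j). munit i j) ` ({..<d} \<times> {..<d}))"
proof
  fix x assume x: "x \<in> Mat d d"
  have "x = (\<Sum>i<d. \<Sum>j<d. scl (ent x i j) (munit i j))" (is "_ = ?y")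
  proof (rule fmat_eqI)
    fix a b
    have "ent ?y a b = (\<Sum>i<d. if a = i then \<Sum>j<d. (if b = j then ent x i j else 0) else 0)"
      unfolding ent_sum ent_scl ent_munit
        by (intro sum.cong refl) (auto simp: if_distrib cong: if_cong)
    also have "\<dots> = (if a < d \<and> b < d then ent x a b else 0)" by simp
    finally show "ent x a b = ent ?y a b" using x by (auto simp: Mat_def)
  qed
  also have "\<dots> \<in> fmat.span ((\<lambda>(i, j). munit i j) ` ({..<d} \<times> {..<d}))"
    by (intro fmat.span_sum fmat.span_scale fmat.span_base) auto
  finally show "x \<in> fmat.span ((\<lambda>(i, j). munit i j) ` ({..<d} \<times> {..<d}))" .
qed

text \<open>Otherwise d^2 + 1 powers of \<open>x\<close> would be linearly independent within the
  span of the d^2 matrix units.\<close>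

lemma annihilating_poly_exists:
  assumes "p \<in> Mat d d" "x \<in> Mat d d"
  shows "\<exists>q. q \<noteq> 0 \<and> pev p x q = 0"
proof (rule ccontr)
  assume "\<not> ?thesis"
  then have nz: "pev p x q \<noteq> 0" if "q \<noteq> 0" for q using that by blast
  define w where "w k = pev p x (monom 1 k)" for k
  \<comment> \<open>Dependence is a property of sets of vectors, so the powers must be known to be
    distinct before they can be counted.\<close>
  have inj: "inj_on w S" for S
  proof (rule inj_onI, rule ccontr)
    fix k l assume "w k = w l" "k \<noteq> l"
    then have "pev p x (monom 1 k - monom 1 l) = 0" by (simp add: w_def pev_diff)
    moreover have "coeff (monom 1 k - monom 1 l :: complex poly) k = 1" using \<open>k \<noteq> l\<close> by simp
    then have "(monom 1 k - monom 1 l :: complex poly) \<noteq> 0" by (metis coeff_0 zero_neq_one)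
    ultimately show False using nz by blast
  qed
  define N where "N = Suc (d * d)"
  have "\<not> fmat.dependent (w ` {..<N})"
  proof
    assume "fmat.dependent (w ` {..<N})"
    then obtain u v where v: "v \<in> w ` {..<N}" "u v \<noteq> 0" and s: "(\<Sum>v\<in>w ` {..<N}. scl (u v) v) = 0"
      by (auto simp: fmat.dependent_finite)
    define q where "q = (\<Sum>k<N. smult (u (w k)) (monom 1 k))"
    have "pev p x q = (\<Sum>k<N. scl (u (w k)) (w k))"
      by (simp only: q_def pev_sum pev_smult w_def)
    also have "\<dots> = 0" using s by (simp add: sum.reindex[OF inj])
    finally have "q = 0" using nz by blast
    obtain k where k: "k < N" "u (w k) \<noteq> 0" using v by blast
    have "coeff q k = (\<Sum>l<N. if l = k then u (w l) else 0)"
      unfolding q_def coeff_sum by (rule sum.cong) auto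
    also have "\<dots> = u (w k)" using k(1) by simp
    finally show False using k(2) \<open>q = 0\<close> by simp
  qed
  moreover have "w k \<in> Mat d d" for k
    unfolding w_def using assms by (intro pev_closed) (auto intro: Mat_add Mat_mult Mat_scl)
  then have "w ` {..<N} \<subseteq> fmat.span ((\<lambda>(i, j). munit i j) ` ({..<d} \<times> {..<d}))"
    using Mat_subset_span by blast
  ultimately have "card (w ` {..<N}) \<le> card ((\<lambda>(i, j). munit i j) ` ({..<d} \<times> {..<d}))"
    using fmat.independent_span_bound by (metis finite_SigmaI finite_imageI finite_lessThan)
  also have "\<dots> \<le> d * d"
    by (rule order.trans[OF card_image_le]) auto
  finally show False by (simp add: card_image[OF inj] N_def)
qed

section \<open>Minimal polynomials and eigenprojections\<close>

definition minpoly :: "fmat \<Rightarrow> fmat \<Rightarrow> complex poly \<Rightarrow> bool" where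
  "minpoly p x q \<longleftrightarrow> q \<noteq> 0 \<and> pev p x q = 0 \<and> (\<forall>g. g \<noteq> 0 \<longrightarrow> pev p x g = 0 \<longrightarrow> degree q \<le> degree g)"

lemma minpoly_exists:
  assumes "p \<in> Mat d d" "x \<in> Mat d d"
  shows "\<exists>q. minpoly p x q"
proof -
  obtain q where q: "q \<noteq> 0 \<and> pev p x q = 0" using annihilating_poly_exists[OF assms] by blast
  show ?thesis
    using ex_has_least_nat[of "\<lambda>q. q \<noteq> 0 \<and> pev p x q = 0" q degree] q
    unfolding minpoly_def by blast
qed

lemma minpoly_root_exists:
  assumes "minpoly p x q" "p \<noteq> 0"
  shows "\<exists>c. poly q c = 0"
proof -
  have "degree q \<noteq> 0"
  proof
    assume "degree q = 0"
    then obtain a where "q = [:a:]" by (metis degree_eq_zeroE)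
    then show False using assms by (auto simp: minpoly_def)
  qed
  then show ?thesis using fundamental_theorem_of_algebra[of q] constant_degree[of q] by auto
qed

definition proj :: "fmat \<Rightarrow> bool" where "proj p \<longleftrightarrow> p * p = p \<and> adj p = p"

text \<open>Dividing the minimal polynomial by X - c leaves \<open>g\<close> with g(x) nonzero and
  killed by x - c. Since \<open>x\<close> is Hermitian, c is a real simple root, so \<open>g\<close>
  can be scaled to have value 1 at c; its value at \<open>x\<close> is then a projection onto
  eigenvectors.\<close>

lemma minpoly_root_projection:
  assumes p: "proj p" and x: "adj x = x" "p * x = x" "x * p = x"
    and q: "minpoly p x q" and c: "poly q c = 0"
  shows "\<exists>g. proj (pev p x g) \<and> pev p x g \<noteq> 0 \<and> x * pev p x g = scl c (pev p x g) \<and> poly g c = 1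
           \<and> p * pev p x g = pev p x g"
proof -
  have pp: "p * p = p" "adj p = p" using p by (auto simp: proj_def)
  obtain g where g: "q = [:- c, 1:] * g" using c by (metis dvdE poly_eq_0_iff_dvd)
  have q0: "q \<noteq> 0" "pev p x q = 0" using q by (auto simp: minpoly_def)
  have g0: "g \<noteq> 0" using q0 g by auto
  have "degree q = Suc (degree g)" using g0 by (simp add: g degree_mult_eq del: mult_pCons_left)
  then have small: "pev p x h \<noteq> 0" if "h \<noteq> 0" "degree h \<le> degree g" for h
    using q that unfolding minpoly_def by (metis not_less_eq_eq order.trans)
  define z where "z = pev p x g"
  have z0: "z \<noteq> 0" using small[of g] g0 by (simp add: z_def)
  have pz: "p * pev p x h = pev p x h" for h
    by (induction h) (simp_all add: pp x distrib_left flip: mult.assoc)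
  have "(x - scl c p) * z = 0"
    using q0(2) unfolding g pev_linear_mult[OF pp(1) x(2)] z_def .
  then have xz: "x * z = scl c z" using pz by (simp add: left_diff_distrib z_def)
  have zz: "adj z * z \<noteq> 0" using z0 adj_mult_self_eq_0 by blast
  have "adj (adj z * (x * z)) = adj z * (x * z)" by (simp add: x mult.assoc)
  then have "scl (cnj c) (adj z * z) = scl c (adj z * z)" by (simp add: xz)
  \<comment> \<open>\<open>adj z * x * z\<close> is Hermitian and equals c times the nonzero
    Hermitian \<open>adj z * z\<close>.\<close>
  then have cr: "cnj c = c" using zz by (metis fmat.scale_right_imp_eq)
  \<comment> \<open>A double root would make \<open>z\<close> a multiple of \<open>y\<close> on the
    left while \<open>y * z = 0\<close>; as \<open>y\<close> is Hermitian, \<open>adj z * z\<close>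
    would vanish.\<close>
  have gc: "poly g c \<noteq> 0"
  proof
    assume "poly g c = 0"
    then obtain h where h: "g = [:- c, 1:] * h" by (metis dvdE poly_eq_0_iff_dvd)
    define y where "y = x - scl c p"
    have ya: "adj y = y" by (simp add: y_def x pp cr)
    have "z = y * pev p x h" unfolding z_def h y_def by (rule pev_linear_mult[OF pp(1) x(2)])
    moreover have "y * z = 0" using \<open>(x - scl c p) * z = 0\<close> by (simp add: y_def)
    ultimately have "adj z * z = 0" by (simp add: ya mult.assoc)
    then show False using zz by simp
  qed
  define f where "f = smult (1 / poly g c) g"
  define e where "e = pev p x f"
  have e: "e = scl (1 / poly g c) z" by (simp add: e_def f_def pev_smult z_def)
  have fc: "poly f c = 1" using gc by (simp add: f_def)
  have e0: "e \<noteq> 0" using z0 gc by (simp add: e)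
  have xe: "x * e = scl c e" by (simp add: e xz mult.commute)
  have pe: "p * e = e" unfolding e_def by (rule pz)
  have "x * e = e * x" unfolding e_def by (rule pev_commute[OF x(2,3)])
  then have "adj e * x = x * adj e" using x(1) by (metis adj_mult)
  moreover have "adj e * x = scl c (adj e)" using arg_cong[OF xe, of adj] by (simp add: x cr)
  ultimately have xae: "x * adj e = scl c (adj e)" by simp
  have "e * p = e" unfolding e_def by (induction f) (simp_all add: pp x distrib_right mult.assoc)
  then have pae: "p * adj e = adj e" by (metis adj_mult pp(2))
  \<comment> \<open>\<open>adj e\<close> consists of eigenvectors too, and \<open>e\<close> acts on
    these as f(c) = 1. As \<open>e * adj e\<close> is self-adjoint, so is \<open>e\<close>.\<close>
  have "e * adj e = adj e" using pev_eigen[OF pae xae, of f] by (simp add: e_def fc)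
  then have "adj e = e" by (metis adj_adj adj_mult)
  moreover have "e * e = e" using pev_eigen[OF pe xe, of f] by (simp add: fc flip: e_def)
  ultimately have "proj e" by (simp add: proj_def)
  then show ?thesis using e0 xe fc pe unfolding e_def by blast
qed

text \<open>If 0 is not a root of the minimal polynomial, \<open>x\<close> is invertible and the
  support is \<open>idm d\<close>; otherwise it is the complement of the eigenprojection for 0. The
  factorisation \<open>s = x * h\<close> is what later lets \<open>x\<close> be cancelled on the
  right.\<close>

lemma support_projection_exists:
  assumes "x \<in> Mat d d" "adj x = x"
  shows "\<exists>s h. proj s \<and> s \<in> Mat d d \<and> x * s = x \<and> s = x * h"
proof -
  obtain q where q: "minpoly (idm d) x q" using minpoly_exists[OF Mat_idm assms(1)] by blast
  have pr: "proj (idm d)" by (simp add: proj_def mult_idm[OF Mat_idm])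
  have x: "idm d * x = x" "x * idm d = x" using assms(1) by auto
  show ?thesis
  proof (cases "poly q 0 = 0")
    case False
    obtain a r where ar: "q = pCons a r" by (cases q)
    then have a: "a \<noteq> 0" using False by simp
    have "scl a (idm d) + x * pev (idm d) x r = 0" using q ar by (simp add: minpoly_def)
    then have "scl (1 / a) (scl a (idm d) + x * pev (idm d) x r) = 0" by simp
    then have "idm d = x * scl (- 1 / a) (pev (idm d) x r)"
      using a by (simp add: scl_add_right scl_minus_left add_eq_0_iff2 del: scl_eq_0_iff)
    then show ?thesis using pr x Mat_idm by blast
  next
    case True
    obtain g where g: "proj (pev (idm d) x g)" "x * pev (idm d) x g = 0" "poly g 0 = 1"
      "idm d * pev (idm d) x g = pev (idm d) x g"
      using minpoly_root_projection[OF pr assms(2) x q True] by auto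
    define e where "e = pev (idm d) x g"
    have eM: "e \<in> Mat d d"
      unfolding e_def using assms(1) by (intro pev_closed) (auto intro: Mat_add Mat_mult Mat_scl Mat_idm)
    obtain a r where ar: "g = pCons a r" by (cases g)
    then have a: "a = 1" using g by simp
    \<comment> \<open>The constant coefficient of \<open>g\<close> is g(0) = 1, so 1 - g is
      divisible by X.\<close>
    have "idm d - e = x * (- pev (idm d) x r)" unfolding e_def ar a by simp
    moreover have "proj (idm d - e)" "x * (idm d - e) = x"
      using g(1,2) eM x pr by (auto simp: proj_def right_diff_distrib left_diff_distrib simp flip: e_def)
    ultimately show ?thesis using Mat_diff[OF Mat_idm eM] by metis
  qed
qed

section \<open>Matrix units in *-algebras\<close>

lemma nrm_proj: "proj p \<Longrightarrow> trc p = of_real (nrm p)"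
  by (metis proj_def trc_adj_mult)

text \<open>Submultiplicativity applied to \<open>p * p = p\<close> gives n <= n^2 for n =
  \<open>nrm p\<close>. This stands in for the integrality of rank.\<close>

lemma nrm_proj_ge_1:
  assumes "proj p" "p \<noteq> 0" shows "nrm p \<ge> 1"
proof -
  have "nrm p \<le> nrm p * nrm p" using nrm_mult_le[of p p] assms(1) by (simp add: proj_def)
  moreover have "nrm p > 0" using nrm_nonneg[of p] nrm_eq_0_iff[of p] assms(2) by linarith
  ultimately show ?thesis by simp
qed

lemma trc_idm: "trc (idm d) = of_nat d"
  by (simp add: trc_Mat[OF Mat_idm] ent_idm)

definition orth_projs :: "nat \<Rightarrow> (nat \<Rightarrow> fmat) \<Rightarrow> bool" where
  "orth_projs r p \<longleftrightarrow> (\<forall>i<r. proj (p i) \<and> p i \<noteq> 0) \<and> (\<forall>i<r. \<forall>j<r. i \<noteq> j \<longrightarrow> p i * p j = 0)"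

lemma orth_projs_mult:
  assumes "orth_projs r p" "i < r" "j < r"
  shows "p i * p j = (if i = j then p i else 0)"
  using assms by (auto simp: orth_projs_def proj_def)

lemma sum_mult_orth_projs:
  assumes "orth_projs r p" "j < r"
  shows "sum p {..<r} * p j = p j" "p j * sum p {..<r} = p j"
proof -
  have "sum p {..<r} * p j = (\<Sum>i<r. if i = j then p i else 0)"
    using assms unfolding sum_distrib_right by (intro sum.cong refl) (simp add: orth_projs_mult)
  then show "sum p {..<r} * p j = p j" using assms(2) by simp
  have "p j * sum p {..<r} = (\<Sum>i<r. if i = j then p i else 0)"
    using assms unfolding sum_distrib_left by (intro sum.cong refl) (simp add: orth_projs_mult)
  then show "p j * sum p {..<r} = p j" using assms(2) by simp
qed

lemma proj_sum_orth_projs: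
  assumes "orth_projs r p" shows "proj (sum p {..<r})"
proof -
  have "sum p {..<r} * sum p {..<r} = (\<Sum>j<r. sum p {..<r} * p j)" by (rule sum_distrib_left)
  also have "\<dots> = sum p {..<r}" using sum_mult_orth_projs[OF assms] by simp
  finally have "sum p {..<r} * sum p {..<r} = sum p {..<r}" .
  moreover have "adj (sum p {..<r}) = sum p {..<r}"
    using assms by (simp add: adj_sum orth_projs_def proj_def)
  ultimately show ?thesis by (simp add: proj_def)
qed

lemma proj_diff:
  assumes "proj p" "proj e" "p * e = e" "e * p = e" shows "proj (p - e)"
  using assms by (simp add: proj_def left_diff_distrib right_diff_distrib)

text \<open>The trace of \<open>idm d\<close> is d; each projection uses up at least 1 of it, and
  the complement of their sum is a projection with nonnegative trace.\<close>

lemma orth_projs_le_dim: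
  assumes "orth_projs r p" "\<And>i. i < r \<Longrightarrow> p i \<in> Mat d d" shows "r \<le> d"
proof -
  define s where "s = sum p {..<r}"
  have s: "proj s" "s \<in> Mat d d"
    using proj_sum_orth_projs[OF assms(1)] assms(2) by (auto simp: s_def intro: Mat_sum)
  have "proj (idm d - s)"
    by (rule proj_diff) (use s in \<open>auto simp: proj_def mult_idm[OF Mat_idm]\<close>)
  then have "trc (idm d) - trc s = of_real (nrm (idm d - s))" by (metis nrm_proj trc_diff)
  moreover have "trc s = of_real (\<Sum>i<r. nrm (p i))"
    using assms(1) by (simp add: s_def trc_sum nrm_proj orth_projs_def)
  ultimately have "of_real (real d) = (of_real (nrm (idm d - s) + (\<Sum>i<r. nrm (p i))) :: complex)"
    by (simp add: trc_idm algebra_simps)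
  then have "real d = nrm (idm d - s) + (\<Sum>i<r. nrm (p i))" using of_real_eq_iff by blast
  moreover have "(\<Sum>i<r. nrm (p i)) \<ge> (\<Sum>i<r. 1)"
    using assms(1) by (intro sum_mono nrm_proj_ge_1) (auto simp: orth_projs_def)
  ultimately have "real d \<ge> real r" using nrm_nonneg[of "idm d - s"] by simp
  then show ?thesis by simp
qed

text \<open>The unit \<open>u\<close> may be smaller than \<open>idm d\<close>: in the application
  the algebra lives on the support of \<open>P 1\<close>.\<close>

locale star_algebra =
  fixes A :: "fmat set" and d :: nat and u :: fmat
  assumes A_Mat: "A \<subseteq> Mat d d"
    and A_add: "x \<in> A \<Longrightarrow> y \<in> A \<Longrightarrow> x + y \<in> A"
    and A_scl: "x \<in> A \<Longrightarrow> scl c x \<in> A"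
    and A_mult: "x \<in> A \<Longrightarrow> y \<in> A \<Longrightarrow> x * y \<in> A"
    and A_adj: "x \<in> A \<Longrightarrow> adj x \<in> A"
    and unit_A: "u \<in> A"
    and unit_left: "x \<in> A \<Longrightarrow> u * x = x"
    and unit_right: "x \<in> A \<Longrightarrow> x * u = x"
begin

lemma A_zero: "0 \<in> A" using A_scl[OF unit_A, of 0] by simp

lemma A_diff: assumes "x \<in> A" "y \<in> A" shows "x - y \<in> A"
  using A_add[OF assms(1) A_scl[OF assms(2), of "- 1"]] by (simp add: scl_minus_left)

lemma A_sum: "(\<And>i. i \<in> I \<Longrightarrow> f i \<in> A) \<Longrightarrow> sum f I \<in> A"
  by (induction I rule: infinite_finite_induct) (auto simp: A_zero intro: A_add)

lemma proj_unit: "proj u"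
proof -
  have "adj u * u = adj u" using unit_right[OF A_adj[OF unit_A]] .
  then have "adj u = u" by (metis adj_adj adj_mult)
  then show ?thesis using unit_left[OF unit_A] by (simp add: proj_def)
qed

text \<open>A nonzero eigenprojection of \<open>x\<close> lies in the algebra below
  \<open>p\<close>; minimality makes it equal to \<open>p\<close>, so \<open>x\<close> acts on all
  of \<open>p\<close> as the eigenvalue.\<close>

lemma hermitian_corner_scalar:
  assumes p: "p \<in> A" "proj p" "p \<noteq> 0" and x: "x \<in> A" "adj x = x" "p * x = x" "x * p = x"
    and min: "\<And>e. e \<in> A \<Longrightarrow> proj e \<Longrightarrow> p * e = e \<Longrightarrow> e * p = e \<Longrightarrow> e = 0 \<or> e = p"
  shows "\<exists>c. x = scl c p"
proof -
  obtain q where q: "minpoly p x q" using minpoly_exists p(1) x(1) A_Mat by blast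
  obtain c where c: "poly q c = 0" using minpoly_root_exists[OF q p(3)] by blast
  obtain g where g: "proj (pev p x g)" "pev p x g \<noteq> 0" "x * pev p x g = scl c (pev p x g)"
    "p * pev p x g = pev p x g"
    using minpoly_root_projection[OF p(2) x(2-4) q c] by blast
  have "pev p x g \<in> A"
    by (rule pev_closed) (auto intro: p x A_zero A_add A_mult A_scl)
  moreover have "pev p x g * p = pev p x g" using g(1,4) p(2) by (metis adj_mult proj_def)
  ultimately have "pev p x g = p" using min g by blast
  then have "x * p = scl c p" using g(3) by simp
  then show ?thesis using x(4) by auto
qed

text \<open>A family of maximal length consists of minimal projections, since a splittable member
  or a defect of the sum would produce a longer family.\<close>

lemma minimal_projections_exist:
  "\<exists>r p. orth_projs r p \<and> (\<forall>i<r. p i \<in> A) \<and> sum p {..<r} = u \<and>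
     (\<forall>i<r. \<forall>x\<in>A. \<exists>c. p i * x * p i = scl c (p i))"
proof -
  define Q where "Q r \<longleftrightarrow> (\<exists>p. orth_projs r p \<and> (\<forall>i<r. p i \<in> A))" for r
  have bound: "r \<le> d" if "Q r" for r
    using that orth_projs_le_dim A_Mat unfolding Q_def by blast
  have "Q 0" by (simp add: Q_def orth_projs_def)
  then obtain r where r: "Q r" "\<And>k. Q k \<Longrightarrow> k \<le> r"
    using bound by (metis GreatestI_nat Greatest_le_nat)
  then obtain p where p: "orth_projs r p" "\<forall>i<r. p i \<in> A" unfolding Q_def by blast
  have nomore: False if "orth_projs (Suc r) p'" "\<forall>i<Suc r. p' i \<in> A" for p'
    using r(2)[of "Suc r"] that unfolding Q_def by fastforce
  have pp: "proj (p i)" "p i \<noteq> 0" "p i \<in> A" "p i * p i = p i" "adj (p i) = p i" if "i < r" for i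
    using p that by (auto simp: orth_projs_def proj_def)
  have sum: "sum p {..<r} = u"
  proof (rule ccontr)
    assume ne: "sum p {..<r} \<noteq> u"
    define s where "s = sum p {..<r}"
    have sA: "s \<in> A" using p by (auto simp: s_def intro: A_sum)
    have ps: "proj (u - s)"
      using proj_unit proj_sum_orth_projs[OF p(1)] unit_left[OF sA] unit_right[OF sA]
      by (auto simp: s_def intro: proj_diff)
    have z: "(u - s) * p i = 0" "p i * (u - s) = 0" if "i < r" for i
      using that sum_mult_orth_projs[OF p(1) that] unit_left unit_right p
      by (auto simp: s_def left_diff_distrib right_diff_distrib)
    have "orth_projs (Suc r) (p(r := u - s))"
      using p(1) ps z ne by (auto simp: orth_projs_def less_Suc_eq s_def)
    moreover have "\<forall>i<Suc r. (p(r := u - s)) i \<in> A" using p(2) A_diff[OF unit_A sA] by auto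
    ultimately show False by (rule nomore)
  qed
  have split: "e = 0 \<or> e = p i" if i: "i < r" and e: "e \<in> A" "proj e" "p i * e = e" "e * p i = e" for i e
  proof (rule ccontr)
    assume ne: "\<not> (e = 0 \<or> e = p i)"
    define p' where "p' = p(i := e, r := p i - e)"
    have z: "e * p j = 0" "p j * e = 0" if "j < r" "j \<noteq> i" for j
    proof -
      have "e * p j = e * (p i * p j)" using e(4) by (metis mult.assoc)
      then show "e * p j = 0" using orth_projs_mult[OF p(1) i that(1)] that(2) by simp
      have "p j * e = (p j * p i) * e" using e(3) by (metis mult.assoc)
      then show "p j * e = 0" using orth_projs_mult[OF p(1) that(1) i] that(2) by simp
    qed
    have z': "(p i - e) * p j = 0" "p j * (p i - e) = 0" if "j < r" "j \<noteq> i" for j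
      using z[OF that] orth_projs_mult[OF p(1)] i that by (auto simp: left_diff_distrib right_diff_distrib)
    have ee: "e * e = e" using e(2) by (simp add: proj_def)
    have "proj (p i - e)" using pp[OF i] e by (intro proj_diff) auto
    moreover have "e * (p i - e) = 0" "(p i - e) * e = 0"
      using e ee by (auto simp: left_diff_distrib right_diff_distrib)
    ultimately have "orth_projs (Suc r) p'"
      using p(1) e(2) ne z z' i by (auto simp: orth_projs_def less_Suc_eq p'_def)
    moreover have "\<forall>j<Suc r. p' j \<in> A" using p(2) e(1) i by (auto simp: p'_def less_Suc_eq intro: A_diff)
    ultimately show False by (rule nomore)
  qed
  have "\<exists>c. p i * x * p i = scl c (p i)" if i: "i < r" and x: "x \<in> A" for i x
  proof -
    define y where "y = p i * x * p i"
    have yA: "y \<in> A" using pp[OF i] x by (auto simp: y_def intro: A_mult)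
    have py: "p i * y = y" "y * p i = y"
      using pp[OF i] by (auto simp: y_def mult.assoc simp flip: mult.assoc[of "p i" "p i"])
    have pay: "p i * adj y = adj y" "adj y * p i = adj y"
      using py pp(5)[OF i] by (metis adj_mult)+
    \<comment> \<open>Only Hermitian elements are known to be scalar in the corner, so
      \<open>y\<close> is treated through its real and imaginary parts.\<close>
    have "\<exists>c. y + adj y = scl c (p i)"
      by (rule hermitian_corner_scalar[OF pp(3,1,2)[OF i] _ _ _ _ split[OF i]])
        (auto simp: yA A_adj A_add add.commute distrib_left distrib_right py pay)
    moreover have "\<exists>c. scl \<i> (y - adj y) = scl c (p i)"
      by (rule hermitian_corner_scalar[OF pp(3,1,2)[OF i] _ _ _ _ split[OF i]])
        (auto simp: yA A_adj A_diff A_scl scl_minus_left fmat.scale_right_diff_distrib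
          right_diff_distrib left_diff_distrib py pay)
    ultimately obtain a b where ab: "y + adj y = scl a (p i)" "scl \<i> (y - adj y) = scl b (p i)" by blast
    have "scl 2 y = (y + adj y) + scl (- \<i>) (scl \<i> (y - adj y))"
      by (rule fmat_eqI) simp
    also have "\<dots> = scl (a - \<i> * b) (p i)" unfolding ab by (rule fmat_eqI) (simp add: algebra_simps)
    finally have "scl (1 / 2) (scl 2 y) = scl ((a - \<i> * b) / 2) (p i)" by simp
    then have "y = scl ((a - \<i> * b) / 2) (p i)" by simp
    then show ?thesis unfolding y_def by blast
  qed
  then show ?thesis using p sum by blast
qed

text \<open>Two minimal projections are either disconnected, with \<open>p i * x * p j = 0\<close>
  throughout, or linked by a partial isometry, namely any nonzero \<open>p i * x * p j\<close> after
  rescaling. Being linked is an equivalence relation. Its classes are the blocks, \<rho> labels each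
  class by its least member, and \<open>v i\<close> links \<open>p i\<close> to that representative,
  so that the products \<open>v i * adj (v j)\<close> are matrix units.\<close>

lemma matrix_units_exist:
  "\<exists>r p \<rho> v. orth_projs r p \<and> (\<forall>i<r. p i \<in> A) \<and> sum p {..<r} = u \<and>
     (\<forall>i<r. \<forall>x\<in>A. \<exists>c. p i * x * p i = scl c (p i)) \<and>
     (\<forall>i<r. \<forall>j<r. \<rho> i \<noteq> \<rho> j \<longrightarrow> (\<forall>x\<in>A. p i * x * p j = 0)) \<and>
     (\<forall>i<r. \<rho> i < r \<and> v i \<in> A \<and> v i * adj (v i) = p i \<and> adj (v i) * v i = p (\<rho> i))"
proof -
  obtain r p where p: "orth_projs r p" "\<forall>i<r. p i \<in> A" "sum p {..<r} = u"
    and minimal: "\<forall>i<r. \<forall>x\<in>A. \<exists>c. p i * x * p i = scl c (p i)"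
    using minimal_projections_exist by blast
  have pp: "proj (p i)" "p i \<noteq> 0" "p i \<in> A" "p i * p i = p i" "adj (p i) = p i" if "i < r" for i
    using p that by (auto simp: orth_projs_def proj_def)
  define E where "E i j \<longleftrightarrow> (\<exists>x\<in>A. p i * x * p j \<noteq> 0)" for i j
  have iso: "\<exists>v\<in>A. v * adj v = p i \<and> adj v * v = p j" if ij: "i < r" "j < r" and "E i j" for i j
  proof -
    obtain x where x: "x \<in> A" "p i * x * p j \<noteq> 0" using \<open>E i j\<close> by (auto simp: E_def)
    define y where "y = p i * x * p j"
    have yA: "y \<in> A" by (simp add: y_def pp ij x A_mult)
    have y0: "y \<noteq> 0" using x by (simp add: y_def)
    have pi: "p i * y = y" using pp(4)[OF ij(1)] by (simp add: y_def flip: mult.assoc)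
    have pj: "y * p j = y" using pp(4)[OF ij(2)] by (simp add: y_def mult.assoc)
    have pi': "adj y * p i = adj y" using pi pp(5)[OF ij(1)] by (metis adj_mult)
    have pj': "p j * adj y = adj y" using pj pp(5)[OF ij(2)] by (metis adj_mult)
    obtain a where "p i * (y * adj y) * p i = scl a (p i)"
      using minimal ij(1) A_mult[OF yA A_adj[OF yA]] by blast
    then have a: "y * adj y = scl a (p i)"
      using pi pi' by (simp add: mult.assoc) (simp flip: mult.assoc)
    obtain b where "p j * (adj y * y) * p j = scl b (p j)"
      using minimal ij(2) A_mult[OF A_adj[OF yA] yA] by blast
    then have b: "adj y * y = scl b (p j)"
      using pj pj' by (simp add: mult.assoc) (simp flip: mult.assoc)
    \<comment> \<open>Evaluating \<open>y * adj y * y\<close> from both sides shows that the two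
      scalars agree, so a single rescaling normalises both products.\<close>
    have "scl a y = (y * adj y) * y" using a pi by simp
    also have "\<dots> = scl b y" using b pj by (simp add: mult.assoc)
    finally have "a = b" using y0 by (metis fmat.scale_right_imp_eq)
    \<comment> \<open>Comparing traces shows that the scalar is a positive real, as the square root
      below requires.\<close>
    have "of_real (nrm y) = b * of_real (nrm (p j))"
      using trc_adj_mult[of y] b nrm_proj[OF pp(1)[OF ij(2)]] by simp
    moreover have "nrm y > 0" "nrm (p j) > 0"
      using nrm_nonneg nrm_eq_0_iff y0 pp(2)[OF ij(2)] by (metis less_eq_real_def)+
    ultimately have "b = of_real (nrm y / nrm (p j))" "nrm y / nrm (p j) > 0"
      by (auto simp: field_simps)
    then obtain t where t: "b = of_real t" "t > 0" by blast
    define v where "v = scl (of_real (1 / sqrt t)) y"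
    have sq: "of_real (1 / sqrt t) * (of_real (1 / sqrt t) * of_real t) = (1 :: complex)"
      using t(2) by (simp flip: of_real_mult add: field_simps)
    have "v * adj v = scl (of_real (1 / sqrt t) * (of_real (1 / sqrt t) * of_real t)) (p i)"
      by (simp add: v_def a \<open>a = b\<close> t(1))
    moreover have "adj v * v = scl (of_real (1 / sqrt t) * (of_real (1 / sqrt t) * of_real t)) (p j)"
      by (simp add: v_def b t(1))
    ultimately have "v * adj v = p i" "adj v * v = p j" unfolding sq by simp_all
    moreover have "v \<in> A" unfolding v_def by (rule A_scl[OF yA])
    ultimately show ?thesis by blast
  qed
  have E_refl: "E i i" if "i < r" for i
    using pp[OF that] unfolding E_def by (intro bexI[of _ "p i"]) auto
  have E_sym: "E j i" if ij: "i < r" "j < r" "E i j" for i j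
  proof -
    obtain x where x: "x \<in> A" "p i * x * p j \<noteq> 0" using ij(3) by (auto simp: E_def)
    have "p j * adj x * p i = adj (p i * x * p j)" using pp(5) ij by (simp add: mult.assoc)
    then have "p j * adj x * p i \<noteq> 0" using x(2) by (metis adj_adj adj_zero)
    then show ?thesis using A_adj[OF x(1)] by (auto simp: E_def)
  qed
  \<comment> \<open>The product of the two partial isometries is a connecting element: multiplied by
    its own adjoint it returns \<open>p i\<close>, so it cannot vanish.\<close>
  have E_trans: "E i k" if ijk: "i < r" "j < r" "k < r" "E i j" "E j k" for i j k
  proof -
    obtain v where v: "v \<in> A" "v * adj v = p i" "adj v * v = p j" using iso ijk by blast
    obtain w where w: "w \<in> A" "w * adj w = p j" "adj w * w = p k" using iso ijk by blast
    have "(v * w) * (adj w * adj v) = v * (w * adj w) * adj v" by (simp add: mult.assoc)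
    also have "\<dots> = (v * adj v) * (v * adj v)" unfolding w(2) v(3)[symmetric] by (simp add: mult.assoc)
    also have "\<dots> = p i" using pp(4)[OF ijk(1)] v(2) by simp
    finally have vw: "(v * w) * (adj w * adj v) = p i" .
    have "p i * (v * w) * p k * (adj w * adj v) = p i * (v * (w * adj w) * (w * adj w) * adj v)"
      unfolding w(3)[symmetric] by (simp add: mult.assoc)
    also have "\<dots> = p i * (v * (w * adj w) * adj v)"
      using pp(4)[OF ijk(2)] unfolding w(2) by (simp add: mult.assoc)
    also have "\<dots> = p i" using vw pp(4)[OF ijk(1)] by (simp add: mult.assoc)
    finally have "p i * (v * w) * p k \<noteq> 0" using pp(2)[OF ijk(1)] by auto
    then show ?thesis using A_mult[OF v(1) w(1)] by (auto simp: E_def)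
  qed
  define \<rho> where "\<rho> i = (LEAST j. j < r \<and> E i j)" for i
  have \<rho>: "\<rho> i < r" "E i (\<rho> i)" if "i < r" for i
    using LeastI[of "\<lambda>j. j < r \<and> E i j" i] that E_refl by (auto simp: \<rho>_def)
  have \<rho>_eq: "\<rho> i = \<rho> j" if "i < r" "j < r" "E i j" for i j
  proof -
    have "k < r \<and> E i k \<longleftrightarrow> k < r \<and> E j k" for k using that E_trans E_sym by meson
    then show ?thesis by (simp add: \<rho>_def)
  qed
  have "\<forall>i. \<exists>v. i < r \<longrightarrow> v \<in> A \<and> v * adj v = p i \<and> adj v * v = p (\<rho> i)"
    using iso \<rho> by blast
  then obtain v where v: "i < r \<Longrightarrow> v i \<in> A \<and> v i * adj (v i) = p i \<and> adj (v i) * v i = p (\<rho> i)" for i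
    by metis
  have "\<forall>i<r. \<forall>j<r. \<rho> i \<noteq> \<rho> j \<longrightarrow> (\<forall>x\<in>A. p i * x * p j = 0)"
    using \<rho>_eq by (auto simp: E_def)
  then show ?thesis
    by (intro exI[of _ r] exI[of _ p] exI[of _ \<rho>] exI[of _ v]) (use p minimal \<rho>(1) v in simp)
qed

end

section \<open>Idempotent channels\<close>

locale idempotent_channel =
  fixes I :: "'i set" and K :: "'i \<Rightarrow> fmat" and d :: nat and P :: "fmat \<Rightarrow> fmat"
  assumes P_def: "P X = (\<Sum>a\<in>I. K a * X * adj (K a))"
    and fin: "finite I"
    and K_Mat: "a \<in> I \<Longrightarrow> K a \<in> Mat d d"
    and K_tp: "(\<Sum>a\<in>I. adj (K a) * K a) = idm d"
    and P_idem: "X \<in> Mat d d \<Longrightarrow> P (P X) = P X"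
begin

text \<open>The dual of \<open>P\<close> under the trace pairing (Heisenberg picture). It is unital
  because \<open>P\<close> preserves the trace.\<close>

definition Ps :: "fmat \<Rightarrow> fmat" where "Ps X = (\<Sum>a\<in>I. adj (K a) * X * K a)"

lemma K_idm: assumes "a \<in> I" shows "K a * idm d = K a" "adj (K a) * idm d = adj (K a)"
  using mult_idm[OF K_Mat[OF assms]] mult_idm[OF Mat_adj[OF K_Mat[OF assms]]] by auto

lemma P_Mat: "X \<in> Mat d d \<Longrightarrow> P X \<in> Mat d d"
  unfolding P_def by (intro Mat_sum Mat_mult[of _ d d] Mat_adj K_Mat) auto

lemma Ps_Mat: "X \<in> Mat d d \<Longrightarrow> Ps X \<in> Mat d d"
  unfolding Ps_def by (intro Mat_sum Mat_mult[of _ d d] Mat_adj K_Mat) auto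

lemma adj_Ps: "adj (Ps X) = Ps (adj X)"
  by (simp add: Ps_def adj_sum mult.assoc)

lemma adj_P: "adj (P X) = P (adj X)"
  by (simp add: P_def adj_sum mult.assoc)

lemma P_scl: "P (scl c X) = scl c (P X)"
  by (simp add: P_def fmat.scale_sum_right)

lemma P_diff: "P (X - Y) = P X - P Y"
  by (simp add: P_def left_diff_distrib right_diff_distrib sum_subtractf)

lemma Ps_diff: "Ps (X - Y) = Ps X - Ps Y"
  by (simp add: Ps_def left_diff_distrib right_diff_distrib sum_subtractf)

lemma trc_Ps: "trc (Ps Y * X) = trc (Y * P X)"
proof -
  have "trc (adj (K a) * Y * K a * X) = trc (Y * (K a * X * adj (K a)))" for a
    by (metis trc_mult_commute mult.assoc)
  then show ?thesis by (simp add: Ps_def P_def sum_distrib_right sum_distrib_left trc_sum)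
qed

lemma eq_of_trc_eq:
  assumes "Y \<in> Mat d d" "Z \<in> Mat d d" "\<And>X. X \<in> Mat d d \<Longrightarrow> trc (Y * X) = trc (Z * X)"
  shows "Y = Z"
proof -
  have "adj (Y - Z) \<in> Mat d d" using assms by (intro Mat_adj Mat_diff)
  then have "trc ((Y - Z) * adj (Y - Z)) = 0"
    using assms(3) by (simp add: left_diff_distrib trc_diff)
  then have "trc (adj (Y - Z) * (Y - Z)) = 0" by (metis trc_mult_commute)
  then have "Y - Z = 0" using trc_adj_mult nrm_eq_0_iff by (metis of_real_eq_0_iff)
  then show ?thesis by simp
qed

lemma Ps_idem: assumes "X \<in> Mat d d" shows "Ps (Ps X) = Ps X"
  by (rule eq_of_trc_eq) (auto simp: trc_Ps P_idem assms Ps_Mat P_Mat)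

lemma trc_P: assumes "X \<in> Mat d d" shows "trc (P X) = trc X"
proof -
  have "Ps (idm d) = idm d" using K_tp by (simp add: Ps_def K_idm)
  then show ?thesis using trc_Ps[of "idm d" X] idm_mult[OF P_Mat[OF assms]] assms by simp
qed

text \<open>The defect \<open>Ps (w\<^sup>* w) - w\<^sup>* w\<close> of the Schwarz inequality is the sum of squares
  of the commutators \<open>[w, K a]\<close>, and \<open>Ps\<close> annihilates it.\<close>

lemma fixed_commute:
  assumes w: "w \<in> Mat d d" "Ps w = w" and ab: "a \<in> I" "b \<in> I"
  shows "w * K a * K b = K a * w * K b"
proof -
  define N where "N a = w * K a - K a * w" for a
  have pw: "Ps (adj w) = adj w" using w(2) adj_Ps by metis
  have "(\<Sum>a\<in>I. adj (N a) * N a) = (\<Sum>a\<in>I. adj (K a) * (adj w * w) * K a - (adj (K a) * adj w * K a) * w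
          - adj w * (adj (K a) * w * K a) + adj w * (adj (K a) * K a) * w)"
    by (intro sum.cong refl) (simp add: N_def algebra_simps mult.assoc)
  also have "\<dots> = Ps (adj w * w) - Ps (adj w) * w - adj w * Ps w + adj w * (\<Sum>a\<in>I. adj (K a) * K a) * w"
    by (simp add: Ps_def sum.distrib sum_subtractf sum_distrib_left sum_distrib_right)
  also have "\<dots> = Ps (adj w * w) - adj w * w"
    by (simp add: w(2) pw K_tp mult_idm[OF Mat_adj[OF w(1)]])
  finally have "Ps (\<Sum>a\<in>I. adj (N a) * N a) = 0"
    using Ps_idem[OF Mat_mult[OF Mat_adj[OF w(1)] w(1)]] by (simp add: Ps_diff)
  \<comment> \<open>Applying \<open>Ps\<close> puts another Kraus operator next to
    \<open>N a\<close>; this is why only \<open>N a * K b\<close> is seen to vanish and why a factor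
    \<open>K b\<close> stands in the claim.\<close>
  then have "(\<Sum>b\<in>I. \<Sum>a\<in>I. adj (N a * K b) * (N a * K b)) = 0"
    by (simp add: Ps_def sum_distrib_left sum_distrib_right mult.assoc)
  then have "(\<Sum>c\<in>I \<times> I. adj (N (snd c) * K (fst c)) * (N (snd c) * K (fst c))) = 0"
    by (simp add: sum.cartesian_product case_prod_beta)
  from sum_adj_mult_self_eq_0[OF _ this, of "(b, a)"] fin ab
  have "N a * K b = 0" by simp
  then show ?thesis by (simp add: N_def left_diff_distrib)
qed

section \<open>The support of the image of \<open>P\<close>\<close>

definition \<sigma> :: fmat where "\<sigma> = P (idm d)"

lemma \<sigma>_eq: "\<sigma> = (\<Sum>a\<in>I. K a * adj (K a))"
  by (simp add: \<sigma>_def P_def K_idm)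

lemma \<sigma>_Mat: "\<sigma> \<in> Mat d d" unfolding \<sigma>_def by (rule P_Mat[OF Mat_idm])

lemma P_\<sigma>: "P \<sigma> = \<sigma>" unfolding \<sigma>_def by (rule P_idem[OF Mat_idm])

text \<open>The projection onto the range of \<sigma>. Since \<sigma> is the image of the identity,
  this range contains the range of every \<open>P X\<close>, see \<open>supp_P\<close>.\<close>

definition supp :: fmat where
  "supp = (SOME s. \<exists>h. proj s \<and> s \<in> Mat d d \<and> \<sigma> * s = \<sigma> \<and> s = \<sigma> * h)"

lemma supp: "proj supp" "supp \<in> Mat d d" "\<sigma> * supp = \<sigma>" "\<exists>h. supp = \<sigma> * h"
proof -
  have "adj \<sigma> = \<sigma>" by (simp add: \<sigma>_def adj_P)
  then have "\<exists>s h. proj s \<and> s \<in> Mat d d \<and> \<sigma> * s = \<sigma> \<and> s = \<sigma> * h"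
    by (rule support_projection_exists[OF \<sigma>_Mat])
  from someI_ex[OF this] show "proj supp" "supp \<in> Mat d d" "\<sigma> * supp = \<sigma>" "\<exists>h. supp = \<sigma> * h"
    unfolding supp_def by blast+
qed

lemma supp_mult: "supp * supp = supp" "adj supp = supp" using supp(1) by (auto simp: proj_def)

lemma supp_\<sigma>: "supp * \<sigma> = \<sigma>"
proof -
  have "adj \<sigma> = \<sigma>" by (simp add: \<sigma>_def adj_P)
  then show ?thesis using supp(3) supp_mult(2) by (metis adj_mult)
qed

text \<open>The cancellation rule for \<sigma>: an identity is checked after multiplication by
  \<sigma>, whose Kraus expansion is available, and then holds on the support.\<close>

lemma mult_supp_eq_0: "N * \<sigma> = 0 \<Longrightarrow> N * supp = 0"
  using supp(4) by (metis mult.assoc mult_zero_left)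

text \<open>The squares belonging to the parts (1 - \<open>supp\<close>) \<open>K a\<close> add up
  to (1 - \<open>supp\<close>) \<sigma> (1 - \<open>supp\<close>), which is 0.\<close>

lemma supp_K: assumes "a \<in> I" shows "supp * K a = K a"
proof -
  define N where "N a = adj (K a - supp * K a)" for a
  have "(\<Sum>a\<in>I. adj (N a) * N a) = \<sigma> - supp * \<sigma> - \<sigma> * supp + supp * \<sigma> * supp"
    by (simp add: \<sigma>_eq N_def supp_mult algebra_simps sum.distrib sum_subtractf sum_distrib_left
        sum_distrib_right)
  also have "\<dots> = 0" by (simp add: supp_\<sigma> supp(3))
  finally have "N a = 0" by (rule sum_adj_mult_self_eq_0[OF fin _ assms])
  then have "adj (N a) = 0" by simp
  then show ?thesis by (simp add: N_def)
qed

lemma supp_P: "supp * P X = P X" "P X * supp = P X"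
proof -
  have "supp * (K a * X * adj (K a)) = K a * X * adj (K a)" if "a \<in> I" for a
    using supp_K[OF that] by (simp flip: mult.assoc)
  then show "supp * P X = P X" by (simp add: P_def sum_distrib_left)
  have "K a * X * adj (K a) * supp = K a * X * adj (K a)" if "a \<in> I" for a
    using arg_cong[OF supp_K[OF that], of adj] by (simp add: supp_mult mult.assoc)
  then show "P X * supp = P X" by (simp add: P_def sum_distrib_right)
qed

text \<open>The commutant of the Kraus operators compressed to the support. The condition is imposed
  on \<open>adj x\<close> as well because the family \<open>K\<close> need not be closed under
  adjoints.\<close>

definition Alg :: "fmat set" where
  "Alg = {x \<in> Mat d d. supp * x = x \<and> x * supp = x \<and>
     (\<forall>a\<in>I. x * K a * supp = K a * x \<and> adj x * K a * supp = K a * adj x)}"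

lemma Alg_mult_aux:
  assumes "supp * y = y" "x * k * supp = k * x" "y * k * supp = k * y"
  shows "x * y * k * supp = k * (x * y)"
proof -
  have "x * y * k * supp = x * (k * y)" using assms(3) by (simp add: mult.assoc)
  also have "\<dots> = x * k * supp * y" using assms(1) by (simp add: mult.assoc)
  also have "\<dots> = k * (x * y)" using assms(2) by (simp add: mult.assoc)
  finally show ?thesis .
qed

sublocale star_algebra Alg d supp
proof
  show "Alg \<subseteq> Mat d d" by (auto simp: Alg_def)
  show "x + y \<in> Alg" if "x \<in> Alg" "y \<in> Alg" for x y
    using that by (auto simp: Alg_def Mat_add algebra_simps)
  show "scl c x \<in> Alg" if "x \<in> Alg" for x c
    using that by (auto simp: Alg_def Mat_scl)
  have sadj: "supp * adj x = adj x" "adj x * supp = adj x" if "x \<in> Alg" for x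
    using that supp_mult(2) by (auto simp: Alg_def) (metis adj_mult)+
  show "adj x \<in> Alg" if "x \<in> Alg" for x
    using that sadj[OF that] by (auto simp: Alg_def Mat_adj)
  show "x * y \<in> Alg" if "x \<in> Alg" "y \<in> Alg" for x y
  proof -
    have "supp * (x * y) = x * y" using that(1) by (auto simp: Alg_def simp flip: mult.assoc)
    moreover have "x * y * supp = x * y" using that(2) by (auto simp: Alg_def mult.assoc)
    moreover have "x * y * K a * supp = K a * (x * y)" if "a \<in> I" for a
      using \<open>x \<in> Alg\<close> \<open>y \<in> Alg\<close> that by (intro Alg_mult_aux) (auto simp: Alg_def)
    moreover have "adj (x * y) * K a * supp = K a * adj (x * y)" if "a \<in> I" for a
      unfolding adj_mult using \<open>x \<in> Alg\<close> \<open>y \<in> Alg\<close> that sadj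
      by (intro Alg_mult_aux) (auto simp: Alg_def)
    ultimately show ?thesis using that by (auto simp: Alg_def intro: Mat_mult)
  qed
  show "supp \<in> Alg" using supp supp_mult supp_K by (auto simp: Alg_def)
  show "supp * x = x" "x * supp = x" if "x \<in> Alg" for x using that by (auto simp: Alg_def)
qed

text \<open>\<open>fixed_commute\<close> needs two Kraus operators to the right of \<open>w\<close>.
  Writing \<sigma> as \<open>P \<sigma>\<close> supplies both for the first claim; for the second,
  \<open>K a\<close> is there already and \<sigma> as the image of the identity supplies the
  other.\<close>

lemma fixed_supp:
  assumes w: "w \<in> Mat d d" "Ps w = w"
  shows "supp * w * supp = w * supp" "a \<in> I \<Longrightarrow> w * K a * supp = K a * w * supp"
proof -
  have "(w - supp * w) * \<sigma> = (\<Sum>a\<in>I. \<Sum>b\<in>I. (w - supp * w) * K a * K b * adj (K b) * adj (K a))"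
    by (subst P_\<sigma>[symmetric]) (simp add: P_def \<sigma>_eq sum_distrib_left sum_distrib_right mult.assoc)
  also have "\<dots> = 0"
  proof (intro sum.neutral ballI)
    fix a b assume ab: "a \<in> I" "b \<in> I"
    have "(w - supp * w) * K a * K b = w * K a * K b - supp * (w * K a * K b)"
      by (simp add: left_diff_distrib mult.assoc)
    also have "\<dots> = K a * w * K b - supp * K a * w * K b"
      unfolding fixed_commute[OF w ab] by (simp add: mult.assoc)
    also have "\<dots> = 0" by (simp add: supp_K[OF ab(1)])
    finally show "(w - supp * w) * K a * K b * adj (K b) * adj (K a) = 0" by simp
  qed
  finally have "(w - supp * w) * supp = 0" by (rule mult_supp_eq_0)
  then show "supp * w * supp = w * supp" by (simp add: left_diff_distrib)
  assume a: "a \<in> I"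
  have "(w * K a - K a * w) * \<sigma> = (\<Sum>b\<in>I. (w * K a * K b - K a * w * K b) * adj (K b))"
    by (simp add: \<sigma>_eq sum_distrib_left left_diff_distrib mult.assoc)
  also have "\<dots> = 0" by (simp add: fixed_commute[OF w a])
  finally have "(w * K a - K a * w) * supp = 0" by (rule mult_supp_eq_0)
  then show "w * K a * supp = K a * w * supp" by (simp add: left_diff_distrib)
qed

text \<open>The source of elements of \<open>Alg\<close>: \<open>Ps Z\<close> is fixed by
  \<open>Ps\<close>. Commutation with \<open>supp\<close> follows from \<open>fixed_supp\<close>
  applied to both \<open>Ps Z\<close> and its adjoint.\<close>

lemma Ps_supp_Alg: assumes "Z \<in> Mat d d" shows "Ps Z * supp \<in> Alg"
proof -
  define w where "w = Ps Z"
  have w: "w \<in> Mat d d" "Ps w = w" "adj w \<in> Mat d d" "Ps (adj w) = adj w"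
    using assms by (auto simp: w_def Ps_Mat Ps_idem adj_Ps Mat_adj)
  have "adj (supp * adj w * supp) = adj (adj w * supp)" using fixed_supp(1)[OF w(3,4)] by simp
  then have sw: "supp * w = w * supp"
    using fixed_supp(1)[OF w(1,2)] by (simp add: supp_mult mult.assoc)
  have "supp * (w * supp) = w * supp" by (metis sw mult.assoc supp_mult(1))
  moreover have "w * supp * supp = w * supp" by (simp add: mult.assoc supp_mult)
  moreover have "w * supp * K a * supp = K a * (w * supp)" if "a \<in> I" for a
    using fixed_supp(2)[OF w(1,2) that] supp_K[OF that] by (simp add: mult.assoc)
  moreover have "adj (w * supp) * K a * supp = K a * adj (w * supp)" if "a \<in> I" for a
  proof -
    have "adj (w * supp) = adj w * supp" using arg_cong[OF sw, of adj] by (simp add: supp_mult)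
    then show ?thesis
      using fixed_supp(2)[OF w(3,4) that] supp_K[OF that] by (simp add: mult.assoc)
  qed
  ultimately have "w * supp \<in> Alg" using Mat_mult[OF w(1) supp(2)] by (simp add: Alg_def)
  then show ?thesis by (simp add: w_def)
qed

text \<open>A fixed point lives on the support, and there \<open>x\<close> passes through every
  Kraus operator. The fixed points of \<open>P\<close> thus form a bimodule over
  \<open>Alg\<close>.\<close>

lemma Alg_left: assumes "x \<in> Alg" "P v = v" shows "P (x * v) = x * v"
proof -
  have "K a * (x * v) * adj (K a) = x * (K a * v * adj (K a))" if "a \<in> I" for a
  proof -
    have "supp * v = v" using assms(2) supp_P(1) by metis
    moreover have "K a * x = x * K a * supp" using assms(1) that by (simp add: Alg_def)
    ultimately show ?thesis by (metis mult.assoc)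
  qed
  then have "P (x * v) = x * P v" by (simp add: P_def sum_distrib_left)
  then show ?thesis using assms(2) by simp
qed

lemma Alg_right: assumes "x \<in> Alg" "P v = v" shows "P (v * x) = v * x"
proof -
  have "P (adj x * adj v) = adj x * adj v"
    by (rule Alg_left[OF A_adj[OF assms(1)]]) (metis adj_P assms(2))
  then show ?thesis by (metis adj_P adj_adj adj_mult)
qed

text \<open>\<open>Alg\<close> separates the fixed points of \<open>P\<close>: for every
  \<open>Z\<close>, the trace of \<open>Z * v\<close> with \<open>v = P v\<close> is that of
  \<open>Ps Z * supp * v\<close>, where \<open>Ps Z * supp\<close> lies in
  \<open>Alg\<close>.\<close>

lemma P_fixed_eq_0:
  assumes u: "P v = v" "v \<in> Mat d d" and "\<And>x. x \<in> Alg \<Longrightarrow> trc (x * v) = 0"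
  shows "v = 0"
proof (rule eq_of_trc_eq[OF u(2)])
  have sv: "supp * v = v" using u(1) supp_P(1) by metis
  fix Z assume "Z \<in> Mat d d"
  then have "trc (Ps Z * supp * v) = 0" using assms(3) Ps_supp_Alg by blast
  then have "trc (Z * P v) = 0" using sv by (simp add: mult.assoc trc_Ps)
  then show "trc (v * Z) = trc (0 * Z)" using u(1) by (simp add: trc_mult_commute)
qed simp

text \<open>The matrices \<open>v i * \<sigma> * adj (v j)\<close> with equal labels are fixed by
  \<open>P\<close> and span its image; their coordinates are traces against \<open>v i\<close> and
  \<open>v j\<close>, up to the block weight \<open>c\<close>. In the later factorisation of
  \<open>P\<close> as \<open>J\<close> after \<open>F\<close>, the trace identity makes
  \<open>F\<close> trace preserving, the expansion is the factorisation itself, and the last part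
  gives trace preservation of \<open>J\<close> and the inversion of \<open>J\<close> by
  \<open>F\<close> on blocks.\<close>

theorem matrix_unit_decomposition:
  "\<exists>(r::nat) \<rho> v c. (\<forall>i<r. \<rho> i < r \<and> v i \<in> Mat d d \<and> c (\<rho> i) > (0::real)) \<and>
     (\<forall>X\<in>Mat d d. (\<Sum>i<r. trc (adj (v i) * P X * v i)) = trc X) \<and>
     (\<forall>X\<in>Mat d d. P X = (\<Sum>i<r. \<Sum>j<r. if \<rho> i = \<rho> j then
        scl (trc (adj (v i) * P X * v j) / of_real (c (\<rho> i))) (v i * \<sigma> * adj (v j)) else 0)) \<and>
     (\<forall>k<r. \<forall>l<r. \<rho> k = \<rho> l \<longrightarrow> P (v k * \<sigma> * adj (v l)) = v k * \<sigma> * adj (v l) \<and>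
        trc (v k * \<sigma> * adj (v l)) = (if k = l then of_real (c (\<rho> k)) else 0) \<and>
        (\<forall>i<r. \<forall>j<r. trc (adj (v i) * (v k * \<sigma> * adj (v l)) * v j)
           = (if i = k \<and> j = l then of_real (c (\<rho> k)) else 0)))"
proof -
  obtain r p \<rho> v where p: "orth_projs r p" "\<forall>i<r. p i \<in> Alg" "sum p {..<r} = supp"
    and minimal: "\<forall>i<r. \<forall>x\<in>Alg. \<exists>c. p i * x * p i = scl c (p i)"
    and off: "\<forall>i<r. \<forall>j<r. \<rho> i \<noteq> \<rho> j \<longrightarrow> (\<forall>x\<in>Alg. p i * x * p j = 0)"
    and v: "\<forall>i<r. \<rho> i < r \<and> v i \<in> Alg \<and> v i * adj (v i) = p i \<and> adj (v i) * v i = p (\<rho> i)"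
    using matrix_units_exist by blast
  have pp: "proj (p i)" "p i \<noteq> 0" "p i \<in> Alg" "p i * p i = p i" "adj (p i) = p i" if "i < r" for i
    using p that by (auto simp: orth_projs_def proj_def)
  have vv: "\<rho> i < r" "v i \<in> Alg" "v i * adj (v i) = p i" "adj (v i) * v i = p (\<rho> i)" if "i < r" for i
    using v that by auto
  have pv: "p i * v i = v i" "v i * p (\<rho> i) = v i" if i: "i < r" for i
  proof -
    have eq: "p i * v i = v i * p (\<rho> i)" using vv(3,4)[OF i] by (metis mult.assoc)
    \<comment> \<open>That \<open>v i * adj (v i)\<close> is a projection forces \<open>v i\<close>
      to be a partial isometry: the defect \<open>z\<close> satisfies
      \<open>z * adj z = 0\<close>.\<close>
    define z where "z = p i * v i - v i"
    have "z * adj z = p i * p i * p i - p i * p i - p i * p i + p i"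
      unfolding z_def using vv(3)[OF i] pp(5)[OF i]
      by (simp add: left_diff_distrib right_diff_distrib) (metis mult.assoc)
    then have "adj (adj z) * adj z = 0" using pp(4)[OF i] by simp
    then have "adj z = 0" by (rule adj_mult_self_eq_0)
    then have "z = 0" by (metis adj_adj adj_zero)
    then show "p i * v i = v i" by (simp add: z_def)
    then show "v i * p (\<rho> i) = v i" using eq by simp
  qed
  have pav: "adj (v i) * p i = adj (v i)" "p (\<rho> i) * adj (v i) = adj (v i)" if "i < r" for i
    using pv[OF that] pp(5)[OF that] pp(5)[OF vv(1)[OF that]] by (metis adj_mult)+
  have avv: "adj (v i) * v k = (if i = k then p (\<rho> i) else 0)" if "i < r" "k < r" for i k
  proof (cases "i = k")
    case False
    have "adj (v i) * v k = adj (v i) * (p i * p k) * v k"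
      using pav(1)[OF that(1)] pv(1)[OF that(2)] by (metis mult.assoc)
    then show ?thesis using False orth_projs_mult[OF p(1) that] by simp
  qed (use vv that in auto)
  \<comment> \<open>The weight of \<sigma> on a minimal projection. It is used at the
    representatives \<rho> i only, one number per block.\<close>
  define c where "c k = Re (trc (p k * \<sigma> * p k))" for k
  have c: "trc (p k * \<sigma> * p k) = of_real (c k)" "c k > 0" if k: "k < r" for k
  proof -
    define z where "z a = adj (p k * K a)" for a
    have "p k * \<sigma> * p k = (\<Sum>a\<in>I. adj (z a) * z a)"
      by (simp add: z_def \<sigma>_eq sum_distrib_left sum_distrib_right pp(5)[OF k] mult.assoc)
    then have t: "trc (p k * \<sigma> * p k) = of_real (\<Sum>a\<in>I. nrm (z a))"
      by (simp add: trc_sum trc_adj_mult)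
    then show eq: "trc (p k * \<sigma> * p k) = of_real (c k)" by (simp add: c_def)
    have "c k \<ge> 0" unfolding c_def t by (simp add: sum_nonneg nrm_nonneg)
    moreover have "c k \<noteq> 0"
    \<comment> \<open>A zero weight would make \<open>p k\<close> orthogonal to the range of
      \<sigma>, although \<open>p k\<close> lies below \<open>supp\<close>.\<close>
    proof
      assume "c k = 0"
      then have "(\<Sum>a\<in>I. nrm (z a)) = 0" using t by (simp add: c_def)
      then have "\<forall>a\<in>I. z a = 0" using fin by (simp add: sum_nonneg_eq_0_iff nrm_nonneg nrm_eq_0_iff)
      then have "\<forall>a\<in>I. p k * K a = 0" unfolding z_def by (metis adj_adj adj_zero)
      then have "p k * \<sigma> = 0" by (simp add: \<sigma>_eq sum_distrib_left flip: mult.assoc)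
      then have "p k * supp = 0" by (rule mult_supp_eq_0)
      then show False using pp[OF k] unit_right by simp
    qed
    ultimately show "c k > 0" by simp
  qed
  \<comment> \<open>The fixed points of \<open>P\<close> in a minimal corner are one-dimensional.
    Subtracting the multiple of \<open>p k * \<sigma> * p k\<close> of equal trace leaves
    \<open>y\<close> of trace 0; compressed elements of \<open>Alg\<close> are scalar there, so all
    of \<open>Alg\<close> is orthogonal to \<open>y\<close>.\<close>
  have corner: "w = scl (trc w / of_real (c k)) (p k * \<sigma> * p k)"
    if k: "k < r" and w: "w \<in> Mat d d" "P w = w" "p k * w = w" "w * p k = w" for k w
  proof -
    define y where "y = w - scl (trc w / of_real (c k)) (p k * \<sigma> * p k)"
    have ps: "P (p k * \<sigma> * p k) = p k * \<sigma> * p k"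
      by (intro Alg_left Alg_right pp k P_\<sigma>)
    have py: "p k * y = y" "y * p k = y"
      using w pp(4)[OF k] by (simp_all add: y_def left_diff_distrib right_diff_distrib mult.assoc)
        (simp flip: mult.assoc)
    have "trc (p k * \<sigma> * p k) \<noteq> 0" using c[OF k] by simp
    then have ty: "trc y = 0" using c[OF k] by (simp add: y_def trc_diff)
    have "y = 0"
    proof (rule P_fixed_eq_0)
      show "P y = y" by (simp add: y_def P_diff P_scl ps w)
      show "y \<in> Mat d d" using A_Mat pp(3)[OF k]
        by (auto simp: y_def intro!: Mat_diff Mat_scl Mat_mult[of _ d d] w \<sigma>_Mat)
      fix x assume "x \<in> Alg"
      then obtain b where b: "p k * x * p k = scl b (p k)" using minimal k by blast
      have "trc (x * y) = trc (x * p k * y * p k)" by (simp add: py mult.assoc)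
      also have "\<dots> = trc (p k * x * p k * y)" by (metis trc_mult_commute mult.assoc)
      also have "\<dots> = 0" by (simp add: b py ty)
      finally show "trc (x * y) = 0" .
    qed
    then show ?thesis by (simp add: y_def)
  qed
  have off0: "p i * w * p j = 0" if ij: "i < r" "j < r" "\<rho> i \<noteq> \<rho> j" and w: "w \<in> Mat d d" "P w = w" for i j w
  proof (rule P_fixed_eq_0)
    show "P (p i * w * p j) = p i * w * p j" by (intro Alg_left Alg_right pp ij w)
    show "p i * w * p j \<in> Mat d d" using A_Mat pp(3) ij by (auto intro!: Mat_mult[of _ d d] w)
    fix x assume "x \<in> Alg"
    then have "p j * x * p i = 0" using off ij by metis
    moreover have "trc (x * (p i * w * p j)) = trc (p j * x * p i * w)"
      by (metis trc_mult_commute mult.assoc)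
    ultimately show "trc (x * (p i * w * p j)) = 0" by simp
  qed
  have tr: "(\<Sum>i<r. trc (adj (v i) * P X * v i)) = trc X" if X: "X \<in> Mat d d" for X
  proof -
    have "trc (adj (v i) * P X * v i) = trc (p i * P X)" if "i < r" for i
      using vv(3)[OF that] by (metis trc_mult_commute mult.assoc)
    then have "(\<Sum>i<r. trc (adj (v i) * P X * v i)) = trc (supp * P X)"
      by (simp add: p(3)[symmetric] sum_distrib_right trc_sum)
    then show ?thesis by (simp add: supp_P trc_P X)
  qed
  have dec: "P X = (\<Sum>i<r. \<Sum>j<r. if \<rho> i = \<rho> j then
        scl (trc (adj (v i) * P X * v j) / of_real (c (\<rho> i))) (v i * \<sigma> * adj (v j)) else 0)"
    if X: "X \<in> Mat d d" for X
  proof -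
    define w where "w = P X"
    have w: "w \<in> Mat d d" "P w = w" using X by (auto simp: w_def P_Mat P_idem)
    have blk: "p i * w * p j = (if \<rho> i = \<rho> j then
        scl (trc (adj (v i) * w * v j) / of_real (c (\<rho> i))) (v i * \<sigma> * adj (v j)) else 0)"
      if ij: "i < r" "j < r" for i j
    proof (cases "\<rho> i = \<rho> j")
      case True
      define k where "k = \<rho> i"
      \<comment> \<open>The partial isometries carry the (i, j) entry to the corner of the common
        representative, where \<open>corner\<close> applies.\<close>
      define y where "y = adj (v i) * w * v j"
      have k: "k < r" using vv ij by (simp add: k_def)
      have "y = scl (trc y / of_real (c k)) (p k * \<sigma> * p k)"
      proof (rule corner[OF k])
        show "y \<in> Mat d d" using A_Mat vv(2) A_adj[OF vv(2)] ij
          by (auto simp: y_def intro!: Mat_mult[of _ d d] w)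
        show "P y = y" unfolding y_def by (intro Alg_left Alg_right vv A_adj ij w)
        show "p k * y = y" using pav(2)[OF ij(1)] by (simp add: y_def k_def flip: mult.assoc)
        show "y * p k = y" using pv(2)[OF ij(2)] by (simp add: y_def k_def True mult.assoc)
      qed
      then have "v i * y * adj (v j) = scl (trc y / of_real (c k)) (v i * p k * \<sigma> * (p k * adj (v j)))"
        by (metis scl_mult_left scl_mult_right mult.assoc)
      moreover have "v i * p k = v i" "p k * adj (v j) = adj (v j)"
        using pv(2)[OF ij(1)] pav(2)[OF ij(2)] True by (simp_all add: k_def)
      moreover have "v i * y * adj (v j) = p i * w * p j"
        using vv(3) ij by (metis y_def mult.assoc)
      ultimately show ?thesis using True by (simp add: y_def k_def)
    qed (simp add: off0 ij w)
    have "w = supp * w * supp" by (simp add: w_def supp_P)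
    also have "\<dots> = (\<Sum>i<r. \<Sum>j<r. p i * w * p j)"
      by (simp add: p(3)[symmetric] sum_distrib_left sum_distrib_right)
        (rule sum.swap)
    also have "\<dots> = (\<Sum>i<r. \<Sum>j<r. if \<rho> i = \<rho> j then
        scl (trc (adj (v i) * w * v j) / of_real (c (\<rho> i))) (v i * \<sigma> * adj (v j)) else 0)"
      by (intro sum.cong refl) (simp add: blk)
    finally show ?thesis unfolding w_def .
  qed
  have units: "P (v k * \<sigma> * adj (v l)) = v k * \<sigma> * adj (v l) \<and>
        trc (v k * \<sigma> * adj (v l)) = (if k = l then of_real (c (\<rho> k)) else 0) \<and>
        (\<forall>i<r. \<forall>j<r. trc (adj (v i) * (v k * \<sigma> * adj (v l)) * v j)
           = (if i = k \<and> j = l then of_real (c (\<rho> k)) else 0))"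
    if kl: "k < r" "l < r" "\<rho> k = \<rho> l" for k l
  proof (intro conjI allI impI)
    show "P (v k * \<sigma> * adj (v l)) = v k * \<sigma> * adj (v l)"
      by (intro Alg_left Alg_right vv A_adj kl P_\<sigma>)
    have "trc (v k * \<sigma> * adj (v l)) = trc (adj (v l) * v k * \<sigma>)"
      by (metis trc_mult_commute mult.assoc)
    also have "\<dots> = (if k = l then trc (p (\<rho> k) * \<sigma>) else 0)" using avv kl by auto
    also have "trc (p (\<rho> k) * \<sigma>) = trc (p (\<rho> k) * \<sigma> * p (\<rho> k))"
      using pp(4)[OF vv(1)[OF kl(1)]] by (metis trc_mult_commute mult.assoc)
    finally show "trc (v k * \<sigma> * adj (v l)) = (if k = l then of_real (c (\<rho> k)) else 0)"
      unfolding c(1)[OF vv(1)[OF kl(1)]] .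
    fix i j assume ij: "i < r" "j < r"
    have "adj (v i) * (v k * \<sigma> * adj (v l)) * v j = (adj (v i) * v k) * \<sigma> * (adj (v l) * v j)"
      by (simp add: mult.assoc)
    also have "\<dots> = (if i = k \<and> j = l then p (\<rho> k) * \<sigma> * p (\<rho> k) else 0)"
      using avv[OF ij(1) kl(1)] avv[OF kl(2) ij(2)] kl(3) by auto
    finally show "trc (adj (v i) * (v k * \<sigma> * adj (v l)) * v j)
           = (if i = k \<and> j = l then of_real (c (\<rho> k)) else 0)"
      using c(1)[OF vv(1)[OF kl(1)]] by simp
  qed
  have basic: "\<forall>i<r. \<rho> i < r \<and> v i \<in> Mat d d \<and> c (\<rho> i) > (0::real)"
    using vv c(2) A_Mat by blast
  show ?thesis
  proof (intro exI[of _ r] exI[of _ \<rho>] exI[of _ v] exI[of _ c] conjI, goal_cases)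
    case 1 show ?case by (rule basic)
  next
    case 2 show ?case using tr by blast
  next
    case 3 show ?case using dec by blast
  next
    case 4 show ?case using units by blast
  qed
qed

end

section \<open>Kraus decomposition\<close>

definition nonneg :: "complex \<Rightarrow> bool" where "nonneg z \<longleftrightarrow> Im z = 0 \<and> Re z \<ge> 0"

lemma nonneg_sum: "(\<And>a. a \<in> A \<Longrightarrow> nonneg (f a)) \<Longrightarrow> nonneg (sum f A)"
  by (simp add: nonneg_def sum_nonneg)

definition qform :: "nat \<Rightarrow> (nat \<Rightarrow> nat \<Rightarrow> complex) \<Rightarrow> (nat \<Rightarrow> complex) \<Rightarrow> complex" where
  "qform n A w = (\<Sum>i<n. \<Sum>j<n. cnj (w i) * A i j * w j)"

lemma sum_two_points:
  fixes f :: "nat \<Rightarrow> complex"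
  assumes "i < N" "n < N" "i \<noteq> n"
  shows "(\<Sum>y<N. f y * (if y = i then s else if y = n then t else 0)) = f i * s + f n * t"
proof -
  have "(\<Sum>y<N. f y * (if y = i then s else if y = n then t else 0))
      = (\<Sum>y<N. (if y = i then f y * s else 0) + (if y = n then f y * t else 0))"
    using assms(3) by (intro sum.cong) auto
  then show ?thesis using assms by (simp add: sum.distrib)
qed

lemma qform_two_points:
  assumes "i < N" "n < N" "i \<noteq> n"
  shows "qform N A (\<lambda>k. if k = i then s else if k = n then t else 0)
    = cnj s * A i i * s + cnj s * A i n * t + cnj t * A n i * s + cnj t * A n n * t"
proof -
  let ?w = "\<lambda>k. if k = i then s else if k = n then t else 0"
  have "qform N A ?w = (\<Sum>x<N. (\<Sum>y<N. A x y * ?w y) * (if x = i then cnj s else if x = n then cnj t else 0))"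
    unfolding qform_def sum_distrib_right by (intro sum.cong refl) auto
  also have "\<dots> = (A i i * s + A i n * t) * cnj s + (A n i * s + A n n * t) * cnj t"
    unfolding sum_two_points[OF assms] ..
  finally show ?thesis by (simp add: algebra_simps)
qed

text \<open>\<open>nonneg\<close> includes being real; the test vectors (1, 0), (0, 1), (1, 1) and
  (1, i) in the two coordinates force the symmetry.\<close>

lemma psd_hermitian:
  assumes psd: "\<And>w. nonneg (qform N A w)" and ij: "i < N" "n < N" "i \<noteq> n"
  shows "A n i = cnj (A i n)"
proof -
  have *: "nonneg (cnj s * A i i * s + cnj s * A i n * t + cnj t * A n i * s + cnj t * A n n * t)" for s t
    using psd[of "\<lambda>k. if k = i then s else if k = n then t else 0"] unfolding qform_two_points[OF ij] .
  show ?thesis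
    using *[of 1 0] *[of 0 1] *[of 1 1] *[of 1 \<i>] by (auto simp: nonneg_def complex_eq_iff)
qed

lemma psd_zero_diag:
  assumes psd: "\<And>w. nonneg (qform N A w)" and ij: "i < N" "n < N" "i \<noteq> n" and z: "A n n = 0"
  shows "A i n = 0"
proof (rule ccontr)
  assume ne: "A i n \<noteq> 0"
  \<comment> \<open>With a = Re (\<open>A i i\<close>), the form at (1, t) is a - 2 (a + 1) <
    0.\<close>
  define t where "t = - of_real ((Re (A i i) + 1) / (cmod (A i n))\<^sup>2) * cnj (A i n)"
  have h: "A n i = cnj (A i n)" by (rule psd_hermitian[OF psd ij])
  have "nonneg (cnj 1 * A i i * 1 + cnj 1 * A i n * t + cnj t * A n i * 1 + cnj t * A n n * t)"
    using psd[of "\<lambda>k. if k = i then 1 else if k = n then t else 0"] unfolding qform_two_points[OF ij] .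
  then have "nonneg (A i i + (A i n * t + cnj (A i n * t)))" using h z by (simp add: algebra_simps)
  then have "Re (A i i) + 2 * Re (A i n * t) \<ge> 0" by (simp add: nonneg_def mult.commute)
  moreover have "A i n * t = - of_real ((Re (A i i) + 1) / (cmod (A i n))\<^sup>2) * of_real ((cmod (A i n))\<^sup>2)"
    unfolding t_def complex_norm_square by (simp add: algebra_simps)
  then have "A i n * t = - of_real (Re (A i i) + 1)" using ne by simp
  moreover have "Re (A i i) \<ge> 0"
    using psd[of "\<lambda>k. if k = i then 1 else if k = n then 0 else 0"] qform_two_points[OF ij, of A 1 0]
    by (simp add: nonneg_def)
  ultimately show False by simp
qed

text \<open>Cholesky factorisation: the last row and column are split off as a rank-one term,
  leaving a Schur complement. A zero pivot is harmless because its row and column vanish by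
  \<open>psd_zero_diag\<close>.\<close>

lemma psd_decomposition:
  assumes "\<And>w. nonneg (qform n A w)"
  shows "\<exists>v. \<forall>i<n. \<forall>j<n. A i j = (\<Sum>a<n. v a i * cnj (v a j))"
  using assms
proof (induction n arbitrary: A)
  case (Suc n)
  note psd = Suc.prems
  have restrict: "qform (Suc n) A (w(n := t)) = qform n A w + (\<Sum>i<n. cnj (w i) * A i n) * t
      + cnj t * (\<Sum>j<n. A n j * w j) + cnj t * A n n * t" for w t
  proof -
    have "(\<Sum>i<n. \<Sum>j<n. cnj ((w(n := t)) i) * A i j * (w(n := t)) j) = qform n A w"
      unfolding qform_def by (intro sum.cong refl) auto
    moreover have "(\<Sum>i<n. cnj ((w(n := t)) i) * A i n * t) = (\<Sum>i<n. cnj (w i) * A i n) * t"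
      unfolding sum_distrib_right by (intro sum.cong refl) auto
    moreover have "(\<Sum>j<n. cnj t * A n j * (w(n := t)) j) = cnj t * (\<Sum>j<n. A n j * w j)"
      unfolding sum_distrib_left by (intro sum.cong refl) auto
    ultimately show ?thesis by (simp add: qform_def sum.distrib)
  qed
  have herm: "A n i = cnj (A i n)" if "i < n" for i
    using psd_hermitian[OF psd, of i n] that by simp
  have "nonneg (A n n)" using psd[of "(\<lambda>_. 0)(n := 1)"] unfolding restrict by (simp add: qform_def)
  then obtain \<alpha> where \<alpha>: "A n n = of_real \<alpha>" "\<alpha> \<ge> 0"
    by (metis complex_eq_iff complex_of_real_def complex.sel nonneg_def)
  show ?case
  proof (cases "\<alpha> = 0")
    case True
    have z: "A i n = 0" "A n i = 0" if "i < n" for i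
      using psd_zero_diag[OF psd, of i n] herm that True \<alpha> by auto
    have "nonneg (qform n A w)" for w
      using psd[of "w(n := 0)"] unfolding restrict by simp
    then obtain v where v: "\<forall>i<n. \<forall>j<n. A i j = (\<Sum>a<n. v a i * cnj (v a j))"
      using Suc.IH by blast
    have "A i j = (\<Sum>a<Suc n. ((\<lambda>a. (v a)(n := 0))(n := \<lambda>_. 0)) a i * cnj (((\<lambda>a. (v a)(n := 0))(n := \<lambda>_. 0)) a j))"
      if "i < Suc n" "j < Suc n" for i j
      using that z v True \<alpha> by (auto simp: less_Suc_eq)
    then show ?thesis by blast
  next
    case False
    then have \<alpha>0: "\<alpha> > 0" using \<alpha> by simp
    \<comment> \<open>The Schur complement. Its form at \<open>w\<close> is the full form at
      \<open>w\<close> extended by - \<beta> / \<alpha>, the choice that completes the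
      square.\<close>
    define B where "B i j = A i j - A i n * A n j / of_real \<alpha>" for i j
    have "nonneg (qform n B w)" for w
    proof -
      define \<beta> where "\<beta> = (\<Sum>j<n. A n j * w j)"
      define \<gamma> where "\<gamma> = (\<Sum>i<n. cnj (w i) * A i n)"
      have "qform n B w = qform n A w - (\<Sum>i<n. \<Sum>j<n. (cnj (w i) * A i n) * (A n j * w j)) / of_real \<alpha>"
        by (simp add: qform_def B_def algebra_simps sum_subtractf sum_divide_distrib diff_divide_distrib)
      also have "\<dots> = qform n A w - \<gamma> * \<beta> / of_real \<alpha>"
        by (simp add: \<beta>_def \<gamma>_def sum_product)
      also have "\<dots> = qform (Suc n) A (w(n := - \<beta> / of_real \<alpha>))"
        unfolding restrict \<alpha> \<beta>_def[symmetric] \<gamma>_def[symmetric] using \<alpha>0 by (simp add: field_simps)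
      finally show ?thesis using psd by simp
    qed
    then obtain v where v: "\<forall>i<n. \<forall>j<n. B i j = (\<Sum>a<n. v a i * cnj (v a j))"
      using Suc.IH by blast
    define v' where "v' = (\<lambda>a. (v a)(n := 0))(n := \<lambda>i. A i n / of_real (sqrt \<alpha>))"
    have sq: "of_real (sqrt \<alpha>) * of_real (sqrt \<alpha>) = (of_real \<alpha> :: complex)"
      using \<alpha>0 by (simp flip: of_real_mult)
    have "A i j = (\<Sum>a<Suc n. v' a i * cnj (v' a j))" if ij: "i < Suc n" "j < Suc n" for i j
    proof -
      have last: "v' n i * cnj (v' n j) = A i n * cnj (A j n) / of_real \<alpha>"
        using sq by (simp add: v'_def)
      have "(\<Sum>a<n. v' a i * cnj (v' a j)) = (if i = n \<or> j = n then 0 else \<Sum>a<n. v a i * cnj (v a j))"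
        by (auto simp: v'_def)
      then have "(\<Sum>a<Suc n. v' a i * cnj (v' a j))
          = (if i = n \<or> j = n then 0 else B i j) + A i n * cnj (A j n) / of_real \<alpha>"
        using v ij last by (auto simp: less_Suc_eq)
      moreover have "cnj (A j n) = A n j" using herm ij \<alpha> by (cases "j = n") auto
      ultimately show ?thesis using herm[of i] \<alpha> \<alpha>0 ij by (auto simp: B_def)
    qed
    then show ?thesis by blast
  qed
qed simp

lemma sum_lessThan_mult:
  fixes f :: "nat \<Rightarrow> 'a::comm_monoid_add"
  shows "(\<Sum>x<n * d. f x) = (\<Sum>s<n. \<Sum>k<d. f (s * d + k))"
proof -
  have "(\<Sum>x<n * d. f x) = (\<Sum>s<n. sum f {s * d..<s * d + d})" by (simp add: sum.nat_group)
  also have "\<dots> = (\<Sum>s<n. \<Sum>k<d. f (s * d + k))"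
  proof (rule sum.cong[OF refl])
    fix s
    show "sum f {s * d..<s * d + d} = (\<Sum>k<d. f (s * d + k))"
      using sum.shift_bounds_nat_ivl[of f 0 "s * d" d] by (simp add: add.commute lessThan_atLeast0)
  qed
  finally show ?thesis .
qed

lemma quadratic_form_eq_qform:
  assumes "A \<in> carrier_mat n n" "v \<in> carrier_vec n"
  shows "conjugate v \<bullet> (A *\<^sub>v v) = qform n (\<lambda>i j. A $$ (i, j)) (\<lambda>i. v $ i)"
  using assms
  by (auto simp: scalar_prod_def qform_def lessThan_atLeast0 sum_distrib_left mult.assoc
      intro!: sum.cong)

lemma psd_iff_qform:
  "psd n A \<longleftrightarrow> A \<in> carrier_mat n n \<and> (\<forall>w. nonneg (qform n (\<lambda>i j. A $$ (i, j)) w))"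
proof -
  have "qform n (\<lambda>i j. A $$ (i, j)) w = qform n (\<lambda>i j. A $$ (i, j)) (\<lambda>i. vec n w $ i)" for w
    by (simp add: qform_def)
  then have "nonneg (qform n (\<lambda>i j. A $$ (i, j)) w)"
    if "A \<in> carrier_mat n n" "\<forall>v\<in>carrier_vec n. nonneg (conjugate v \<bullet> (A *\<^sub>v v))" for w
    using bspec[OF that(2), of "vec n w"] quadratic_form_eq_qform[OF that(1), of "vec n w"]
    by (simp add: qform_def)
  then show ?thesis
    by (auto simp: psd_def quadratic_form_eq_qform simp flip: nonneg_def)
qed

section \<open>Kraus maps and Choi's theorem\<close>

definition kraus :: "nat \<Rightarrow> nat \<Rightarrow> 'i set \<Rightarrow> ('i \<Rightarrow> nat \<Rightarrow> nat \<Rightarrow> complex) \<Rightarrow> complex mat \<Rightarrow> complex mat" where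
  "kraus d e I K X = mat e e (\<lambda>(i, j). \<Sum>a\<in>I. \<Sum>k<d. \<Sum>l<d. K a i k * X $$ (k, l) * cnj (K a j l))"

definition kraus_tp :: "nat \<Rightarrow> nat \<Rightarrow> 'i set \<Rightarrow> ('i \<Rightarrow> nat \<Rightarrow> nat \<Rightarrow> complex) \<Rightarrow> bool" where
  "kraus_tp d e I K \<longleftrightarrow>
     (\<forall>k<d. \<forall>l<d. (\<Sum>a\<in>I. \<Sum>i<e. K a i k * cnj (K a i l)) = (if k = l then 1 else 0))"

lemma kraus_carrier [simp]: "kraus d e I K X \<in> carrier_mat e e"
  by (simp add: kraus_def)

lemma kraus_lin: "lin_map d e (kraus d e I K)"
  unfolding lin_map_def
proof (intro conjI ballI allI)
  fix A B :: "complex mat" assume "A \<in> carrier_mat d d" "B \<in> carrier_mat d d"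
  then show "kraus d e I K (A + B) = kraus d e I K A + kraus d e I K B"
    by (intro eq_matI) (auto simp: kraus_def algebra_simps sum.distrib)
next
  fix A :: "complex mat" and c assume "A \<in> carrier_mat d d"
  then show "kraus d e I K (c \<cdot>\<^sub>m A) = c \<cdot>\<^sub>m kraus d e I K A"
    by (intro eq_matI) (auto simp: kraus_def algebra_simps sum_distrib_left)
qed simp

lemma kraus_trace:
  assumes tp: "kraus_tp d e I K" and "A \<in> carrier_mat d d"
  shows "mtrace (kraus d e I K A) = mtrace A"
proof -
  have "mtrace (kraus d e I K A) = (\<Sum>i<e. \<Sum>a\<in>I. \<Sum>k<d. \<Sum>l<d. K a i k * A $$ (k, l) * cnj (K a i l))"
    by (simp add: mtrace_def kraus_def)
  also have "\<dots> = (\<Sum>k<d. \<Sum>l<d. \<Sum>a\<in>I. \<Sum>i<e. K a i k * A $$ (k, l) * cnj (K a i l))"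
    unfolding sum.cartesian_product
    by (rule sum.reindex_bij_witness[of _ "\<lambda>(k, l, a, i). (i, a, k, l)" "\<lambda>(i, a, k, l). (k, l, a, i)"]) auto
  also have "\<dots> = (\<Sum>k<d. \<Sum>l<d. A $$ (k, l) * (\<Sum>a\<in>I. \<Sum>i<e. K a i k * cnj (K a i l)))"
    by (simp add: sum_distrib_left mult_ac)
  also have "\<dots> = (\<Sum>k<d. \<Sum>l<d. if k = l then A $$ (k, l) else 0)"
    using tp by (intro sum.cong refl) (simp add: kraus_tp_def)
  also have "\<dots> = mtrace A" using assms(2) by (simp add: mtrace_def)
  finally show ?thesis .
qed

lemma div_mod_split: "k < (e::nat) \<Longrightarrow> (s * e + k) div e = s" "k < (e::nat) \<Longrightarrow> (s * e + k) mod e = k"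
  by auto

lemma mult_add_less: "s < n \<Longrightarrow> k < d \<Longrightarrow> s * d + k < n * (d::nat)"
proof -
  assume "s < n" "k < d"
  then have "s * d + k < Suc s * d" "Suc s * d \<le> n * d" by (simp, intro mult_le_mono1, simp)
  then show ?thesis by linarith
qed

text \<open>The output form at \<open>v\<close> is a sum of input forms, one for each Kraus
  operator, at the vectors \<open>w a\<close> obtained from \<open>v\<close> by the adjoint of the
  identity tensored with \<open>K a\<close>.\<close>

lemma kraus_cp:
  assumes X: "psd (n * d) X"
  shows "psd (n * e) (id_tensor n d e (kraus d e I K) X)"
proof -
  have Xc: "X \<in> carrier_mat (n * d) (n * d)" and Xp: "\<And>w. nonneg (qform (n * d) (\<lambda>i j. X $$ (i, j)) w)"
    using X by (auto simp: psd_iff_qform)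
  have "nonneg (qform (n * e) (\<lambda>i j. id_tensor n d e (kraus d e I K) X $$ (i, j)) v)" for v
  proof -
    let ?h = "\<lambda>s i t j a k l. (cnj (v (s * e + i)) * K a i k) * X $$ (s * d + k, t * d + l) * (cnj (K a j l) * v (t * e + j))"
    have entry: "id_tensor n d e (kraus d e I K) X $$ (s * e + i, t * e + j)
        = (\<Sum>a\<in>I. \<Sum>k<d. \<Sum>l<d. K a i k * X $$ (s * d + k, t * d + l) * cnj (K a j l))"
      if "s < n" "t < n" "i < e" "j < e" for s t i j
      using that by (simp add: id_tensor_def mult_add_less div_mod_split blk_def kraus_def)
    define w where "w a x = (\<Sum>i<e. cnj (K a i (x mod d)) * v (x div d * e + i))" for a x
    have "qform (n * e) (\<lambda>i j. id_tensor n d e (kraus d e I K) X $$ (i, j)) v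
       = (\<Sum>s<n. \<Sum>i<e. \<Sum>t<n. \<Sum>j<e. \<Sum>a\<in>I. \<Sum>k<d. \<Sum>l<d. ?h s i t j a k l)"
      unfolding qform_def sum_lessThan_mult
      by (intro sum.cong refl)
        (simp add: entry sum_distrib_left sum_distrib_right mult_ac[where 'a = complex])
    also have "\<dots> = (\<Sum>a\<in>I. \<Sum>s<n. \<Sum>k<d. \<Sum>t<n. \<Sum>l<d. \<Sum>i<e. \<Sum>j<e. ?h s i t j a k l)"
      unfolding sum.cartesian_product
      by (rule sum.reindex_bij_witness[of _
            "\<lambda>(a, s, k, t, l, i, j). (s, i, t, j, a, k, l)" "\<lambda>(s, i, t, j, a, k, l). (a, s, k, t, l, i, j)"])
        auto
    also have "\<dots> = (\<Sum>a\<in>I. qform (n * d) (\<lambda>i j. X $$ (i, j)) (w a))"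
      unfolding qform_def sum_lessThan_mult
      by (intro sum.cong refl) (simp add: w_def div_mod_split sum_distrib_left sum_distrib_right mult_ac[where 'a = complex])
    also have "nonneg \<dots>" by (intro nonneg_sum Xp)
    finally show ?thesis .
  qed
  then show ?thesis by (auto simp: psd_iff_qform id_tensor_def)
qed

lemma channel_kraus: "kraus_tp d e I K \<Longrightarrow> channel d e (kraus d e I K)"
  by (simp add: channel_def kraus_lin kraus_trace kraus_cp)

lemma unit_mat_carrier [simp]: "unit_mat d k l \<in> carrier_mat d d"
  by (simp add: unit_mat_def)

lemma lin_map_entries:
  assumes T: "lin_map d e T" and X: "X \<in> carrier_mat d d" and ij: "i < e" "j < e"
  shows "T X $$ (i, j) = (\<Sum>k<d. \<Sum>l<d. X $$ (k, l) * T (unit_mat d k l) $$ (i, j))"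
proof -
  define Z where "Z S = mat d d (\<lambda>(k, l). if (k, l) \<in> S then X $$ (k, l) else 0)" for S
  have car: "T A \<in> carrier_mat e e" if "A \<in> carrier_mat d d" for A
    using T that by (auto simp: lin_map_def)
  have "T (Z S) $$ (i, j) = (\<Sum>(k, l)\<in>S. X $$ (k, l) * T (unit_mat d k l) $$ (i, j))"
    if "finite S" "S \<subseteq> {..<d} \<times> {..<d}" for S
    using that
  proof (induction S rule: finite_induct)
    case empty
    have "Z {} = 0 \<cdot>\<^sub>m unit_mat d 0 0" by (intro eq_matI) (auto simp: Z_def unit_mat_def)
    then have "T (Z {}) = 0 \<cdot>\<^sub>m T (unit_mat d 0 0)" using T by (simp add: lin_map_def)
    then show ?case using car[of "unit_mat d 0 0"] ij by simp
  next
    case (insert x S)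
    obtain k l where x: "x = (k, l)" by (cases x)
    have "Z (insert x S) = Z S + X $$ (k, l) \<cdot>\<^sub>m unit_mat d k l"
      using insert x by (intro eq_matI) (auto simp: Z_def unit_mat_def)
    then have "T (Z (insert x S)) = T (Z S) + X $$ (k, l) \<cdot>\<^sub>m T (unit_mat d k l)"
      using T by (simp add: lin_map_def Z_def)
    moreover have "T (Z S) \<in> carrier_mat e e" by (rule car) (simp add: Z_def)
    ultimately have "T (Z (insert x S)) $$ (i, j) = T (Z S) $$ (i, j) + X $$ (k, l) * T (unit_mat d k l) $$ (i, j)"
      using car[of "unit_mat d k l"] ij by simp
    then show ?case using insert x by simp
  qed
  from this[of "{..<d} \<times> {..<d}"]
  have "T (Z ({..<d} \<times> {..<d})) $$ (i, j) = (\<Sum>(k, l)\<in>{..<d} \<times> {..<d}. X $$ (k, l) * T (unit_mat d k l) $$ (i, j))"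
    by simp
  moreover have "Z ({..<d} \<times> {..<d}) = X" using X by (intro eq_matI) (auto simp: Z_def)
  ultimately show ?thesis by (simp add: sum.cartesian_product)
qed

lemma kraus_unit:
  assumes "k < d" "l < d" "i < e" "j < e"
  shows "kraus d e I K (unit_mat d k l) $$ (i, j) = (\<Sum>a\<in>I. K a i k * cnj (K a j l))"
proof -
  have "kraus d e I K (unit_mat d k l) $$ (i, j)
      = (\<Sum>a\<in>I. \<Sum>k'<d. \<Sum>l'<d. K a i k' * unit_mat d k l $$ (k', l') * cnj (K a j l'))"
    using assms by (simp add: kraus_def)
  also have "\<dots> = (\<Sum>a\<in>I. \<Sum>k'<d. \<Sum>l'<d. if l' = l then if k' = k then K a i k' * cnj (K a j l') else 0 else 0)"
    by (intro sum.cong refl) (auto simp: unit_mat_def)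
  finally have "kraus d e I K (unit_mat d k l) $$ (i, j)
      = (\<Sum>a\<in>I. \<Sum>k'<d. \<Sum>l'<d. if l' = l then if k' = k then K a i k' * cnj (K a j l') else 0 else 0)" .
  then show ?thesis using assms by simp
qed

lemma mtrace_unit: "k < d \<Longrightarrow> l < d \<Longrightarrow> mtrace (unit_mat d k l) = (if k = l then 1 else 0)"
proof -
  assume kl: "k < d" "l < d"
  have "mtrace (unit_mat d k l) = (\<Sum>i<d. if i = k then if k = l then 1 else 0 else 0)"
    unfolding mtrace_def unit_mat_def dim_row_mat by (intro sum.cong refl) (simp add: index_mat)
  then show ?thesis using kl by simp
qed

text \<open>Choi's theorem. \<open>X0\<close> is the unnormalised maximally entangled projection, so
  the blocks of its image are the values of \<open>T\<close> on matrix units. That image is positive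
  semidefinite; the vectors of its rank-one decomposition, reshaped to matrices, are the Kraus
  operators.\<close>

theorem kraus_decomposition:
  assumes T: "channel d e T"
  shows "\<exists>K m. kraus_tp d e {..<m::nat} K \<and> (\<forall>X\<in>carrier_mat d d. T X = kraus d e {..<m} K X)"
proof -
  have lin: "lin_map d e T" using T by (simp add: channel_def)
  have car: "T A \<in> carrier_mat e e" if "A \<in> carrier_mat d d" for A
    using lin that by (auto simp: lin_map_def)
  define X0 :: "complex mat" where
    "X0 = mat (d * d) (d * d) (\<lambda>(r, c). if r div d = r mod d \<and> c div d = c mod d then 1 else 0)"
  have "nonneg (qform (d * d) (\<lambda>i j. X0 $$ (i, j)) w)" for w
  proof -
    define z where "z = (\<Sum>j<d * d. if j div d = j mod d then w j else 0)"
    have "qform (d * d) (\<lambda>i j. X0 $$ (i, j)) w = cnj z * z"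
      unfolding qform_def z_def cnj_sum sum_product by (intro sum.cong refl) (auto simp: X0_def)
    then show ?thesis by (simp add: nonneg_def)
  qed
  then have "psd (d * d) X0" by (simp add: psd_iff_qform X0_def)
  then have C: "psd (d * e) (id_tensor d d e T X0)" using T by (simp add: channel_def)
  have b: "blk d X0 k l = unit_mat d k l" if "k < d" "l < d" for k l
    using that by (intro eq_matI) (auto simp: blk_def X0_def unit_mat_def mult_add_less div_mod_split)
  define A where "A r c = id_tensor d d e T X0 $$ (r, c)" for r c
  have A: "A (k * e + i) (l * e + j) = T (unit_mat d k l) $$ (i, j)"
    if "k < d" "l < d" "i < e" "j < e" for k l i j
    using that by (simp add: A_def id_tensor_def mult_add_less div_mod_split b)
  have Ap: "nonneg (qform (d * e) A w)" for w
    using C by (simp add: psd_iff_qform A_def[abs_def])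
  obtain v where v: "\<forall>r<d * e. \<forall>c<d * e. A r c = (\<Sum>a<d * e. v a r * cnj (v a c))"
    using psd_decomposition[of "d * e" A] Ap by blast
  define K where "K a i k = v a (k * e + i)" for a i k
  have TK: "T (unit_mat d k l) $$ (i, j) = (\<Sum>a<d * e. K a i k * cnj (K a j l))"
    if "k < d" "l < d" "i < e" "j < e" for k l i j
    using that v A mult_add_less by (auto simp: K_def)
  have "kraus_tp d e {..<d * e} K"
    unfolding kraus_tp_def
  proof (intro allI impI)
    fix k l assume kl: "k < d" "l < d"
    have "(\<Sum>a<d * e. \<Sum>i<e. K a i k * cnj (K a i l)) = (\<Sum>i<e. T (unit_mat d k l) $$ (i, i))"
      by (subst sum.swap) (simp add: TK kl)
    also have "\<dots> = mtrace (T (unit_mat d k l))"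
      using car[of "unit_mat d k l"] by (simp add: mtrace_def)
    also have "\<dots> = (if k = l then 1 else 0)"
      using T kl by (simp add: channel_def mtrace_unit)
    finally show "(\<Sum>a<d * e. \<Sum>i<e. K a i k * cnj (K a i l)) = (if k = l then 1 else 0)" .
  qed
  moreover have "T X = kraus d e {..<d * e} K X" if X: "X \<in> carrier_mat d d" for X
  proof (rule eq_matI)
    fix i j assume "i < dim_row (kraus d e {..<d * e} K X)" "j < dim_col (kraus d e {..<d * e} K X)"
    then have ij: "i < e" "j < e" by (auto simp: kraus_def)
    show "T X $$ (i, j) = kraus d e {..<d * e} K X $$ (i, j)"
      unfolding lin_map_entries[OF lin X ij] lin_map_entries[OF kraus_lin X ij]
      by (intro sum.cong refl) (simp add: TK kraus_unit ij)
  qed (use car[OF X] in \<open>auto simp: kraus_def\<close>)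
  ultimately show ?thesis by blast
qed

section \<open>Composition and limits of channels\<close>

lemma channel_lin: "channel d e T \<Longrightarrow> lin_map d e T"
  by (simp add: channel_def)

lemma channel_carrier: "channel d e T \<Longrightarrow> X \<in> carrier_mat d d \<Longrightarrow> T X \<in> carrier_mat e e"
  by (auto simp: channel_def lin_map_def)

lemma blk_carrier [simp]: "blk d X s t \<in> carrier_mat d d"
  by (simp add: blk_def)

lemma div_less_mult: "r < n * e \<Longrightarrow> r div e < (n::nat)"
  by (simp add: less_mult_imp_div_less)

lemma mod_less_mult: "r < n * e \<Longrightarrow> r mod e < (e::nat)"
  by (cases "e = 0") auto

lemma id_tensor_cong:
  assumes "\<And>X. X \<in> carrier_mat d d \<Longrightarrow> T X = S X"
  shows "id_tensor n d e T X = id_tensor n d e S X"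
  using assms by (simp add: id_tensor_def)

lemma channel_cong:
  assumes "channel d e T" "\<And>X. X \<in> carrier_mat d d \<Longrightarrow> S X = T X"
  shows "channel d e S"
  using assms id_tensor_cong[of d S T] unfolding channel_def lin_map_def
  by (auto simp: add_carrier_mat smult_carrier_mat)

lemma channel_id: "channel d d id"
proof -
  have "id_tensor n d d id X = X" if "X \<in> carrier_mat (n * d) (n * d)" for n X
    using that by (intro eq_matI) (auto simp: id_tensor_def blk_def mod_less_mult)
  then show ?thesis by (auto simp: channel_def lin_map_def psd_def)
qed

lemma channel_comp:
  assumes T: "channel d e T" and S: "channel e f S"
  shows "channel d f (S \<circ> T)"
  unfolding channel_def
proof (intro conjI ballI allI impI)
  show "lin_map d f (S \<circ> T)"
    using channel_lin[OF T] channel_lin[OF S] by (auto simp: lin_map_def)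
  show "mtrace ((S \<circ> T) A) = mtrace A" if "A \<in> carrier_mat d d" for A
    using T S channel_carrier[OF T that] that by (simp add: channel_def)
  fix n X assume X: "psd (n * d) X"
  have "blk e (id_tensor n d e T X) s t = T (blk d X s t)" if "s < n" "t < n" for s t
    using that channel_carrier[OF T, of "blk d X s t"]
    by (intro eq_matI) (auto simp: blk_def[of e] id_tensor_def mult_add_less div_mod_split)
  then have "id_tensor n d f (S \<circ> T) X = id_tensor n e f S (id_tensor n d e T X)"
    by (intro eq_matI) (auto simp: id_tensor_def[of n d f] id_tensor_def[of n e f] div_less_mult)
  then show "psd (n * f) (id_tensor n d f (S \<circ> T) X)"
    using T S X by (simp add: channel_def)
qed

lemma channel_funpow: "channel d d T \<Longrightarrow> channel d d (T ^^ t)"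
  by (induction t) (auto intro: channel_comp channel_id[unfolded id_def] simp: id_def)

lemma lin_map_eqI:
  assumes "lin_map d e T" "lin_map d e S" "X \<in> carrier_mat d d"
    and "\<And>k l i j. k < d \<Longrightarrow> l < d \<Longrightarrow> i < e \<Longrightarrow> j < e \<Longrightarrow>
      T (unit_mat d k l) $$ (i, j) = S (unit_mat d k l) $$ (i, j)"
  shows "T X = S X"
proof -
  have "T X \<in> carrier_mat e e" "S X \<in> carrier_mat e e" using assms by (auto simp: lin_map_def)
  moreover have "T X $$ (i, j) = S X $$ (i, j)" if ij: "i < e" "j < e" for i j
    unfolding lin_map_entries[OF assms(1,3) ij] lin_map_entries[OF assms(2,3) ij]
    by (intro sum.cong refl) (simp add: assms(4) ij)
  ultimately show ?thesis by (intro eq_matI) auto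
qed

lemma kraus_tp_norm:
  assumes "kraus_tp d e I K" "k < d"
  shows "(\<Sum>a\<in>I. \<Sum>i<e. (cmod (K a i k))\<^sup>2) = 1"
proof -
  have "complex_of_real (\<Sum>a\<in>I. \<Sum>i<e. (cmod (K a i k))\<^sup>2) = 1"
    using assms unfolding kraus_tp_def of_real_sum complex_norm_square by simp
  then show ?thesis using of_real_eq_1_iff by blast
qed

text \<open>Cauchy-Schwarz over the Kraus index. The bound supplies the compactness for extracting
  limits of powers and the uniform constant in \<open>channel_perturbation\<close>.\<close>

lemma channel_entry_bound:
  assumes T: "channel d e T" and kl: "k < d" "l < d" and ij: "i < e" "j < e"
  shows "cmod (T (unit_mat d k l) $$ (i, j)) \<le> 1"
proof -
  obtain K and m :: nat where K: "kraus_tp d e {..<m} K"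
    and TK: "\<forall>X\<in>carrier_mat d d. T X = kraus d e {..<m} K X"
    using kraus_decomposition[OF T] by blast
  have row: "(\<Sum>a<m. (cmod (K a i k))\<^sup>2) \<le> 1" if "k < d" "i < e" for i k
  proof -
    have "(\<Sum>a<m. (cmod (K a i k))\<^sup>2) \<le> (\<Sum>a<m. \<Sum>i<e. (cmod (K a i k))\<^sup>2)"
      using that(2) by (intro sum_mono member_le_sum) auto
    then show ?thesis using kraus_tp_norm[OF K that(1)] by simp
  qed
  have "T (unit_mat d k l) $$ (i, j) = (\<Sum>a<m. K a i k * cnj (K a j l))"
    using TK kl ij by (simp add: kraus_unit)
  then have "(cmod (T (unit_mat d k l) $$ (i, j)))\<^sup>2 \<le> (\<Sum>a<m. (cmod (K a i k))\<^sup>2) * (\<Sum>a<m. (cmod (K a j l))\<^sup>2)"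
    using complex_Cauchy_Schwarz_sum[of "\<lambda>a. K a i k" "\<lambda>a. cnj (K a j l)" "{..<m}"] by simp
  also have "\<dots> \<le> 1 * 1"
    using row[OF kl(1) ij(1)] row[OF kl(2) ij(2)] by (intro mult_mono) (auto intro: sum_nonneg)
  finally show ?thesis by (simp add: power2_le_iff_abs_le abs_le_square_iff power_le_one_iff)
qed

text \<open>Only matrix units are tested: they determine a linear map on
  \<open>carrier_mat d d\<close>, and outside that carrier the functions are arbitrary.\<close>

definition chan_tendsto :: "nat \<Rightarrow> nat \<Rightarrow> (nat \<Rightarrow> complex mat \<Rightarrow> complex mat) \<Rightarrow> (complex mat \<Rightarrow> complex mat) \<Rightarrow> bool" where
  "chan_tendsto d e F P \<longleftrightarrow> (\<forall>k<d. \<forall>l<d. \<forall>i<e. \<forall>j<e.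
     (\<lambda>n. F n (unit_mat d k l) $$ (i, j)) \<longlonglongrightarrow> P (unit_mat d k l) $$ (i, j))"

lemma chan_tendsto_apply:
  assumes "\<And>n. lin_map d e (F n)" "lin_map d e P" "chan_tendsto d e F P"
    "X \<in> carrier_mat d d" "i < e" "j < e"
  shows "(\<lambda>n. F n X $$ (i, j)) \<longlonglongrightarrow> P X $$ (i, j)"
  unfolding lin_map_entries[OF assms(1,4,5,6)] lin_map_entries[OF assms(2,4,5,6)]
  using assms(3,5,6) by (intro tendsto_sum tendsto_mult tendsto_const) (auto simp: chan_tendsto_def)

lemma nonneg_LIMSEQ:
  assumes "\<And>n. nonneg (f n)" "f \<longlonglongrightarrow> z"
  shows "nonneg z"
proof -
  have "(\<lambda>n. Im (f n)) \<longlonglongrightarrow> Im z" "(\<lambda>n. Re (f n)) \<longlonglongrightarrow> Re z"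
    using assms(2) by (auto intro: tendsto_intros)
  then show ?thesis
    using assms(1) LIMSEQ_unique[of "\<lambda>_. 0 :: real"] unfolding nonneg_def
    by (auto intro: LIMSEQ_le_const)
qed

text \<open>The limiting entries define a linear map; trace preservation and complete positivity
  survive because both are closed conditions on entries.\<close>

lemma channel_limit:
  assumes F: "\<And>n. channel d e (F n)"
    and conv: "\<And>k l i j. k < d \<Longrightarrow> l < d \<Longrightarrow> i < e \<Longrightarrow> j < e \<Longrightarrow>
      convergent (\<lambda>n. F n (unit_mat d k l) $$ (i, j))"
  shows "\<exists>P. channel d e P \<and> chan_tendsto d e F P"
proof -
  define L where "L k l i j = lim (\<lambda>n. F n (unit_mat d k l) $$ (i, j))" for k l i j
  have L: "(\<lambda>n. F n (unit_mat d k l) $$ (i, j)) \<longlonglongrightarrow> L k l i j"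
    if "k < d" "l < d" "i < e" "j < e" for k l i j
    using conv[OF that] by (simp add: L_def convergent_LIMSEQ_iff)
  define P where "P X = mat e e (\<lambda>(i, j). \<Sum>k<d. \<Sum>l<d. X $$ (k, l) * L k l i j)" for X
  have lin: "lin_map d e P"
    unfolding lin_map_def P_def
    by (auto intro!: eq_matI simp: distrib_right sum.distrib sum_distrib_left mult.assoc)
  have "P (unit_mat d k l) $$ (i, j) = L k l i j" if "k < d" "l < d" "i < e" "j < e" for k l i j
  proof -
    have "P (unit_mat d k l) $$ (i, j) = (\<Sum>k'<d. \<Sum>l'<d. unit_mat d k l $$ (k', l') * L k' l' i j)"
      using that by (simp add: P_def)
    also have "\<dots> = (\<Sum>k'<d. \<Sum>l'<d. if l' = l then if k' = k then L k' l' i j else 0 else 0)"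
      by (intro sum.cong refl) (auto simp: unit_mat_def)
    finally show ?thesis using that by simp
  qed
  then have tends: "chan_tendsto d e F P" using L by (simp add: chan_tendsto_def)
  have ap: "(\<lambda>n. F n X $$ (i, j)) \<longlonglongrightarrow> P X $$ (i, j)" if "X \<in> carrier_mat d d" "i < e" "j < e" for X i j
    by (rule chan_tendsto_apply[OF channel_lin[OF F] lin tends that])
  have Pc: "P X \<in> carrier_mat e e" for X by (simp add: P_def)
  have tr: "mtrace (P A) = mtrace A" if A: "A \<in> carrier_mat d d" for A
  proof -
    have "dim_row (F n A) = e" for n using channel_carrier[OF F[of n] A] by simp
    moreover have "dim_row (P A) = e" using Pc[of A] by simp
    ultimately have "(\<lambda>n. mtrace (F n A)) \<longlonglongrightarrow> mtrace (P A)"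
      by (auto simp: mtrace_def intro!: tendsto_sum ap A)
    moreover have "mtrace (F n A) = mtrace A" for n using F[of n] A by (simp add: channel_def)
    ultimately have "(\<lambda>n. mtrace A) \<longlonglongrightarrow> mtrace (P A)" by simp
    then show ?thesis using LIMSEQ_unique[OF tendsto_const] by metis
  qed
  have cp: "psd (n * e) (id_tensor n d e P X)" if X: "psd (n * d) X" for n X
  proof -
    have "nonneg (qform (n * e) (\<lambda>i j. id_tensor n d e P X $$ (i, j)) w)" for w
    proof (rule nonneg_LIMSEQ)
      show "nonneg (qform (n * e) (\<lambda>i j. id_tensor n d e (F m) X $$ (i, j)) w)" for m
        using F[of m] X unfolding channel_def psd_iff_qform by blast
      show "(\<lambda>m. qform (n * e) (\<lambda>i j. id_tensor n d e (F m) X $$ (i, j)) w)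
          \<longlonglongrightarrow> qform (n * e) (\<lambda>i j. id_tensor n d e P X $$ (i, j)) w"
        unfolding qform_def
        by (intro tendsto_sum tendsto_mult tendsto_const)
          (auto simp: id_tensor_def mod_less_mult intro!: ap)
    qed
    then show ?thesis by (simp add: psd_iff_qform id_tensor_def)
  qed
  show ?thesis using lin tr cp tends by (auto simp: channel_def)
qed

lemma comp_entries:
  assumes "lin_map d e T" "lin_map e f S" "k < d" "l < d" "i < f" "j < f"
  shows "S (T (unit_mat d k l)) $$ (i, j)
    = (\<Sum>s<e. \<Sum>t<e. T (unit_mat d k l) $$ (s, t) * S (unit_mat e s t) $$ (i, j))"
  using assms by (intro lin_map_entries) (auto simp: lin_map_def)

lemma chan_tendsto_comp:
  assumes F: "\<And>n. lin_map d e (F n)" "lin_map d e P" "chan_tendsto d e F P"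
    and G: "\<And>n. lin_map e f (G n)" "lin_map e f Q" "chan_tendsto e f G Q"
  shows "chan_tendsto d f (\<lambda>n. G n \<circ> F n) (Q \<circ> P)"
  unfolding chan_tendsto_def comp_def
proof (intro allI impI)
  fix k l i j assume kl: "k < d" "l < d" and ij: "i < f" "j < f"
  show "(\<lambda>n. G n (F n (unit_mat d k l)) $$ (i, j)) \<longlonglongrightarrow> Q (P (unit_mat d k l)) $$ (i, j)"
    unfolding comp_entries[OF F(1) G(1) kl ij] comp_entries[OF F(2) G(2) kl ij]
    using F(3) G(3) kl ij by (intro tendsto_sum tendsto_mult) (auto simp: chan_tendsto_def)
qed

lemma chan_tendsto_unique:
  assumes "chan_tendsto d e F P" "chan_tendsto d e F Q" "lin_map d e P" "lin_map d e Q" "X \<in> carrier_mat d d"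
  shows "P X = Q X"
  using assms(1,2) unfolding chan_tendsto_def
  by (intro lin_map_eqI[OF assms(3-5)]) (meson LIMSEQ_unique)

lemma convergent_subseq_family:
  fixes x :: "nat \<Rightarrow> 'i \<Rightarrow> complex"
  assumes "finite I" "\<And>n i. i \<in> I \<Longrightarrow> cmod (x n i) \<le> B"
  shows "\<exists>s. strict_mono (s :: nat \<Rightarrow> nat) \<and> (\<forall>i\<in>I. convergent (\<lambda>n. x (s n) i))"
  using assms
proof (induction I rule: finite_induct)
  case empty
  then show ?case using strict_mono_id by (auto simp: id_def)
next
  case (insert a I)
  then obtain s where s: "strict_mono s" "\<forall>i\<in>I. convergent (\<lambda>n. x (s n) i)" by auto
  have "\<forall>n. cmod (x (s n) a) \<le> B" using insert.prems by simp
  from Bolzano_Weierstrass_complex_disc[OF this]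
  obtain t z where t: "strict_mono (t :: nat \<Rightarrow> nat)" "\<forall>e>0. \<exists>N. \<forall>n\<ge>N. cmod (x (s (t n)) a - z) < e"
    by blast
  have "(\<lambda>n. x (s (t n)) a) \<longlonglongrightarrow> z" using t(2) by (simp add: LIMSEQ_iff)
  moreover have "convergent (\<lambda>n. x (s (t n)) i)" if "i \<in> I" for i
    using convergent_subseq_convergent[OF _ t(1), of "\<lambda>n. x (s n) i"] s(2) that by (auto simp: comp_def)
  ultimately have "\<forall>i\<in>insert a I. convergent (\<lambda>n. x ((s \<circ> t) n) i)" by (auto simp: convergent_def)
  then show ?case using strict_mono_o[OF s(1) t(1)] by blast
qed

text \<open>For powers of a channel the five limits \<open>L\<close>, \<open>L\<close>, \<open>P\<close>, \<open>Q\<close>, \<open>G\<close> along \<open>m\<close>, \<open>m'\<close>, \<open>n\<close>, \<open>l\<close>, \<open>h\<close>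
  satisfy \<open>L = P L\<close> and \<open>P = L Q\<close>, which makes \<open>P\<close> idempotent, and \<open>P = T G\<close>.\<close>

lemma recurrent_times_exist:
  fixes x :: "nat \<Rightarrow> 'i \<Rightarrow> complex"
  assumes I: "finite I" and bd: "\<And>n i. i \<in> I \<Longrightarrow> cmod (x n i) \<le> B"
  shows "\<exists>m m' n l h :: nat \<Rightarrow> nat. (\<forall>k. m' k = n k + m k \<and> n k = m k + l k \<and> n k = Suc (h k) \<and> k \<le> n k) \<and>
    (\<forall>i\<in>I. (\<exists>L. (\<lambda>k. x (m k) i) \<longlonglongrightarrow> L \<and> (\<lambda>k. x (m' k) i) \<longlonglongrightarrow> L) \<and>
       convergent (\<lambda>k. x (n k) i) \<and> convergent (\<lambda>k. x (l k) i) \<and> convergent (\<lambda>k. x (h k) i))"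
proof -
  obtain s where s: "strict_mono s" "\<forall>i\<in>I. convergent (\<lambda>n. x (s n) i)"
    using convergent_subseq_family[of I x B] I bd by blast
  \<comment> \<open>Since s (g k) >= g k, the gap between the times \<open>s (g k)\<close> and
    \<open>s k\<close> is at least s k + k + 1. Hence none of the subtractions in \<open>n\<close>,
    \<open>l\<close> and \<open>h\<close> is truncated, and \<open>n k\<close> is at least k. As
    \<open>g\<close> is increasing, \<open>s\<close> and \<open>s \<circ> g\<close> have the same
    limits.\<close>
  define g where "g k = 2 * s k + k + 1" for k
  have sg: "s (g k) \<ge> 2 * s k + k + 1" for k
    using strict_mono_imp_increasing[OF s(1), of "g k"] by (simp add: g_def)
  define n where "n k = s (g k) - s k" for k
  define l where "l k = n k - s k" for k
  define h where "h k = n k - 1" for k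
  have rel: "s (g k) = n k + s k" "n k = s k + l k" "n k = Suc (h k)" "k \<le> n k" for k
    using sg[of k] by (auto simp: n_def l_def h_def)
  have "strict_mono g"
  proof (rule strict_monoI)
    fix a b :: nat assume "a < b"
    then show "g a < g b" using strict_monoD[OF s(1), of a b] by (simp add: g_def)
  qed
  \<comment> \<open>The three difference sequences are packed into one family, so that a single
    further subsequence makes all of them converge.\<close>
  define y where "y k = (\<lambda>(c::nat, i). x (if c = 0 then n k else if c = 1 then l k else h k) i)" for k
  have "finite ({..<3::nat} \<times> I)" using I by simp
  moreover have "cmod (y k j) \<le> B" if "j \<in> {..<3} \<times> I" for k j
    using that bd by (auto simp: y_def split: prod.splits)
  ultimately obtain t where t: "strict_mono t" "\<forall>j\<in>{..<3} \<times> I. convergent (\<lambda>k. y (t k) j)"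
    using convergent_subseq_family[of "{..<3} \<times> I" y B] by blast
  have "(\<exists>L. (\<lambda>k. x ((s \<circ> t) k) i) \<longlonglongrightarrow> L \<and> (\<lambda>k. x ((s \<circ> g \<circ> t) k) i) \<longlonglongrightarrow> L) \<and>
       convergent (\<lambda>k. x ((n \<circ> t) k) i) \<and> convergent (\<lambda>k. x ((l \<circ> t) k) i) \<and> convergent (\<lambda>k. x ((h \<circ> t) k) i)"
    if i: "i \<in> I" for i
  proof (intro conjI)
    obtain L where L: "(\<lambda>n. x (s n) i) \<longlonglongrightarrow> L" using s(2) i by (auto simp: convergent_def)
    have "(\<lambda>k. x ((s \<circ> t) k) i) \<longlonglongrightarrow> L"
      using LIMSEQ_subseq_LIMSEQ[OF L t(1)] by (simp add: comp_def)
    moreover have "(\<lambda>k. x ((s \<circ> g \<circ> t) k) i) \<longlonglongrightarrow> L"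
      using LIMSEQ_subseq_LIMSEQ[OF L strict_mono_o[OF \<open>strict_mono g\<close> t(1)]] by (simp add: comp_def)
    ultimately show "\<exists>L. (\<lambda>k. x ((s \<circ> t) k) i) \<longlonglongrightarrow> L \<and> (\<lambda>k. x ((s \<circ> g \<circ> t) k) i) \<longlonglongrightarrow> L" by blast
    show "convergent (\<lambda>k. x ((n \<circ> t) k) i)" "convergent (\<lambda>k. x ((l \<circ> t) k) i)" "convergent (\<lambda>k. x ((h \<circ> t) k) i)"
      using t(2)[rule_format, of "(0, i)"] t(2)[rule_format, of "(1, i)"] t(2)[rule_format, of "(2, i)"] i
      by (auto simp: y_def comp_def)
  qed
  moreover have "k \<le> (n \<circ> t) k" for k
    using strict_mono_imp_increasing[OF t(1), of k] rel(4)[of "t k"] by simp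
  ultimately show ?thesis
    by (intro exI[of _ "s \<circ> t"] exI[of _ "s \<circ> g \<circ> t"] exI[of _ "n \<circ> t"] exI[of _ "l \<circ> t"] exI[of _ "h \<circ> t"])
      (use rel in auto)
qed

section \<open>Tensor products of channels\<close>

text \<open>\<open>tensor_chan\<close> for maps between different sizes, needed because the factors
  \<open>F\<close> and \<open>J\<close> of the limit change the dimension.\<close>

definition gtensor :: "nat \<Rightarrow> nat \<Rightarrow> nat \<Rightarrow> nat \<Rightarrow> (complex mat \<Rightarrow> complex mat) \<Rightarrow> (complex mat \<Rightarrow> complex mat)
    \<Rightarrow> complex mat \<Rightarrow> complex mat" where
  "gtensor d e d' e' T S X = mat (e * e') (e * e') (\<lambda>(r, c).
     \<Sum>i<d. \<Sum>j<d. \<Sum>k<d'. \<Sum>l<d'. X $$ (i * d' + k, j * d' + l) *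
        T (unit_mat d i j) $$ (r div e', c div e') * S (unit_mat d' k l) $$ (r mod e', c mod e'))"

lemma tensor_chan_eq_gtensor: "tensor_chan d d' T S = gtensor d d d' d' T S"
  by (rule ext) (simp add: tensor_chan_def gtensor_def)

lemma gtensor_cong:
  assumes "\<And>X. X \<in> carrier_mat d d \<Longrightarrow> T X = T' X" "\<And>X. X \<in> carrier_mat d' d' \<Longrightarrow> S X = S' X"
  shows "gtensor d e d' e' T S = gtensor d e d' e' T' S'"
  by (rule ext) (simp add: gtensor_def assms)

definition ktensor :: "nat \<Rightarrow> nat \<Rightarrow> ('i \<Rightarrow> nat \<Rightarrow> nat \<Rightarrow> complex) \<Rightarrow> ('j \<Rightarrow> nat \<Rightarrow> nat \<Rightarrow> complex)
    \<Rightarrow> 'i \<times> 'j \<Rightarrow> nat \<Rightarrow> nat \<Rightarrow> complex" where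
  "ktensor d' e' K L = (\<lambda>(a, b) r x. K a (r div e') (x div d') * L b (r mod e') (x mod d'))"

lemma gtensor_kraus:
  "gtensor d e d' e' (kraus d e I K) (kraus d' e' J L) X
     = kraus (d * d') (e * e') (I \<times> J) (ktensor d' e' K L) X" (is "?l = ?r")
proof (rule eq_matI)
  fix r c assume "r < dim_row ?r" "c < dim_col ?r"
  then have rc: "r < e * e'" "c < e * e'" by (auto simp: kraus_def)
  note rc' = div_less_mult[OF rc(1)] div_less_mult[OF rc(2)]
    mod_less_mult[OF rc(1)] mod_less_mult[OF rc(2)]
  have "?l $$ (r, c) = (\<Sum>i<d. \<Sum>j<d. \<Sum>k<d'. \<Sum>l<d'. \<Sum>b\<in>J. \<Sum>a\<in>I. X $$ (i * d' + k, j * d' + l) *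
        (K a (r div e') i * cnj (K a (c div e') j)) * (L b (r mod e') k * cnj (L b (c mod e') l)))"
    using rc by (simp add: gtensor_def kraus_unit rc' sum_distrib_left sum_distrib_right)
  also have "\<dots> = (\<Sum>a\<in>I. \<Sum>b\<in>J. \<Sum>i<d. \<Sum>k<d'. \<Sum>j<d. \<Sum>l<d'. X $$ (i * d' + k, j * d' + l) *
        (K a (r div e') i * cnj (K a (c div e') j)) * (L b (r mod e') k * cnj (L b (c mod e') l)))"
    unfolding sum.cartesian_product
    by (rule sum.reindex_bij_witness[of _
          "\<lambda>(a, b, i, k, j, l). (i, j, k, l, b, a)" "\<lambda>(i, j, k, l, b, a). (a, b, i, k, j, l)"]) auto
  also have "\<dots> = ?r $$ (r, c)"
    using rc by (simp add: kraus_def ktensor_def sum_lessThan_mult div_mod_split mult_ac[where 'a = complex]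
        sum.cartesian_product')
  finally show "?l $$ (r, c) = ?r $$ (r, c)" .
qed (auto simp: gtensor_def kraus_def)

lemma kraus_tp_tensor:
  assumes K: "kraus_tp d e I K" and L: "kraus_tp d' e' J L"
  shows "kraus_tp (d * d') (e * e') (I \<times> J) (ktensor d' e' K L)"
  unfolding kraus_tp_def
proof (intro allI impI)
  fix x y assume xy: "x < d * d'" "y < d * d'"
  note xy' = div_less_mult[OF xy(1)] div_less_mult[OF xy(2)]
    mod_less_mult[OF xy(1)] mod_less_mult[OF xy(2)]
  have "(\<Sum>a\<in>I \<times> J. \<Sum>r<e * e'. ktensor d' e' K L a r x *
      cnj (ktensor d' e' K L a r y))
    = (\<Sum>a\<in>I. \<Sum>b\<in>J. \<Sum>i<e. \<Sum>k<e'. (K a i (x div d') * cnj (K a i (y div d'))) *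
         (L b k (x mod d') * cnj (L b k (y mod d'))))"
    by (simp add: ktensor_def sum_lessThan_mult div_mod_split mult_ac[where 'a = complex] sum.cartesian_product')
  also have "\<dots> = (\<Sum>a\<in>I. \<Sum>i<e. K a i (x div d') * cnj (K a i (y div d'))) *
      (\<Sum>b\<in>J. \<Sum>k<e'. L b k (x mod d') * cnj (L b k (y mod d')))"
    unfolding sum_product by simp
  also have "\<dots> = (if x = y then 1 else 0)"
    using K L xy' by (auto simp: kraus_tp_def) (metis div_mult_mod_eq)+
  finally show "(\<Sum>a\<in>I \<times> J. \<Sum>r<e * e'. ktensor d' e' K L a r x *
      cnj (ktensor d' e' K L a r y))
     = (if x = y then 1 else 0)" .
qed

text \<open>Kronecker products of Kraus operators are Kraus operators of the tensor product, which
  settles complete positivity.\<close>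

lemma channel_gtensor:
  assumes T: "channel d e T" and S: "channel d' e' S"
  shows "channel (d * d') (e * e') (gtensor d e d' e' T S)"
proof -
  obtain K L and m m' :: nat where K: "kraus_tp d e {..<m} K" "\<forall>X\<in>carrier_mat d d. T X = kraus d e {..<m} K X"
    and L: "kraus_tp d' e' {..<m'} L" "\<forall>X\<in>carrier_mat d' d'. S X = kraus d' e' {..<m'} L X"
    using kraus_decomposition[OF T] kraus_decomposition[OF S] by blast
  have "gtensor d e d' e' T S = gtensor d e d' e' (kraus d e {..<m} K) (kraus d' e' {..<m'} L)"
    by (rule gtensor_cong) (use K L in auto)
  then show ?thesis
    using channel_cong[OF channel_kraus[OF kraus_tp_tensor[OF K(1) L(1)]]] gtensor_kraus by metis
qed

lemma gtensor_unit:
  assumes "x < d * d'" "y < d * d'" "r < e * e'" "c < e * e'"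
  shows "gtensor d e d' e' T S (unit_mat (d * d') x y) $$ (r, c)
    = T (unit_mat d (x div d') (y div d')) $$ (r div e', c div e')
      * S (unit_mat d' (x mod d') (y mod d')) $$ (r mod e', c mod e')"
proof -
  note xy = div_less_mult[OF assms(1)] div_less_mult[OF assms(2)]
    mod_less_mult[OF assms(1)] mod_less_mult[OF assms(2)]
  have eq: "i * d' + k = x \<longleftrightarrow> i = x div d' \<and> k = x mod d'" if "k < d'" for i k x
    using that by (auto simp: div_mod_split)
  have "gtensor d e d' e' T S (unit_mat (d * d') x y) $$ (r, c)
    = (\<Sum>i<d. \<Sum>j<d. \<Sum>k<d'. \<Sum>l<d'. unit_mat (d * d') x y $$ (i * d' + k, j * d' + l) *
        T (unit_mat d i j) $$ (r div e', c div e') * S (unit_mat d' k l) $$ (r mod e', c mod e'))"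
    using assms by (simp add: gtensor_def)
  also have "\<dots> = (\<Sum>i<d. \<Sum>j<d. \<Sum>k<d'. \<Sum>l<d'. if l = y mod d' then if k = x mod d' then
      if j = y div d' then if i = x div d' then
      T (unit_mat d i j) $$ (r div e', c div e') * S (unit_mat d' k l) $$ (r mod e', c mod e')
      else 0 else 0 else 0 else 0)"
    by (intro sum.cong refl) (simp add: unit_mat_def[of "d * d'"] mult_add_less eq)
  finally show ?thesis using xy by simp
qed

lemma gtensor_comp:
  assumes T: "channel d e T" "channel e f T'" and S: "channel d' e' S" "channel e' f' S'"
    and X: "X \<in> carrier_mat (d * d') (d * d')"
  shows "gtensor d f d' f' (T' \<circ> T) (S' \<circ> S) X = gtensor e f e' f' T' S' (gtensor d e d' e' T S X)"
proof -
  let ?gg = "gtensor e f e' f' T' S' \<circ> gtensor d e d' e' T S" and ?gc = "gtensor d f d' f' (T' \<circ> T) (S' \<circ> S)"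
  have "?gc X = ?gg X"
  proof (rule lin_map_eqI[OF _ _ X])
    show "lin_map (d * d') (f * f') ?gc"
      by (intro channel_lin channel_gtensor channel_comp[OF T] channel_comp[OF S])
    have g: "channel (d * d') (e * e') (gtensor d e d' e' T S)" "channel (e * e') (f * f') (gtensor e f e' f' T' S')"
      by (intro channel_gtensor T S)+
    then show "lin_map (d * d') (f * f') ?gg"
      by (intro channel_lin channel_comp)
    fix x y r c assume *: "x < d * d'" "y < d * d'" "r < f * f'" "c < f * f'"
    let ?A = "\<lambda>s t. T (unit_mat d (x div d') (y div d')) $$ (s, t) * T' (unit_mat e s t) $$ (r div f', c div f')"
    let ?B = "\<lambda>s' t'. S (unit_mat d' (x mod d') (y mod d')) $$ (s', t') * S' (unit_mat e' s' t') $$ (r mod f', c mod f')"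
    note b = *[THEN div_less_mult] *[THEN mod_less_mult]
    have "?gg (unit_mat (d * d') x y) $$ (r, c)
      = (\<Sum>s<e. \<Sum>s'<e'. \<Sum>t<e. \<Sum>t'<e'.
          (?A s t) *
          (?B s' t'))"
      unfolding comp_def comp_entries[OF g[THEN channel_lin] *] sum_lessThan_mult
      by (intro sum.cong refl) (simp add: gtensor_unit * mult_add_less div_mod_split)
    also have "\<dots> = (\<Sum>s<e. \<Sum>t<e. ?A s t)
        * (\<Sum>s'<e'. \<Sum>t'<e'. ?B s' t')"
      unfolding sum_product by simp
    also have "\<dots> = ?gc (unit_mat (d * d') x y) $$ (r, c)"
      unfolding gtensor_unit[OF *] comp_def
        comp_entries[OF T[THEN channel_lin] b(1-4)] comp_entries[OF S[THEN channel_lin] b(5-8)] ..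
    finally show "?gc (unit_mat (d * d') x y) $$ (r, c)
      = ?gg (unit_mat (d * d') x y) $$ (r, c)" ..
  qed
  then show ?thesis by simp
qed

lemma unit_mat_entry: "i < d \<Longrightarrow> j < d \<Longrightarrow> unit_mat d k l $$ (i, j) = (if i = k \<and> j = l then 1 else 0)"
  by (simp add: unit_mat_def)

lemma gtensor_id:
  assumes "X \<in> carrier_mat (d * d') (d * d')"
  shows "gtensor d d d' d' id id X = X"
proof -
  have "gtensor d d d' d' id id X = id X"
  proof (rule lin_map_eqI[OF _ _ assms])
    show "lin_map (d * d') (d * d') (gtensor d d d' d' id id)"
      by (intro channel_lin channel_gtensor channel_id)
    show "lin_map (d * d') (d * d') id" by (intro channel_lin channel_id)
    fix x y r c assume *: "x < d * d'" "y < d * d'" "r < d * d'" "c < d * d'"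
    note b = *[THEN div_less_mult] *[THEN mod_less_mult]
    have "r = x \<longleftrightarrow> r div d' = x div d' \<and> r mod d' = x mod d'"
      "c = y \<longleftrightarrow> c div d' = y div d' \<and> c mod d' = y mod d'"
      by (metis div_mult_mod_eq)+
    then show "gtensor d d d' d' id id (unit_mat (d * d') x y) $$ (r, c) = id (unit_mat (d * d') x y) $$ (r, c)"
      unfolding gtensor_unit[OF *] id_apply unit_mat_entry[OF b(3,4)] unit_mat_entry[OF b(7,8)]
        unit_mat_entry[OF *(3,4)] by auto
  qed
  then show ?thesis by simp
qed

lemma gtensor_funpow:
  assumes "channel d d T" "channel d' d' S" "X \<in> carrier_mat (d * d') (d * d')"
  shows "(gtensor d d d' d' T S ^^ t) X = gtensor d d d' d' (T ^^ t) (S ^^ t) X"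
proof (induction t)
  case 0
  then show ?case using gtensor_id[OF assms(3)] by (simp add: id_def)
next
  case (Suc t)
  then show ?case
    using gtensor_comp[OF channel_funpow[OF assms(1)] assms(1) channel_funpow[OF assms(2)] assms(2,3), of t t]
    by (simp add: comp_def)
qed

section \<open>Bounds on codes\<close>

text \<open>The encoder's weights for message i sum to 1, so by Cauchy-Schwarz the success
  probability of i is at most the trace of the decoder's effect for outcome i. These effects add up
  to the identity of size r.\<close>

lemma classical_success_bound:
  assumes E: "channel D r E" and R: "channel r D R"
  shows "(\<Sum>i<D. Re (R (E (unit_mat D i i)) $$ (i, i))) \<le> real r"
proof -
  obtain L and m :: nat where L: "kraus_tp D r {..<m} L" "\<forall>X\<in>carrier_mat D D. E X = kraus D r {..<m} L X"
    using kraus_decomposition[OF E] by blast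
  obtain K and n :: nat where K: "kraus_tp r D {..<n} K" "\<forall>X\<in>carrier_mat r r. R X = kraus r D {..<n} K X"
    using kraus_decomposition[OF R] by blast
  have bound: "Re (R (E (unit_mat D i i)) $$ (i, i)) \<le> (\<Sum>a<n. \<Sum>s<r. (cmod (K a i s))\<^sup>2)" if i: "i < D" for i
  proof -
    define z where "z a b = (\<Sum>s<r. K a i s * L b s i)" for a b
    have "R (E (unit_mat D i i)) $$ (i, i)
        = (\<Sum>s<r. \<Sum>t<r. E (unit_mat D i i) $$ (s, t) * R (unit_mat r s t) $$ (i, i))"
      by (rule comp_entries[OF channel_lin[OF E] channel_lin[OF R] i i i i])
    also have "\<dots> = (\<Sum>s<r. \<Sum>t<r. \<Sum>a<n. \<Sum>b<m. (K a i s * L b s i) * cnj (K a i t * L b t i))"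
      using i K(2) L(2) by (intro sum.cong refl) (simp add: kraus_unit sum_product sum.swap[of _ "{..<m}"] mult_ac)
    also have "\<dots> = (\<Sum>a<n. \<Sum>b<m. \<Sum>s<r. \<Sum>t<r. (K a i s * L b s i) * cnj (K a i t * L b t i))"
      unfolding sum.cartesian_product
      by (rule sum.reindex_bij_witness[of _ "\<lambda>(a, b, s, t). (s, t, a, b)" "\<lambda>(s, t, a, b). (a, b, s, t)"]) auto
    also have "\<dots> = (\<Sum>a<n. \<Sum>b<m. z a b * cnj (z a b))"
      by (simp add: z_def sum_product cnj_sum)
    also have "\<dots> = of_real (\<Sum>a<n. \<Sum>b<m. (cmod (z a b))\<^sup>2)"
      unfolding of_real_sum complex_norm_square ..
    finally have "Re (R (E (unit_mat D i i)) $$ (i, i)) = (\<Sum>a<n. \<Sum>b<m. (cmod (z a b))\<^sup>2)"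
      by simp
    also have "\<dots> \<le> (\<Sum>a<n. \<Sum>b<m. (\<Sum>s<r. (cmod (K a i s))\<^sup>2) * (\<Sum>s<r. (cmod (L b s i))\<^sup>2))"
      unfolding z_def by (intro sum_mono complex_Cauchy_Schwarz_sum)
    also have "\<dots> = (\<Sum>a<n. \<Sum>s<r. (cmod (K a i s))\<^sup>2) * (\<Sum>b<m. \<Sum>s<r. (cmod (L b s i))\<^sup>2)"
      by (rule sum_product[symmetric])
    finally show ?thesis using kraus_tp_norm[OF L(1) i] by simp
  qed
  have "(\<Sum>i<D. Re (R (E (unit_mat D i i)) $$ (i, i))) \<le> (\<Sum>i<D. \<Sum>a<n. \<Sum>s<r. (cmod (K a i s))\<^sup>2)"
    by (intro sum_mono bound) simp
  also have "\<dots> = (\<Sum>s<r. \<Sum>a<n. \<Sum>i<D. (cmod (K a i s))\<^sup>2)"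
    unfolding sum.cartesian_product
    by (rule sum.reindex_bij_witness[of _ "\<lambda>(s, a, i). (i, a, s)" "\<lambda>(i, a, s). (s, a, i)"]) auto
  also have "\<dots> = real r" by (simp add: kraus_tp_norm[OF K(1)])
  finally show ?thesis .
qed

abbreviation label_class :: "nat \<Rightarrow> (nat \<Rightarrow> nat) \<Rightarrow> nat \<Rightarrow> nat set" where
  "label_class r \<rho> s \<equiv> {t. t < r \<and> \<rho> t = \<rho> s}"

text \<open>Each product is bounded by half the sum of the two squares, and each index meets at most
  \<open>M\<close> indices of its class. This is where block size, not total dimension, enters the
  quantum bound.\<close>

lemma block_square_bound:
  fixes g :: "nat \<Rightarrow> complex" and \<rho> :: "nat \<Rightarrow> nat"
  assumes M: "\<And>s. s < r \<Longrightarrow> card (label_class r \<rho> s) \<le> M"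
  shows "Re (\<Sum>s<r. \<Sum>t<r. if \<rho> s = \<rho> t then g s * cnj (g t) else 0) \<le> real M * (\<Sum>s<r. (cmod (g s))\<^sup>2)"
proof -
  define q where "q s = (cmod (g s))\<^sup>2" for s
  have half: "(\<Sum>s<r. \<Sum>t<r. if \<rho> s = \<rho> t then q s / 2 else 0) \<le> real M * (\<Sum>s<r. q s) / 2"
  proof -
    have "(\<Sum>t<r. if \<rho> s = \<rho> t then q s / 2 else 0) \<le> real M * q s / 2" if "s < r" for s
    proof -
      have "(\<Sum>t<r. if \<rho> s = \<rho> t then q s / 2 else 0) = real (card (label_class r \<rho> s)) * (q s / 2)"
        by (simp add: sum.If_cases Int_def eq_commute)
      also have "\<dots> \<le> real M * (q s / 2)"
        using M[OF that] by (intro mult_right_mono) (auto simp: q_def)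
      finally show ?thesis by simp
    qed
    then have "(\<Sum>s<r. \<Sum>t<r. if \<rho> s = \<rho> t then q s / 2 else 0) \<le> (\<Sum>s<r. real M * q s / 2)"
      by (intro sum_mono) simp
    then show ?thesis by (simp add: sum_distrib_left sum_divide_distrib)
  qed
  have swap: "(\<Sum>s<r. \<Sum>t<r. if \<rho> s = \<rho> t then q t / 2 else 0) = (\<Sum>s<r. \<Sum>t<r. if \<rho> s = \<rho> t then q s / 2 else 0)"
    by (subst sum.swap) (simp add: eq_commute)
  have "Re (\<Sum>s<r. \<Sum>t<r. if \<rho> s = \<rho> t then g s * cnj (g t) else 0)
      = (\<Sum>s<r. \<Sum>t<r. if \<rho> s = \<rho> t then Re (g s * cnj (g t)) else 0)"
    by (auto intro!: sum.cong)
  also have "\<dots> \<le> (\<Sum>s<r. \<Sum>t<r. (if \<rho> s = \<rho> t then q s / 2 else 0) + (if \<rho> s = \<rho> t then q t / 2 else 0))"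
  proof (intro sum_mono)
    fix s t
    have "Re (g s * cnj (g t)) \<le> cmod (g s) * cmod (g t)"
      using complex_Re_le_cmod[of "g s * cnj (g t)"] by (simp add: norm_mult)
    also have "\<dots> \<le> q s / 2 + q t / 2"
      using zero_le_power2[of "cmod (g s) - cmod (g t)"] by (simp add: q_def power2_diff)
    finally show "(if \<rho> s = \<rho> t then Re (g s * cnj (g t)) else 0)
       \<le> (if \<rho> s = \<rho> t then q s / 2 else 0) + (if \<rho> s = \<rho> t then q t / 2 else 0)" by simp
  qed
  also have "\<dots> \<le> real M * (\<Sum>s<r. q s)" using half swap by (simp add: sum.distrib)
  finally show ?thesis by (simp add: q_def)
qed

lemma sum_rotate3:
  "(\<Sum>a\<in>A. \<Sum>b\<in>B. \<Sum>s\<in>C. f a b s) = (\<Sum>s\<in>C. \<Sum>a\<in>A. \<Sum>b\<in>B. f a b s)"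
proof -
  have "(\<Sum>a\<in>A. \<Sum>b\<in>B. \<Sum>s\<in>C. f a b s) = (\<Sum>a\<in>A. \<Sum>s\<in>C. \<Sum>b\<in>B. f a b s)"
    by (rule sum.cong[OF refl], rule sum.swap)
  also have "\<dots> = (\<Sum>s\<in>C. \<Sum>a\<in>A. \<Sum>b\<in>B. f a b s)" by (rule sum.swap)
  finally show ?thesis .
qed

text \<open>The sum is a sum of squared traces of products of encoder and decoder Kraus operators.
  Since \<open>E\<close> has no entries between blocks, only index pairs with equal labels remain,
  which costs the factor \<open>M\<close>; after Cauchy-Schwarz the decoder contributes 1 for each s
  and the encoder D in total.\<close>

lemma quantum_fidelity_bound:
  fixes \<rho> :: "nat \<Rightarrow> nat"
  assumes E: "channel D r E" and R: "channel r D R"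
    and blocks: "\<And>X s t. X \<in> carrier_mat D D \<Longrightarrow> s < r \<Longrightarrow> t < r \<Longrightarrow> \<rho> s \<noteq> \<rho> t \<Longrightarrow> E X $$ (s, t) = 0"
    and M: "\<And>s. s < r \<Longrightarrow> card (label_class r \<rho> s) \<le> M"
  shows "(\<Sum>k<D. \<Sum>l<D. Re (R (E (unit_mat D k l)) $$ (k, l))) \<le> real M * real D"
proof -
  obtain L and m :: nat where L: "kraus_tp D r {..<m} L" "\<forall>X\<in>carrier_mat D D. E X = kraus D r {..<m} L X"
    using kraus_decomposition[OF E] by blast
  obtain K and n :: nat where K: "kraus_tp r D {..<n} K" "\<forall>X\<in>carrier_mat r r. R X = kraus r D {..<n} K X"
    using kraus_decomposition[OF R] by blast
  let ?h = "\<lambda>k l s t a b. if \<rho> s = \<rho> t then (K a k s * L b s k) * cnj (K a l t * L b t l) else 0"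
  \<comment> \<open>The s-th diagonal entry of the matrix product of \<open>L b\<close> and
    \<open>K a\<close>.\<close>
  define g where "g a b s = (\<Sum>k<D. K a k s * L b s k)" for a b s
  have ent: "R (E (unit_mat D k l)) $$ (k, l) = (\<Sum>s<r. \<Sum>t<r. \<Sum>a<n. \<Sum>b<m. ?h k l s t a b)" if kl: "k < D" "l < D" for k l
  proof -
    have "R (E (unit_mat D k l)) $$ (k, l)
        = (\<Sum>s<r. \<Sum>t<r. E (unit_mat D k l) $$ (s, t) * R (unit_mat r s t) $$ (k, l))"
      by (rule comp_entries[OF channel_lin[OF E] channel_lin[OF R] kl kl])
    also have "\<dots> = (\<Sum>s<r. \<Sum>t<r. \<Sum>a<n. \<Sum>b<m. ?h k l s t a b)"
    proof (rule sum.cong[OF refl], rule sum.cong[OF refl])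
      fix s t assume st: "s \<in> {..<r}" "t \<in> {..<r}"
      show "E (unit_mat D k l) $$ (s, t) * R (unit_mat r s t) $$ (k, l) = (\<Sum>a<n. \<Sum>b<m. ?h k l s t a b)"
      proof (cases "\<rho> s = \<rho> t")
        case True
        then show ?thesis using kl st K(2) L(2)
          by (simp add: kraus_unit sum_product sum.swap[of _ "{..<m}"] mult_ac)
      qed (use st blocks in simp)
    qed
    finally show ?thesis .
  qed
  have "(\<Sum>k<D. \<Sum>l<D. R (E (unit_mat D k l)) $$ (k, l))
      = (\<Sum>k<D. \<Sum>l<D. \<Sum>s<r. \<Sum>t<r. \<Sum>a<n. \<Sum>b<m. ?h k l s t a b)"
    by (simp add: ent)
  also have "\<dots> = (\<Sum>a<n. \<Sum>b<m. \<Sum>s<r. \<Sum>t<r. \<Sum>k<D. \<Sum>l<D. ?h k l s t a b)"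
    unfolding sum.cartesian_product
    by (rule sum.reindex_bij_witness[of _ "\<lambda>(a, b, s, t, k, l). (k, l, s, t, a, b)" "\<lambda>(k, l, s, t, a, b). (a, b, s, t, k, l)"]) auto
  also have "\<dots> = (\<Sum>a<n. \<Sum>b<m. \<Sum>s<r. \<Sum>t<r. if \<rho> s = \<rho> t then g a b s * cnj (g a b t) else 0)"
    by (rule sum.cong[OF refl])+ (simp add: g_def sum_product cnj_sum)
  finally have "(\<Sum>k<D. \<Sum>l<D. Re (R (E (unit_mat D k l)) $$ (k, l)))
      = (\<Sum>a<n. \<Sum>b<m. Re (\<Sum>s<r. \<Sum>t<r. if \<rho> s = \<rho> t then g a b s * cnj (g a b t) else 0))"
    by (metis (mono_tags, lifting) Re_sum sum.cong)
  also have "\<dots> \<le> (\<Sum>a<n. \<Sum>b<m. real M * (\<Sum>s<r. (cmod (g a b s))\<^sup>2))"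
    by (intro sum_mono block_square_bound M)
  also have "\<dots> \<le> (\<Sum>a<n. \<Sum>b<m. real M * (\<Sum>s<r. (\<Sum>k<D. (cmod (K a k s))\<^sup>2) * (\<Sum>k<D. (cmod (L b s k))\<^sup>2)))"
    unfolding g_def by (intro sum_mono mult_left_mono complex_Cauchy_Schwarz_sum) auto
  also have "\<dots> = real M * (\<Sum>s<r. \<Sum>a<n. \<Sum>b<m. (\<Sum>k<D. (cmod (K a k s))\<^sup>2) * (\<Sum>k<D. (cmod (L b s k))\<^sup>2))"
    unfolding sum_distrib_left[symmetric] sum_rotate3 ..
  also have "\<dots> = real M * (\<Sum>s<r. \<Sum>b<m. \<Sum>k<D. (cmod (L b s k))\<^sup>2)"
    by (simp add: sum_product[symmetric] kraus_tp_norm[OF K(1)])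
  also have "(\<Sum>s<r. \<Sum>b<m. \<Sum>k<D. (cmod (L b s k))\<^sup>2) = (\<Sum>k<D. \<Sum>b<m. \<Sum>s<r. (cmod (L b s k))\<^sup>2)"
    unfolding sum.cartesian_product
    by (rule sum.reindex_bij_witness[of _ "\<lambda>(k, b, s). (s, b, k)" "\<lambda>(s, b, k). (k, b, s)"]) auto
  also have "\<dots> = real D" by (simp add: kraus_tp_norm[OF L(1)])
  finally show ?thesis .
qed

text \<open>One factor 1 / D comes from the blocks of the projector, the other from the two outer
  vectors.\<close>

lemma entanglement_fidelity_eq:
  assumes N: "lin_map D D N" and D: "D \<ge> 1"
  shows "conjugate (phi_plus D) \<bullet> (id_tensor D D D N (proj_vec (phi_plus D)) *\<^sub>v phi_plus D)
    = (\<Sum>k<D. \<Sum>l<D. N (unit_mat D k l) $$ (k, l)) / (of_nat D)\<^sup>2"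
proof -
  let ?X = "id_tensor D D D N (proj_vec (phi_plus D))"
  define q :: complex where "q = of_real (1 / sqrt (real D))"
  have qq: "cnj q * q = 1 / of_nat D" "q * cnj q = 1 / of_nat D"
    using D by (auto simp: q_def simp flip: of_real_mult)
  have phi: "phi_plus D $ (k * D + i) = (if i = k then q else 0)" if "k < D" "i < D" for k i
    using that by (simp add: phi_plus_def mult_add_less div_mod_split q_def)
  have b: "blk D (proj_vec (phi_plus D)) k l = (1 / of_nat D) \<cdot>\<^sub>m unit_mat D k l" if "k < D" "l < D" for k l
  proof (rule eq_matI)
    fix i j assume "i < dim_row ((1 / of_nat D) \<cdot>\<^sub>m unit_mat D k l)" "j < dim_col ((1 / of_nat D) \<cdot>\<^sub>m unit_mat D k l)"
    then have ij: "i < D" "j < D" by (auto simp: unit_mat_def)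
    have "blk D (proj_vec (phi_plus D)) k l $$ (i, j) = phi_plus D $ (k * D + i) * cnj (phi_plus D $ (l * D + j))"
      using that ij mult_add_less[of k D i D] mult_add_less[of l D j D]
      by (simp add: blk_def proj_vec_def phi_plus_def)
    then show "blk D (proj_vec (phi_plus D)) k l $$ (i, j) = ((1 / of_nat D) \<cdot>\<^sub>m unit_mat D k l) $$ (i, j)"
      using that ij by (auto simp: phi qq unit_mat_def)
  qed (auto simp: blk_def unit_mat_def)
  have ent: "?X $$ (k * D + i, l * D + j)
      = N (unit_mat D k l) $$ (i, j) / of_nat D" if "k < D" "l < D" "i < D" "j < D" for k l i j
  proof -
    have "N ((1 / of_nat D) \<cdot>\<^sub>m unit_mat D k l) = (1 / of_nat D) \<cdot>\<^sub>m N (unit_mat D k l)"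
      "N (unit_mat D k l) \<in> carrier_mat D D"
      using N by (simp_all add: lin_map_def)
    then show ?thesis using that by (simp add: id_tensor_def mult_add_less div_mod_split b)
  qed
  have "conjugate (phi_plus D) \<bullet> (?X *\<^sub>v phi_plus D)
      = qform (D * D) (\<lambda>i j. ?X $$ (i, j)) (\<lambda>i. phi_plus D $ i)"
    by (rule quadratic_form_eq_qform) (auto simp: id_tensor_def phi_plus_def)
  also have "\<dots> = (\<Sum>k<D. \<Sum>i<D. \<Sum>l<D. \<Sum>j<D. if j = l then if i = k then
      N (unit_mat D k l) $$ (i, j) / (of_nat D)\<^sup>2 else 0 else 0)"
    unfolding qform_def sum_lessThan_mult
  proof (intro sum.cong refl)
    fix k i l j assume *: "k \<in> {..<D}" "i \<in> {..<D}" "l \<in> {..<D}" "j \<in> {..<D}"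
    have "cnj q * (N (unit_mat D k l) $$ (i, j) / of_nat D) * q = N (unit_mat D k l) $$ (i, j) / of_nat D * (cnj q * q)"
      by simp
    then show "cnj (phi_plus D $ (k * D + i)) * ?X $$ (k * D + i, l * D + j) *
          phi_plus D $ (l * D + j) = (if j = l then if i = k then
      N (unit_mat D k l) $$ (i, j) / (of_nat D)\<^sup>2 else 0 else 0)"
      using * by (auto simp: phi ent qq power2_eq_square)
  qed
  also have "\<dots> = (\<Sum>k<D. \<Sum>i<D. if i = k then \<Sum>l<D. N (unit_mat D k l) $$ (i, l) / (of_nat D)\<^sup>2 else 0)"
    by (intro sum.cong[OF refl]) simp
  also have "\<dots> = (\<Sum>k<D. \<Sum>l<D. N (unit_mat D k l) $$ (k, l)) / (of_nat D)\<^sup>2"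
    by (simp add: sum_divide_distrib)
  finally show ?thesis .
qed

lemma classical_code_0_iff:
  "classical_code d T D 0 \<longleftrightarrow> D \<ge> 1 \<and> (\<exists>E R. channel D d E \<and> channel d D R \<and>
     (\<Sum>i<D. Re (R (T (E (unit_mat D i i))) $$ (i, i))) \<ge> real D)"
  unfolding classical_code_def
  by (intro conj_cong refl ex_cong1) (auto simp: field_simps)

lemma quantum_code_0_iff:
  assumes T: "channel d d T"
  shows "quantum_code d T D 0 \<longleftrightarrow> D \<ge> 1 \<and> (\<exists>E R. channel D d E \<and> channel d D R \<and>
     (\<Sum>k<D. \<Sum>l<D. Re (R (T (E (unit_mat D k l))) $$ (k, l))) \<ge> (real D)\<^sup>2)"
proof -
  have "Re (conjugate (phi_plus D) \<bullet> (id_tensor D D D (R \<circ> T \<circ> E) (proj_vec (phi_plus D)) *\<^sub>v phi_plus D)) \<ge> 1 - 0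
    \<longleftrightarrow> (\<Sum>k<D. \<Sum>l<D. Re (R (T (E (unit_mat D k l))) $$ (k, l))) \<ge> (real D)\<^sup>2"
    if "D \<ge> 1" "channel D d E" "channel d D R" for E R
  proof -
    have "lin_map D D (R \<circ> T \<circ> E)"
      using that T by (intro channel_lin channel_comp[of D d] channel_comp[of d d])
    from entanglement_fidelity_eq[OF this that(1)]
    have "Re (conjugate (phi_plus D) \<bullet> (id_tensor D D D (R \<circ> T \<circ> E) (proj_vec (phi_plus D)) *\<^sub>v phi_plus D))
       = (\<Sum>k<D. \<Sum>l<D. Re (R (T (E (unit_mat D k l))) $$ (k, l))) / (real D)\<^sup>2"
      by (simp flip: of_nat_power)
    then show ?thesis using that(1) by (simp add: le_divide_eq)
  qed
  then show ?thesis unfolding quantum_code_def by blast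
qed

text \<open>d^4 counts the terms of the expansion in matrix units; the entries of \<open>E\<close>
  and \<open>R\<close> are at most 1 in modulus. The bound is the same for all codes and all sizes
  D.\<close>

lemma channel_perturbation:
  assumes E: "channel D d E" and R: "channel d D R" and T: "lin_map d d T" "lin_map d d P"
    and close: "\<And>p q u v. p < d \<Longrightarrow> q < d \<Longrightarrow> u < d \<Longrightarrow> v < d \<Longrightarrow>
      cmod (T (unit_mat d p q) $$ (u, v) - P (unit_mat d p q) $$ (u, v)) \<le> \<epsilon>"
    and k: "k < D" "l < D"
  shows "Re (R (T (E (unit_mat D k l))) $$ (k, l)) \<le> Re (R (P (E (unit_mat D k l))) $$ (k, l)) + real d ^ 4 * \<epsilon>"
proof -
  let ?\<Delta> = "\<lambda>p q u v. T (unit_mat d p q) $$ (u, v) - P (unit_mat d p q) $$ (u, v)"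
  define X where "X = E (unit_mat D k l)"
  have X: "X \<in> carrier_mat d d" unfolding X_def by (rule channel_carrier[OF E]) simp
  have exp: "R (T X) $$ (k, l) = (\<Sum>u<d. \<Sum>v<d. \<Sum>p<d. \<Sum>q<d. X $$ (p, q) * T (unit_mat d p q) $$ (u, v) * R (unit_mat d u v) $$ (k, l))"
    if T: "lin_map d d T" for T
  proof -
    have "T X \<in> carrier_mat d d" using T X by (auto simp: lin_map_def)
    then have "R (T X) $$ (k, l) = (\<Sum>u<d. \<Sum>v<d. T X $$ (u, v) * R (unit_mat d u v) $$ (k, l))"
      by (rule lin_map_entries[OF channel_lin[OF R] _ k])
    also have "\<dots> = (\<Sum>u<d. \<Sum>v<d. \<Sum>p<d. \<Sum>q<d. X $$ (p, q) * T (unit_mat d p q) $$ (u, v) * R (unit_mat d u v) $$ (k, l))"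
      by (rule sum.cong[OF refl])+ (simp add: lin_map_entries[OF T X] sum_distrib_right)
    finally show ?thesis .
  qed
  have diff: "R (T X) $$ (k, l) - R (P X) $$ (k, l) = (\<Sum>u<d. \<Sum>v<d. \<Sum>p<d. \<Sum>q<d.
      X $$ (p, q) * ?\<Delta> p q u v * R (unit_mat d u v) $$ (k, l))"
    unfolding exp[OF T(1)] exp[OF T(2)] by (simp add: algebra_simps sum_subtractf)
  have "cmod (R (T X) $$ (k, l) - R (P X) $$ (k, l)) \<le> (\<Sum>u<d. \<Sum>v<d. \<Sum>p<d. \<Sum>q<d. \<epsilon>)"
    unfolding diff
  proof (intro sum_norm_le)
    fix u v p q assume *: "u \<in> {..<d}" "v \<in> {..<d}" "p \<in> {..<d}" "q \<in> {..<d}"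
    have "cmod (X $$ (p, q)) \<le> 1" unfolding X_def using channel_entry_bound[OF E k] * by simp
    moreover have "cmod (R (unit_mat d u v) $$ (k, l)) \<le> 1" using channel_entry_bound[OF R _ _ k] * by simp
    moreover have "cmod (?\<Delta> p q u v) \<le> \<epsilon>"
      using close * by simp
    ultimately have "cmod (X $$ (p, q)) * cmod (?\<Delta> p q u v)
        * cmod (R (unit_mat d u v) $$ (k, l)) \<le> 1 * \<epsilon> * 1"
      by (intro mult_mono) (auto intro: order_trans[OF norm_ge_zero])
    then show "cmod (X $$ (p, q) * ?\<Delta> p q u v * R (unit_mat d u v) $$ (k, l)) \<le> \<epsilon>"
      by (simp add: norm_mult)
  qed
  also have "\<dots> = real d ^ 4 * \<epsilon>" by (simp add: power4_eq_xxxx)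
  finally have "cmod (R (T X) $$ (k, l) - R (P X) $$ (k, l)) \<le> real d ^ 4 * \<epsilon>" .
  then show ?thesis
    using complex_Re_le_cmod[of "R (T X) $$ (k, l) - R (P X) $$ (k, l)"] by (simp add: X_def)
qed

section \<open>Factorization of idempotent channels\<close>

lift_definition trunc :: "nat \<Rightarrow> nat \<Rightarrow> (nat \<Rightarrow> nat \<Rightarrow> complex) \<Rightarrow> fmat" is
  "\<lambda>m n f i j. if i < m \<and> j < n then f i j else 0"
proof -
  fix m n :: nat and f :: "nat \<Rightarrow> nat \<Rightarrow> complex"
  have "supported (max m n) (\<lambda>i j. if i < m \<and> j < n then f i j else 0)"
    by (auto simp: supported_def)
  then show "\<exists>N. supported N (\<lambda>i j. if i < m \<and> j < n then f i j else 0)" by blast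
qed

lemma ent_trunc: "ent (trunc m n f) i j = (if i < m \<and> j < n then f i j else 0)"
  by (simp add: trunc.rep_eq)

lemma trunc_Mat: "trunc m n f \<in> Mat m n"
  by (simp add: Mat_def ent_trunc)

lemma ent_sandwich:
  assumes "A \<in> Mat m d" "Y \<in> Mat d d" "B \<in> Mat n d"
  shows "ent (A * Y * adj B) s t = (\<Sum>x<d. \<Sum>y<d. ent A s x * ent Y x y * cnj (ent B t y))"
proof -
  have "ent (A * Y * adj B) s t = (\<Sum>y<d. (\<Sum>x<d. ent A s x * ent Y x y) * cnj (ent B t y))"
    by (simp add: ent_mult_right[OF Mat_adj[OF assms(3)]] ent_mult_left[OF assms(1)])
  also have "\<dots> = (\<Sum>x<d. \<Sum>y<d. ent A s x * ent Y x y * cnj (ent B t y))"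
    by (subst sum.swap) (simp add: sum_distrib_right)
  finally show ?thesis .
qed

text \<open>The traces of the images of matrix units are exactly the sums in
  \<open>kraus_tp\<close>. For the maps \<open>F\<close> and \<open>J\<close> below they are easier
  to find than the sums themselves.\<close>

lemma kraus_tp_if_trace:
  assumes "\<And>k l. k < d \<Longrightarrow> l < d \<Longrightarrow> mtrace (kraus d e I K (unit_mat d k l)) = (if k = l then 1 else 0)"
  shows "kraus_tp d e I K"
  unfolding kraus_tp_def
proof (intro allI impI)
  fix k l assume kl: "k < d" "l < d"
  have "mtrace (kraus d e I K (unit_mat d k l)) = (\<Sum>i<e. kraus d e I K (unit_mat d k l) $$ (i, i))"
    by (simp add: mtrace_def kraus_def)
  also have "\<dots> = (\<Sum>i<e. \<Sum>a\<in>I. K a i k * cnj (K a i l))"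
    by (simp add: kraus_unit kl)
  also have "\<dots> = (\<Sum>a\<in>I. \<Sum>i<e. K a i k * cnj (K a i l))" by (rule sum.swap)
  finally show "(\<Sum>a\<in>I. \<Sum>i<e. K a i k * cnj (K a i l)) = (if k = l then 1 else 0)"
    using assms kl by simp
qed

text \<open>\<open>F\<close> records the block coordinates of \<open>P X\<close> and
  \<open>J\<close> rebuilds the fixed point from them, as in
  \<open>matrix_unit_decomposition\<close>. Both maps are defined by explicit Kraus operators, so
  that only trace preservation remains for them to be channels.\<close>

theorem idempotent_channel_factorization:
  assumes P: "channel d d P" and idem: "\<And>X. X \<in> carrier_mat d d \<Longrightarrow> P (P X) = P X"
  shows "\<exists>(r::nat) (\<rho>::nat \<Rightarrow> nat) F J. channel d r F \<and> channel r d J \<and>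
    (\<forall>X\<in>carrier_mat d d. P X = J (F X)) \<and>
    (\<forall>k<r. \<forall>l<r. \<rho> k = \<rho> l \<longrightarrow> F (J (unit_mat r k l)) = unit_mat r k l) \<and>
    (\<forall>X\<in>carrier_mat d d. \<forall>i<r. \<forall>j<r. \<rho> i \<noteq> \<rho> j \<longrightarrow> F X $$ (i, j) = 0)"
proof -
  obtain K0 and m :: nat where K0: "kraus_tp d d {..<m} K0"
    and PK: "\<forall>X\<in>carrier_mat d d. P X = kraus d d {..<m} K0 X"
    using kraus_decomposition[OF P] by blast
  define K where "K a = trunc d d (K0 a)" for a
  define P' where "P' X = (\<Sum>a<m. K a * X * adj (K a))" for X
  define fm where "fm X = trunc d d (\<lambda>i j. X $$ (i, j))" for X :: "complex mat"
  have KM: "K a \<in> Mat d d" for a by (simp add: K_def trunc_Mat)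
  have fmM: "fm X \<in> Mat d d" for X by (simp add: fm_def trunc_Mat)
  have Pfm: "P' (fm X) = fm (P X)" if X: "X \<in> carrier_mat d d" for X
  proof (rule fmat_eqI)
    fix i j
    have "P' (fm X) \<in> Mat d d"
      unfolding P'_def by (intro Mat_sum Mat_mult[of _ d d] Mat_adj KM fmM)
    moreover have "ent (P' (fm X)) i j
        = (\<Sum>a<m. \<Sum>x<d. \<Sum>y<d. ent (K a) i x * ent (fm X) x y * cnj (ent (K a) j y))"
      by (simp add: P'_def ent_sandwich[OF KM fmM KM])
    then have "ent (P' (fm X)) i j = P X $$ (i, j)" if "i < d" "j < d"
      using that X PK by (simp add: kraus_def K_def fm_def ent_trunc)
    ultimately show "ent (P' (fm X)) i j = ent (fm (P X)) i j"
      by (auto simp: fm_def ent_trunc Mat_def)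
  qed
  have fm_surj: "\<exists>X\<in>carrier_mat d d. Y = fm X" if "Y \<in> Mat d d" for Y
  proof
    show "Y = fm (mat d d (\<lambda>(i, j). ent Y i j))"
      using that by (intro fmat_eqI) (auto simp: fm_def ent_trunc Mat_def)
  qed simp
  interpret idempotent_channel "{..<m}" K d P'
  proof
    show "(\<Sum>a<m. adj (K a) * K a) = idm d"
    proof (rule fmat_eqI)
      fix i j
      have "(\<Sum>a<m. adj (K a) * K a) \<in> Mat d d" by (intro Mat_sum Mat_mult[of _ d d] Mat_adj KM)
      moreover have "ent (\<Sum>a<m. adj (K a) * K a) i j = (if i = j then 1 else 0)" if ij: "i < d" "j < d"
      proof -
        have "ent (\<Sum>a<m. adj (K a) * K a) i j = (\<Sum>a<m. \<Sum>s<d. ent (K a) s j * cnj (ent (K a) s i))"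
          by (simp add: ent_mult_right[OF KM] mult.commute)
        also have "\<dots> = (\<Sum>a<m. \<Sum>s<d. K0 a s j * cnj (K0 a s i))"
          using ij by (simp add: K_def ent_trunc)
        finally have "ent (\<Sum>a<m. adj (K a) * K a) i j = (\<Sum>a<m. \<Sum>s<d. K0 a s j * cnj (K0 a s i))" .
        then show ?thesis using K0 ij by (simp add: kraus_tp_def)
      qed
      ultimately show "ent (\<Sum>a<m. adj (K a) * K a) i j = ent (idm d) i j"
        by (cases "i < d \<and> j < d") (auto simp: ent_idm Mat_def simp del: ent_sum)
    qed
    show "P' (P' X) = P' X" if X: "X \<in> Mat d d" for X
    proof -
      obtain Y where Y: "Y \<in> carrier_mat d d" "X = fm Y" using fm_surj[OF X] by blast
      then show ?thesis using Pfm idem channel_carrier[OF P] by simp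
    qed
  qed (simp_all add: P'_def KM)
  obtain r :: nat and \<rho> v c where basic: "\<forall>i<r. \<rho> i < r \<and> v i \<in> Mat d d \<and> c (\<rho> i) > (0::real)"
    and tr: "\<forall>X\<in>Mat d d. (\<Sum>i<r. trc (adj (v i) * P' X * v i)) = trc X"
    and dec: "\<forall>X\<in>Mat d d. P' X = (\<Sum>i<r. \<Sum>j<r. if \<rho> i = \<rho> j then
        scl (trc (adj (v i) * P' X * v j) / of_real (c (\<rho> i))) (v i * \<sigma> * adj (v j)) else 0)"
    and units: "\<forall>k<r. \<forall>l<r. \<rho> k = \<rho> l \<longrightarrow> P' (v k * \<sigma> * adj (v l)) = v k * \<sigma> * adj (v l) \<and>
        trc (v k * \<sigma> * adj (v l)) = (if k = l then of_real (c (\<rho> k)) else 0) \<and>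
        (\<forall>i<r. \<forall>j<r. trc (adj (v i) * (v k * \<sigma> * adj (v l)) * v j)
           = (if i = k \<and> j = l then of_real (c (\<rho> k)) else 0))"
    using matrix_unit_decomposition by blast
  have vM: "v i \<in> Mat d d" if "i < r" for i using basic that by blast
  have trc_fm: "trc (fm X) = mtrace X" if "X \<in> carrier_mat d d" for X
    using that unfolding trc_Mat[OF fmM] by (simp add: mtrace_def fm_def ent_trunc)
  \<comment> \<open>In the Kraus index, \<open>a\<close> belongs to \<open>P\<close>,
    \<open>s\<close> is the row summed by the trace, and \<open>k\<close> is a block label: keeping
    only the rows with label \<open>k\<close> suppresses entries between blocks.\<close>
  define KF where "KF = (\<lambda>(k, s, a) i x. if \<rho> i = k then ent (adj (v i) * K a) s x else 0)"
  define F where "F = kraus d r ({..<r} \<times> {..<d} \<times> {..<m}) KF"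
  have Fent: "F X $$ (i, j) = (if \<rho> i = \<rho> j then trc (adj (v i) * P' (fm X) * v j) else 0)"
    if X: "X \<in> carrier_mat d d" and ij: "i < r" "j < r" for X i j
  proof -
    have aM: "adj (v i) * K a \<in> Mat d d" if "i < r" for i a
      by (intro Mat_mult[of _ d d] Mat_adj vM KM that)
    have cM: "adj (v i) * P' (fm X) * v j \<in> Mat d d"
      by (intro Mat_mult[of _ d d] Mat_adj vM ij P_Mat fmM)
    let ?S = "\<Sum>s<d. \<Sum>a<m. \<Sum>x<d. \<Sum>y<d.
        ent (adj (v i) * K a) s x * X $$ (x, y) * cnj (ent (adj (v j) * K a) s y)"
    have "F X $$ (i, j) = (\<Sum>k<r. \<Sum>s<d. \<Sum>a<m. \<Sum>x<d. \<Sum>y<d.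
        (if \<rho> i = k then ent (adj (v i) * K a) s x else 0) * X $$ (x, y) *
        cnj (if \<rho> j = k then ent (adj (v j) * K a) s y else 0))"
      using ij by (simp add: F_def kraus_def KF_def sum.cartesian_product')
    also have "\<dots> = (\<Sum>k<r. if k = \<rho> i then if \<rho> i = \<rho> j then ?S else 0 else 0)"
      by (intro sum.cong[OF refl]) auto
    also have "\<dots> = (if \<rho> i = \<rho> j then ?S else 0)"
      using basic ij by simp
    also have "?S
      = (\<Sum>s<d. \<Sum>a<m. ent ((adj (v i) * K a) * fm X * adj (adj (v j) * K a)) s s)"
      unfolding ent_sandwich[OF aM[OF ij(1)] fmM aM[OF ij(2)]]
      by (intro sum.cong refl) (simp add: fm_def ent_trunc)
    also have "\<dots> = (\<Sum>s<d. ent (adj (v i) * P' (fm X) * v j) s s)"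
      unfolding P'_def by (simp add: sum_distrib_left sum_distrib_right mult.assoc)
    also have "\<dots> = trc (adj (v i) * P' (fm X) * v j)"
      by (rule trc_Mat[OF cM, symmetric])
    finally show ?thesis .
  qed
  have "kraus_tp d r ({..<r} \<times> {..<d} \<times> {..<m}) KF"
  proof (rule kraus_tp_if_trace, unfold F_def[symmetric])
    fix k l assume kl: "k < d" "l < d"
    have "mtrace (F (unit_mat d k l)) = (\<Sum>i<r. F (unit_mat d k l) $$ (i, i))"
      by (simp add: mtrace_def F_def kraus_def)
    also have "\<dots> = trc (fm (unit_mat d k l))" using tr fmM by (simp add: Fent)
    also have "\<dots> = (if k = l then 1 else 0)" by (simp add: trc_fm mtrace_unit kl)
    finally show "mtrace (F (unit_mat d k l)) = (if k = l then 1 else 0)" .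
  qed
  then have Fch: "channel d r F" unfolding F_def by (rule channel_kraus)
  \<comment> \<open>Here \<open>s\<close> runs over the columns of \<open>v i * K a\<close>; summing
    over \<open>a\<close> and \<open>s\<close> yields \<open>v k * \<sigma> * adj (v l)\<close>, as
    \<sigma> is the sum of the \<open>K a * adj (K a)\<close>. The root of \<open>c\<close>
    normalises the trace.\<close>
  define KJ where "KJ = (\<lambda>(k, a, s) x i. if \<rho> i = k then ent (v i * K a) x s / of_real (sqrt (c k)) else 0)"
  define J where "J = kraus r d ({..<r} \<times> {..<m} \<times> {..<d}) KJ"
  have WM: "v k * \<sigma> * adj (v l) \<in> Mat d d" if "k < r" "l < r" for k l
    by (intro Mat_mult[of _ d d] Mat_adj vM that \<sigma>_Mat)
  have Jent: "J (unit_mat r k l) $$ (x, y) = (if \<rho> k = \<rho> l then ent (v k * \<sigma> * adj (v l)) x y / of_real (c (\<rho> k)) else 0)"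
    if kl: "k < r" "l < r" and xy: "x < d" "y < d" for k l x y
  proof -
    have sq: "of_real (sqrt (c (\<rho> i))) * of_real (sqrt (c (\<rho> i))) = (of_real (c (\<rho> i)) :: complex)" if "i < r" for i
      using basic that by (simp add: less_imp_le flip: of_real_mult)
    have aM: "v l * K a \<in> Mat d d" for a by (intro Mat_mult[of _ d d] vM KM kl)
    let ?S = "\<Sum>a<m. \<Sum>s<d. ent (v k * K a) x s * cnj (ent (v l * K a) y s) / of_real (c (\<rho> k))"
    have "J (unit_mat r k l) $$ (x, y) = (\<Sum>q<r. \<Sum>a<m. \<Sum>s<d.
       (if \<rho> k = q then ent (v k * K a) x s / of_real (sqrt (c q)) else 0) *
       cnj (if \<rho> l = q then ent (v l * K a) y s / of_real (sqrt (c q)) else 0))"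
      using kl xy by (simp add: J_def kraus_unit KJ_def sum.cartesian_product')
    also have "\<dots> = (\<Sum>q<r. if q = \<rho> k then if \<rho> k = \<rho> l then ?S else 0 else 0)"
      by (intro sum.cong[OF refl]) (auto simp: sq kl)
    also have "\<dots> = (if \<rho> k = \<rho> l then ?S else 0)"
      using basic kl by simp
    also have "?S
       = (\<Sum>a<m. ent ((v k * K a) * adj (v l * K a)) x y) / of_real (c (\<rho> k))"
      unfolding ent_mult_right[OF Mat_adj[OF aM]] ent_adj sum_divide_distrib ..
    also have "(\<Sum>a<m. ent ((v k * K a) * adj (v l * K a)) x y) = ent (v k * \<sigma> * adj (v l)) x y"
      by (simp add: \<sigma>_eq sum_distrib_left sum_distrib_right mult.assoc)
    finally show ?thesis .
  qed
  have Jfm: "fm (J (unit_mat r k l)) = (if \<rho> k = \<rho> l then scl (1 / of_real (c (\<rho> k))) (v k * \<sigma> * adj (v l)) else 0)"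
    if kl: "k < r" "l < r" for k l
    using WM[OF kl] Jent[OF kl] by (intro fmat_eqI) (auto simp: fm_def ent_trunc Mat_def)
  have Jcar: "J X \<in> carrier_mat d d" for X by (simp add: J_def)
  have "kraus_tp r d ({..<r} \<times> {..<m} \<times> {..<d}) KJ"
  proof (rule kraus_tp_if_trace, unfold J_def[symmetric])
    fix k l assume kl: "k < r" "l < r"
    have "mtrace (J (unit_mat r k l)) = trc (fm (J (unit_mat r k l)))" by (simp add: trc_fm Jcar)
    also have "\<dots> = (if k = l then 1 else 0)"
      unfolding Jfm[OF kl] using units basic kl by fastforce
    finally show "mtrace (J (unit_mat r k l)) = (if k = l then 1 else 0)" .
  qed
  then have Jch: "channel r d J" unfolding J_def by (rule channel_kraus)
  have PJF: "P X = J (F X)" if X: "X \<in> carrier_mat d d" for X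
  proof (rule eq_matI)
    have FX: "F X \<in> carrier_mat r r" by (rule channel_carrier[OF Fch X])
    fix x y assume "x < dim_row (J (F X))" "y < dim_col (J (F X))"
    then have xy: "x < d" "y < d" using Jcar[of "F X"] by auto
    have "J (F X) $$ (x, y) = (\<Sum>i<r. \<Sum>j<r. F X $$ (i, j) * J (unit_mat r i j) $$ (x, y))"
      by (rule lin_map_entries[OF channel_lin[OF Jch] FX xy])
    also have "\<dots> = (\<Sum>i<r. \<Sum>j<r. ent (if \<rho> i = \<rho> j then
        scl (trc (adj (v i) * P' (fm X) * v j) / of_real (c (\<rho> i))) (v i * \<sigma> * adj (v j)) else 0) x y)"
      by (intro sum.cong refl) (simp add: Fent X Jent xy)
    also have "\<dots> = ent (P' (fm X)) x y"
      by (subst bspec[OF dec fmM]) (simp only: ent_sum)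
    also have "\<dots> = P X $$ (x, y)" unfolding Pfm[OF X] using xy by (simp add: fm_def ent_trunc)
    finally show "P X $$ (x, y) = J (F X) $$ (x, y)" ..
  qed (use channel_carrier[OF P X] Jcar[of "F X"] in auto)
  have FJ: "F (J (unit_mat r k l)) = unit_mat r k l" if kl: "k < r" "l < r" "\<rho> k = \<rho> l" for k l
  proof (rule eq_matI)
    fix i j assume "i < dim_row (unit_mat r k l)" "j < dim_col (unit_mat r k l)"
    then have ij: "i < r" "j < r" by (auto simp: unit_mat_def)
    have ck: "c (\<rho> k) > 0" using basic kl by blast
    have "P' (fm (J (unit_mat r k l))) = scl (1 / of_real (c (\<rho> k))) (v k * \<sigma> * adj (v l))"
      using units kl by (simp add: Jfm P_scl)
    then have "trc (adj (v i) * P' (fm (J (unit_mat r k l))) * v j)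
       = 1 / of_real (c (\<rho> k)) * trc (adj (v i) * (v k * \<sigma> * adj (v l)) * v j)"
      by simp
    also have "\<dots> = (if i = k \<and> j = l then 1 else 0)" using units kl ij ck by simp
    finally have "F (J (unit_mat r k l)) $$ (i, j) = (if \<rho> i = \<rho> j then if i = k \<and> j = l then 1 else 0 else 0)"
      by (simp add: Fent Jcar ij)
    then show "F (J (unit_mat r k l)) $$ (i, j) = unit_mat r k l $$ (i, j)"
      using kl(3) by (auto simp: unit_mat_entry ij)
  qed (use channel_carrier[OF Fch Jcar] in \<open>auto simp: unit_mat_def\<close>)
  have "\<forall>X\<in>carrier_mat d d. \<forall>i<r. \<forall>j<r. \<rho> i \<noteq> \<rho> j \<longrightarrow> F X $$ (i, j) = 0"
    by (simp add: Fent)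
  then show ?thesis using Fch Jch PJF FJ by blast
qed

section \<open>The peripheral structure of a channel\<close>

text \<open>The blocks of the \<open>r \<times> r\<close> matrices are the level sets of \<open>\<rho>\<close> on \<open>{..<r}\<close>.\<close>

definition peripheral :: "nat \<Rightarrow> (complex mat \<Rightarrow> complex mat) \<Rightarrow> (nat \<Rightarrow> nat) \<Rightarrow> nat \<Rightarrow> (nat \<Rightarrow> nat) \<Rightarrow> bool" where
  "peripheral d T n r \<rho> \<longleftrightarrow> (\<exists>F J. channel d r F \<and> channel r d J \<and>
     (\<forall>k<r. \<forall>l<r. \<rho> k = \<rho> l \<longrightarrow> F (J (unit_mat r k l)) = unit_mat r k l) \<and>
     (\<forall>X\<in>carrier_mat d d. \<forall>i<r. \<forall>j<r. \<rho> i \<noteq> \<rho> j \<longrightarrow> F X $$ (i, j) = 0) \<and>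
     chan_tendsto d d (\<lambda>k. T ^^ n k) (J \<circ> F) \<and>
     (\<forall>t. \<exists>G. channel d d G \<and> (\<forall>X\<in>carrier_mat d d. (T ^^ t) (G X) = J (F X))))"

text \<open>Idempotence is P P = P L Q = L Q = P. The limit \<open>G\<close> of the powers preceding
  \<open>n k\<close> satisfies T G = P = G T, so it inverts \<open>T\<close> on the range of
  \<open>P\<close>; the recovery channel for the t-th power is \<open>P\<close> after t copies of
  \<open>G\<close>.\<close>

lemma peripheral_exists:
  assumes T: "channel d d T"
    and rel: "\<And>k. m' k = n k + m k" "\<And>k. n k = m k + l k" "\<And>k. n k = Suc (h k)"
    and conv: "\<And>p q i j. p < d \<Longrightarrow> q < d \<Longrightarrow> i < d \<Longrightarrow> j < d \<Longrightarrow>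
      (\<exists>L. (\<lambda>k. (T ^^ m k) (unit_mat d p q) $$ (i, j)) \<longlonglongrightarrow> L \<and>
           (\<lambda>k. (T ^^ m' k) (unit_mat d p q) $$ (i, j)) \<longlonglongrightarrow> L) \<and>
      convergent (\<lambda>k. (T ^^ n k) (unit_mat d p q) $$ (i, j)) \<and>
      convergent (\<lambda>k. (T ^^ l k) (unit_mat d p q) $$ (i, j)) \<and>
      convergent (\<lambda>k. (T ^^ h k) (unit_mat d p q) $$ (i, j))"
  shows "\<exists>r \<rho>. peripheral d T n r \<rho>"
proof -
  have Tn: "channel d d (T ^^ t)" for t by (rule channel_funpow[OF T])
  have cm: "convergent (\<lambda>k. (T ^^ m k) (unit_mat d p q) $$ (i, j))" if "p < d" "q < d" "i < d" "j < d" for p q i j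
    using conv[OF that] by (auto simp: convergent_def)
  obtain L where L: "channel d d L" "chan_tendsto d d (\<lambda>k. T ^^ m k) L"
    using channel_limit[of d d "\<lambda>k. T ^^ m k", OF Tn cm] by blast
  obtain P where P: "channel d d P" "chan_tendsto d d (\<lambda>k. T ^^ n k) P"
    using channel_limit[of d d "\<lambda>k. T ^^ n k"] Tn conv by blast
  obtain Q where Q: "channel d d Q" "chan_tendsto d d (\<lambda>k. T ^^ l k) Q"
    using channel_limit[of d d "\<lambda>k. T ^^ l k"] Tn conv by blast
  obtain G where G: "channel d d G" "chan_tendsto d d (\<lambda>k. T ^^ h k) G"
    using channel_limit[of d d "\<lambda>k. T ^^ h k"] Tn conv by blast
  note lin = channel_lin
  have m'L: "chan_tendsto d d (\<lambda>k. T ^^ m' k) L"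
    unfolding chan_tendsto_def
  proof (intro allI impI)
    fix p q i j assume *: "p < d" "q < d" "i < d" "j < d"
    obtain z where z: "(\<lambda>k. (T ^^ m k) (unit_mat d p q) $$ (i, j)) \<longlonglongrightarrow> z"
      "(\<lambda>k. (T ^^ m' k) (unit_mat d p q) $$ (i, j)) \<longlonglongrightarrow> z" using conv[OF *] by blast
    have "z = L (unit_mat d p q) $$ (i, j)"
      using z(1) L(2) * LIMSEQ_unique unfolding chan_tendsto_def by blast
    then show "(\<lambda>k. (T ^^ m' k) (unit_mat d p q) $$ (i, j)) \<longlonglongrightarrow> L (unit_mat d p q) $$ (i, j)"
      using z(2) by simp
  qed
  have "chan_tendsto d d (\<lambda>k. T ^^ n k \<circ> T ^^ m k) (P \<circ> L)"
    by (intro chan_tendsto_comp[of d d] lin Tn L P)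
  then have "chan_tendsto d d (\<lambda>k. T ^^ m' k) (P \<circ> L)" by (simp add: rel(1) funpow_add)
  then have PL: "P (L X) = L X" if "X \<in> carrier_mat d d" for X
    using chan_tendsto_unique[OF _ m'L lin[OF channel_comp[OF L(1) P(1)]] lin[OF L(1)] that] by simp
  have "chan_tendsto d d (\<lambda>k. T ^^ m k \<circ> T ^^ l k) (L \<circ> Q)"
    by (intro chan_tendsto_comp[of d d] lin Tn L Q)
  then have "chan_tendsto d d (\<lambda>k. T ^^ n k) (L \<circ> Q)" by (simp add: rel(2) funpow_add)
  then have LQ: "L (Q X) = P X" if "X \<in> carrier_mat d d" for X
    using chan_tendsto_unique[OF _ P(2) lin[OF channel_comp[OF Q(1) L(1)]] lin[OF P(1)] that] by simp
  have idem: "P (P X) = P X" if X: "X \<in> carrier_mat d d" for X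
    using PL[OF channel_carrier[OF Q(1) X]] LQ[OF X] by simp
  have Tconst: "chan_tendsto d d (\<lambda>_. T) T" by (simp add: chan_tendsto_def)
  have "chan_tendsto d d (\<lambda>k. T \<circ> T ^^ h k) (T \<circ> G)"
    by (intro chan_tendsto_comp[of d d] lin Tn T G Tconst)
  then have "chan_tendsto d d (\<lambda>k. T ^^ n k) (T \<circ> G)" by (simp add: rel(3))
  then have TG: "T (G X) = P X" if "X \<in> carrier_mat d d" for X
    using chan_tendsto_unique[OF _ P(2) lin[OF channel_comp[OF G(1) T]] lin[OF P(1)] that] by simp
  have "chan_tendsto d d (\<lambda>k. T ^^ h k \<circ> T) (G \<circ> T)"
    by (intro chan_tendsto_comp[of d d] lin Tn T G Tconst)
  then have "chan_tendsto d d (\<lambda>k. T ^^ n k) (G \<circ> T)" by (simp add: rel(3) funpow_Suc_right del: funpow.simps)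
  then have GT: "G (T X) = P X" if "X \<in> carrier_mat d d" for X
    using chan_tendsto_unique[OF _ P(2) lin[OF channel_comp[OF T G(1)]] lin[OF P(1)] that] by simp
  \<comment> \<open>Both sides are T G T.\<close>
  have TP: "T (P X) = P (T X)" if "X \<in> carrier_mat d d" for X
    using GT[OF that] TG[OF channel_carrier[OF T that]] by simp
  have rec: "\<exists>G'. channel d d G' \<and> (\<forall>X\<in>carrier_mat d d. (T ^^ t) (G' X) = P X)" for t
  proof (induction t)
    case 0
    then show ?case using P(1) by auto
  next
    case (Suc t)
    then obtain G' where G': "channel d d G'" "\<forall>X\<in>carrier_mat d d. (T ^^ t) (G' X) = P X" by blast
    have "(T ^^ Suc t) ((G' \<circ> G) X) = P X" if X: "X \<in> carrier_mat d d" for X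
    proof -
      have GX: "G X \<in> carrier_mat d d" by (rule channel_carrier[OF G(1) X])
      have "(T ^^ Suc t) ((G' \<circ> G) X) = T (P (G X))" using G'(2) GX by simp
      also have "\<dots> = P X" using TP[OF GX] TG[OF X] idem[OF X] by simp
      finally show ?thesis .
    qed
    then show ?case using channel_comp[OF G(1) G'(1)] by blast
  qed
  obtain r :: nat and \<rho> :: "nat \<Rightarrow> nat" and F J where FJ: "channel d r F" "channel r d J"
    "\<forall>X\<in>carrier_mat d d. P X = J (F X)"
    "\<forall>k<r. \<forall>l<r. \<rho> k = \<rho> l \<longrightarrow> F (J (unit_mat r k l)) = unit_mat r k l"
    "\<forall>X\<in>carrier_mat d d. \<forall>i<r. \<forall>j<r. \<rho> i \<noteq> \<rho> j \<longrightarrow> F X $$ (i, j) = 0"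
    using idempotent_channel_factorization[OF P(1) idem] by blast
  have "chan_tendsto d d (\<lambda>k. T ^^ n k) (J \<circ> F)"
    using P(2) FJ(3) by (simp add: chan_tendsto_def)
  moreover have "\<forall>t. \<exists>G. channel d d G \<and> (\<forall>X\<in>carrier_mat d d. (T ^^ t) (G X) = J (F X))"
    using rec FJ(3) by simp
  ultimately have "peripheral d T n r \<rho>" unfolding peripheral_def using FJ(1,2,4,5) by blast
  then show ?thesis by blast
qed

text \<open>The entries of the powers of both channels form one finite bounded family, so
  \<open>recurrent_times_exist\<close> yields times that serve both.\<close>

lemma common_peripheral_exists:
  assumes T: "channel d d T" and S: "channel d' d' S"
  shows "\<exists>n r \<rho> r' \<rho>'. (\<forall>k. k \<le> n k) \<and> peripheral d T n r \<rho> \<and> peripheral d' S n r' \<rho>'"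
proof -
  define x where "x t i = (case i of Inl (p, q, i, j) \<Rightarrow> (T ^^ t) (unit_mat d p q) $$ (i, j)
     | Inr (p, q, i, j) \<Rightarrow> (S ^^ t) (unit_mat d' p q) $$ (i, j))" for t i
  define I where "I = Inl ` ({..<d} \<times> {..<d} \<times> {..<d} \<times> {..<d}) \<union> Inr ` ({..<d'} \<times> {..<d'} \<times> {..<d'} \<times> {..<d'})"
  have "finite I" by (simp add: I_def)
  moreover have "cmod (x t i) \<le> 1" if "i \<in> I" for t i
    using that channel_entry_bound[OF channel_funpow[OF T]] channel_entry_bound[OF channel_funpow[OF S]]
    by (auto simp: I_def x_def)
  ultimately obtain m m' n l h :: "nat \<Rightarrow> nat" where
    rel: "\<forall>k. m' k = n k + m k \<and> n k = m k + l k \<and> n k = Suc (h k) \<and> k \<le> n k" and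
    conv: "\<forall>i\<in>I. (\<exists>L. (\<lambda>k. x (m k) i) \<longlonglongrightarrow> L \<and> (\<lambda>k. x (m' k) i) \<longlonglongrightarrow> L) \<and>
       convergent (\<lambda>k. x (n k) i) \<and> convergent (\<lambda>k. x (l k) i) \<and> convergent (\<lambda>k. x (h k) i)"
    using recurrent_times_exist[of I x 1] by blast
  have "\<exists>r \<rho>. peripheral d T n r \<rho>"
  proof (rule peripheral_exists[OF T, of m' n m l h], goal_cases)
    case (4 p q i j)
    then have "Inl (p, q, i, j) \<in> I" by (simp add: I_def)
    from bspec[OF conv this] show ?case by (simp add: x_def)
  qed (use rel in blast)+
  moreover have "\<exists>r \<rho>. peripheral d' S n r \<rho>"
  proof (rule peripheral_exists[OF S, of m' n m l h], goal_cases)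
    case (4 p q i j)
    then have "Inr (p, q, i, j) \<in> I" by (simp add: I_def)
    from bspec[OF conv this] show ?case by (simp add: x_def)
  qed (use rel in blast)+
  ultimately show ?thesis using rel by blast
qed

text \<open>Encoding the pair gives a natural number again. Such labels may exceed r r', which is
  harmless as \<open>peripheral\<close> only compares them.\<close>

definition pair_label :: "nat \<Rightarrow> (nat \<Rightarrow> nat) \<Rightarrow> (nat \<Rightarrow> nat) \<Rightarrow> nat \<Rightarrow> nat" where
  "pair_label r' \<rho> \<rho>' x = prod_encode (\<rho> (x div r'), \<rho>' (x mod r'))"

lemma pair_label_eq_iff:
  "pair_label r' \<rho> \<rho>' x = pair_label r' \<rho> \<rho>' y \<longleftrightarrow> \<rho> (x div r') = \<rho> (y div r') \<and> \<rho>' (x mod r') = \<rho>' (y mod r')"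
  by (simp add: pair_label_def)

text \<open>The tensor products of the maps \<open>F\<close>, \<open>J\<close> and \<open>G\<close>
  serve for the tensor channel. Where pair labels differ, one of the two factors of each entry
  vanishes; the limit is a product of limits because \<open>n\<close> is shared.\<close>

lemma peripheral_tensor:
  assumes T: "channel d d T" "peripheral d T n r \<rho>" and S: "channel d' d' S" "peripheral d' S n r' \<rho>'"
  shows "peripheral (d * d') (gtensor d d d' d' T S) n (r * r') (pair_label r' \<rho> \<rho>')"
proof -
  let ?pl = "pair_label r' \<rho> \<rho>'" and ?g = "gtensor d d d' d'" and ?u = "unit_mat (r * r')" and ?w = "unit_mat (d * d')"
  obtain F J where F: "channel d r F" "channel r d J"
    "\<forall>k<r. \<forall>l<r. \<rho> k = \<rho> l \<longrightarrow> F (J (unit_mat r k l)) = unit_mat r k l"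
    "\<forall>X\<in>carrier_mat d d. \<forall>i<r. \<forall>j<r. \<rho> i \<noteq> \<rho> j \<longrightarrow> F X $$ (i, j) = 0"
    "chan_tendsto d d (\<lambda>k. T ^^ n k) (J \<circ> F)"
    "\<forall>t. \<exists>G. channel d d G \<and> (\<forall>X\<in>carrier_mat d d. (T ^^ t) (G X) = J (F X))"
    using T(2) unfolding peripheral_def by blast
  obtain F' J' where F': "channel d' r' F'" "channel r' d' J'"
    "\<forall>k<r'. \<forall>l<r'. \<rho>' k = \<rho>' l \<longrightarrow> F' (J' (unit_mat r' k l)) = unit_mat r' k l"
    "\<forall>X\<in>carrier_mat d' d'. \<forall>i<r'. \<forall>j<r'. \<rho>' i \<noteq> \<rho>' j \<longrightarrow> F' X $$ (i, j) = 0"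
    "chan_tendsto d' d' (\<lambda>k. S ^^ n k) (J' \<circ> F')"
    "\<forall>t. \<exists>G. channel d' d' G \<and> (\<forall>X\<in>carrier_mat d' d'. (S ^^ t) (G X) = J' (F' X))"
    using S(2) unfolding peripheral_def by blast
  define F2 where "F2 = gtensor d r d' r' F F'"
  define J2 where "J2 = gtensor r d r' d' J J'"
  have F2: "channel (d * d') (r * r') F2" unfolding F2_def by (rule channel_gtensor[OF F(1) F'(1)])
  have J2: "channel (r * r') (d * d') J2" unfolding J2_def by (rule channel_gtensor[OF F(2) F'(2)])
  have JF: "J2 (F2 X) = ?g (J \<circ> F) (J' \<circ> F') X" if "X \<in> carrier_mat (d * d') (d * d')" for X
    unfolding F2_def J2_def by (rule gtensor_comp[OF F(1,2) F'(1,2) that, symmetric])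
  have FJ: "F2 (J2 (?u x y)) = ?u x y"
    if xy: "x < r * r'" "y < r * r'" "?pl x = ?pl y" for x y
  proof (rule eq_matI)
    note b = xy(1,2)[THEN div_less_mult] xy(1,2)[THEN mod_less_mult]
    have lab: "\<rho> (x div r') = \<rho> (y div r')" "\<rho>' (x mod r') = \<rho>' (y mod r')"
      using xy(3) by (auto simp: pair_label_eq_iff)
    fix i j assume "i < dim_row (?u x y)" "j < dim_col (?u x y)"
    then have ij: "i < r * r'" "j < r * r'" by (auto simp: unit_mat_def)
    note c = ij[THEN div_less_mult] ij[THEN mod_less_mult]
    have e: "i = x \<longleftrightarrow> i div r' = x div r' \<and> i mod r' = x mod r'" "j = y \<longleftrightarrow> j div r' = y div r' \<and> j mod r' = y mod r'"
      by (metis div_mult_mod_eq)+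
    have "F2 (J2 (?u x y)) $$ (i, j) = gtensor r r r' r' (F \<circ> J) (F' \<circ> J') (?u x y) $$ (i, j)"
      unfolding F2_def J2_def by (subst gtensor_comp[OF F(2,1) F'(2,1)]) simp_all
    also have "\<dots> = unit_mat r (x div r') (y div r') $$ (i div r', j div r') * unit_mat r' (x mod r') (y mod r') $$ (i mod r', j mod r')"
      unfolding gtensor_unit[OF xy(1,2) ij] using F(3) F'(3) b lab by simp
    also have "\<dots> = ?u x y $$ (i, j)"
      unfolding unit_mat_entry[OF c(1,2)] unit_mat_entry[OF c(3,4)] unit_mat_entry[OF ij] e by auto
    finally show "F2 (J2 (?u x y)) $$ (i, j) = ?u x y $$ (i, j)" .
  qed (use channel_carrier[OF F2 channel_carrier[OF J2 unit_mat_carrier]] in \<open>auto simp: unit_mat_def\<close>)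
  have blocks: "F2 X $$ (i, j) = 0"
    if ij: "i < r * r'" "j < r * r'" "?pl i \<noteq> ?pl j" for X i j
  proof -
    note c = ij(1,2)[THEN div_less_mult] ij(1,2)[THEN mod_less_mult]
    have "F (unit_mat d p q) $$ (i div r', j div r') = 0 \<or> F' (unit_mat d' p' q') $$ (i mod r', j mod r') = 0" for p q p' q'
      using F(4) F'(4) c ij(3) unit_mat_carrier by (metis pair_label_eq_iff)
    then have z: "X $$ (p * d' + p', q * d' + q') * F (unit_mat d p q) $$ (i div r', j div r') *
        F' (unit_mat d' p' q') $$ (i mod r', j mod r') = 0" for p q p' q' by (metis mult_zero_left mult_zero_right)
    show ?thesis using ij by (simp add: F2_def gtensor_def z del: mult_eq_0_iff)
  qed
  have lim: "chan_tendsto (d * d') (d * d') (\<lambda>k. ?g T S ^^ n k) (J2 \<circ> F2)"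
    unfolding chan_tendsto_def
  proof (intro allI impI)
    fix x y i j assume xy: "x < d * d'" "y < d * d'" and ij: "i < d * d'" "j < d * d'"
    note b = xy[THEN div_less_mult] xy[THEN mod_less_mult]
      ij[THEN div_less_mult] ij[THEN mod_less_mult]
    show "(\<lambda>k. (?g T S ^^ n k) (?w x y) $$ (i, j)) \<longlonglongrightarrow> (J2 \<circ> F2) (?w x y) $$ (i, j)"
      unfolding gtensor_funpow[OF T(1) S(1) unit_mat_carrier] comp_def[of J2] JF[OF unit_mat_carrier]
        gtensor_unit[OF xy ij]
      using F(5) F'(5) b by (intro tendsto_mult) (auto simp: chan_tendsto_def)
  qed
  have inv: "\<exists>G. channel (d * d') (d * d') G \<and> (\<forall>X\<in>carrier_mat (d * d') (d * d').
      (?g T S ^^ t) (G X) = J2 (F2 X))" for t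
  proof -
    obtain G where G: "channel d d G" "\<forall>X\<in>carrier_mat d d. (T ^^ t) (G X) = J (F X)" using F(6) by blast
    obtain G' where G': "channel d' d' G'" "\<forall>X\<in>carrier_mat d' d'. (S ^^ t) (G' X) = J' (F' X)" using F'(6) by blast
    have ch: "channel (d * d') (d * d') (?g G G')" by (rule channel_gtensor[OF G(1) G'(1)])
    have "(?g T S ^^ t) (?g G G' X) = J2 (F2 X)"
      if X: "X \<in> carrier_mat (d * d') (d * d')" for X
    proof -
      have "(?g T S ^^ t) (?g G G' X)
          = ?g (T ^^ t) (S ^^ t) (?g G G' X)"
        by (rule gtensor_funpow[OF T(1) S(1) channel_carrier[OF ch X]])
      also have "\<dots> = ?g (T ^^ t \<circ> G) (S ^^ t \<circ> G') X"
        by (rule gtensor_comp[OF G(1) channel_funpow[OF T(1)] G'(1) channel_funpow[OF S(1)] X, symmetric])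
      also have "?g (T ^^ t \<circ> G) (S ^^ t \<circ> G') = ?g (J \<circ> F) (J' \<circ> F')"
        by (rule gtensor_cong) (use G(2) G'(2) in auto)
      finally show ?thesis using JF[OF X] by simp
    qed
    then show ?thesis using ch by blast
  qed
  show ?thesis unfolding peripheral_def
    by (intro exI[of _ F2] exI[of _ J2] conjI F2 J2 lim) (use FJ blocks inv in auto)
qed

section \<open>Zero-error capacities\<close>

definition max_class :: "nat \<Rightarrow> (nat \<Rightarrow> nat) \<Rightarrow> nat" where
  "max_class r \<rho> = Max ((\<lambda>s. card (label_class r \<rho> s)) ` {..<r})"

lemma card_class_le: "s < r \<Longrightarrow> card (label_class r \<rho> s) \<le> max_class r \<rho>"
  by (simp add: max_class_def)

lemma max_class_attained:
  assumes "r \<ge> 1" shows "\<exists>s<r. card (label_class r \<rho> s) = max_class r \<rho>"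
proof -
  have "max_class r \<rho> \<in> (\<lambda>s. card (label_class r \<rho> s)) ` {..<r}"
    unfolding max_class_def using assms by (intro Max_in) (auto simp: lessThan_empty_iff)
  then show ?thesis by auto
qed

lemma max_class_pos: assumes "r \<ge> 1" shows "max_class r \<rho> \<ge> 1"
proof -
  have "0 < card (label_class r \<rho> 0)" using assms by (auto simp: card_gt_0_iff intro!: exI[of _ 0])
  then show ?thesis using card_class_le[of 0 r \<rho>] assms by simp
qed

text \<open>Classes of pair labels are products of classes, and the two components vary
  independently, so the largest sizes multiply.\<close>

lemma max_class_pair:
  assumes r: "r \<ge> 1" "r' \<ge> 1"
  shows "max_class (r * r') (pair_label r' \<rho> \<rho>') = max_class r \<rho> * max_class r' \<rho>'"
proof -
  let ?pl = "pair_label r' \<rho> \<rho>'"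
  have card: "card (label_class (r * r') ?pl x)
      = card (label_class r \<rho> (x div r')) * card (label_class r' \<rho>' (x mod r'))" for x
  proof -
    have "bij_betw (\<lambda>(s, t). s * r' + t)
        (label_class r \<rho> (x div r') \<times> label_class r' \<rho>' (x mod r'))
        (label_class (r * r') ?pl x)"
      by (rule bij_betw_byWitness[where f' = "\<lambda>y. (y div r', y mod r')"])
        (auto simp: pair_label_eq_iff mult_add_less div_mod_split div_less_mult mod_less_mult)
    from bij_betw_same_card[OF this] show ?thesis by (simp add: card_cartesian_product)
  qed
  show ?thesis
  proof (rule antisym)
    obtain x where x: "x < r * r'"
      "card (label_class (r * r') ?pl x) = max_class (r * r') ?pl"
      using max_class_attained[of "r * r'" ?pl] r by auto
    show "max_class (r * r') ?pl \<le> max_class r \<rho> * max_class r' \<rho>'"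
      unfolding x(2)[symmetric] card
      by (intro mult_le_mono card_class_le div_less_mult[OF x(1)] mod_less_mult[OF x(1)])
    obtain s where s: "s < r" "card (label_class r \<rho> s) = max_class r \<rho>"
      using max_class_attained[OF r(1)] by blast
    obtain s' where s': "s' < r'" "card (label_class r' \<rho>' s') = max_class r' \<rho>'"
      using max_class_attained[OF r(2)] by blast
    show "max_class r \<rho> * max_class r' \<rho>' \<le> max_class (r * r') ?pl"
      using card_class_le[OF mult_add_less[OF s(1) s'(1)], of ?pl] s s'
      by (simp add: card div_mod_split)
  qed
qed

text \<open>\<open>E\<close> is conjugation by the isometry that sends basis vector a to basis
  vector \<open>f a\<close>, and \<open>R\<close> undoes it. It places an
  \<open>M\<close>-dimensional system in one block.\<close>

lemma block_embedding:
  assumes f: "inj_on f {..<M}" "f ` {..<M} \<subseteq> {..<r}" and M: "M \<ge> 1"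
  shows "\<exists>E R. channel M r E \<and> channel r M R \<and>
    (\<forall>a<M. \<forall>b<M. E (unit_mat M a b) = unit_mat r (f a) (f b) \<and> R (unit_mat r (f a) (f b)) = unit_mat M a b)"
proof -
  have f_eq: "f a = f b \<longleftrightarrow> a = b" if "a < M" "b < M" for a b using f(1) that by (auto simp: inj_on_def)
  have f_less: "f a < r" if "a < M" for a using f(2) that by auto
  define KE :: "nat \<Rightarrow> nat \<Rightarrow> nat \<Rightarrow> complex" where "KE = (\<lambda>_ i a. if i = f a then 1 else 0)"
  \<comment> \<open>Index \<open>r\<close> is the compression onto the image of \<open>f\<close>.
    Each s < r outside this image sends basis vector s to vector 0, which restores trace
    preservation and needs \<open>M\<close> >= 1.\<close>
  define KR :: "nat \<Rightarrow> nat \<Rightarrow> nat \<Rightarrow> complex" where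
    "KR s a i = (if s = r then if i = f a then 1 else 0
       else if i = s \<and> a = 0 \<and> s \<notin> f ` {..<M} then 1 else 0)" for s a i
  define E where "E = kraus M r {0::nat} KE"
  define R where "R = kraus r M {..<Suc r} KR"
  have "kraus_tp M r {0} KE"
    unfolding kraus_tp_def
  proof (intro allI impI)
    fix k l assume kl: "k < M" "l < M"
    have "(\<Sum>i<r. KE 0 i k * cnj (KE 0 i l)) = (\<Sum>i<r. if i = f k then if k = l then 1 else 0 else 0)"
      using f_eq[OF kl] by (intro sum.cong refl) (auto simp: KE_def)
    then show "(\<Sum>a\<in>{0}. \<Sum>i<r. KE a i k * cnj (KE a i l)) = (if k = l then 1 else 0)"
      using f_less[OF kl(1)] by simp
  qed
  then have E: "channel M r E" unfolding E_def by (rule channel_kraus)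
  have "kraus_tp r M {..<Suc r} KR"
    unfolding kraus_tp_def
  proof (intro allI impI)
    fix k l assume kl: "k < r" "l < r"
    have "(\<Sum>i<M. KR s i k * cnj (KR s i l)) = (if s = k then if k = l \<and> k \<notin> f ` {..<M} then 1 else 0 else 0)" if "s < r" for s
    proof -
      have "(\<Sum>i<M. KR s i k * cnj (KR s i l)) = (\<Sum>i<M. if i = 0 then if s = k then if k = l \<and> k \<notin> f ` {..<M} then 1 else 0 else 0 else 0)"
        using that by (intro sum.cong refl) (auto simp: KR_def)
      then show ?thesis using M by simp
    qed
    then have "(\<Sum>s<r. \<Sum>i<M. KR s i k * cnj (KR s i l)) = (if k = l \<and> k \<notin> f ` {..<M} then 1 else 0)"
      using kl by simp
    moreover have "(\<Sum>i<M. KR r i k * cnj (KR r i l)) = (if k = l \<and> k \<in> f ` {..<M} then 1 else 0)"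
    proof (cases "k \<in> f ` {..<M}")
      case True
      then obtain a where a: "a < M" "k = f a" by auto
      have "(\<Sum>i<M. KR r i k * cnj (KR r i l)) = (\<Sum>i<M. if i = a then if k = l then 1 else 0 else 0)"
        using a f_eq by (intro sum.cong refl) (auto simp: KR_def)
      then show ?thesis using a by auto
    next
      case False
      then show ?thesis by (auto simp: KR_def intro!: sum.neutral)
    qed
    ultimately show "(\<Sum>s<Suc r. \<Sum>i<M. KR s i k * cnj (KR s i l)) = (if k = l then 1 else 0)" by simp
  qed
  then have R: "channel r M R" unfolding R_def by (rule channel_kraus)
  have EM: "E (unit_mat M a b) = unit_mat r (f a) (f b)" if "a < M" "b < M" for a b
  proof (rule eq_matI)
    fix i j assume "i < dim_row (unit_mat r (f a) (f b))" "j < dim_col (unit_mat r (f a) (f b))"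
    then have "i < r" "j < r" by (auto simp: unit_mat_def)
    then show "E (unit_mat M a b) $$ (i, j) = unit_mat r (f a) (f b) $$ (i, j)"
      using that by (simp add: E_def kraus_unit KE_def unit_mat_entry)
  qed (use channel_carrier[OF E unit_mat_carrier] in \<open>auto simp: unit_mat_def\<close>)
  have RM: "R (unit_mat r (f a) (f b)) = unit_mat M a b" if ab: "a < M" "b < M" for a b
  proof (rule eq_matI)
    fix i j assume "i < dim_row (unit_mat M a b)" "j < dim_col (unit_mat M a b)"
    then have ij: "i < M" "j < M" by (auto simp: unit_mat_def)
    have "R (unit_mat r (f a) (f b)) $$ (i, j) = (\<Sum>s<Suc r. KR s i (f a) * cnj (KR s j (f b)))"
      unfolding R_def by (rule kraus_unit) (use f_less ab ij in auto)
    also have "\<dots> = KR r i (f a) * cnj (KR r j (f b)) + (\<Sum>s<r. KR s i (f a) * cnj (KR s j (f b)))" by simp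
    also have "(\<Sum>s<r. KR s i (f a) * cnj (KR s j (f b))) = 0"
      using ab by (intro sum.neutral) (auto simp: KR_def)
    finally show "R (unit_mat r (f a) (f b)) $$ (i, j) = unit_mat M a b $$ (i, j)"
      using ab ij f_eq by (auto simp: KR_def unit_mat_entry)
  qed (use channel_carrier[OF R unit_mat_carrier] in \<open>auto simp: unit_mat_def\<close>)
  show ?thesis using E R EM RM by blast
qed

lemma funpow_split:
  fixes T :: "complex mat \<Rightarrow> complex mat"
  assumes "n \<le> t" shows "(T ^^ t) X = (T ^^ n) ((T ^^ (t - n)) X)"
  using funpow_add[of n "t - n" T] assms by simp

text \<open>The recovery channels give perfect codes for every power, with r messages or with one
  largest block. Conversely, a code for a large power is nearly a code for the limit
  \<open>J \<circ> F\<close>; with \<open>F\<close> moved to the encoder and \<open>J\<close> to the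
  decoder, the bounds for codes through \<open>r \<times> r\<close> block matrices apply.\<close>

theorem capacities_peripheral:
  assumes d: "d \<ge> 1" and T: "channel d d T" and per: "peripheral d T n r \<rho>" and n: "\<And>k. k \<le> n k"
  shows "r \<ge> 1" "C_inf 0 d T = log 2 (real r)" "Q_inf 0 d T = log 2 (real (max_class r \<rho>))"
proof -
  obtain F J where F: "channel d r F" and J: "channel r d J"
    and FJ: "\<forall>k<r. \<forall>l<r. \<rho> k = \<rho> l \<longrightarrow> F (J (unit_mat r k l)) = unit_mat r k l"
    and blocks: "\<forall>X\<in>carrier_mat d d. \<forall>i<r. \<forall>j<r. \<rho> i \<noteq> \<rho> j \<longrightarrow> F X $$ (i, j) = 0"
    and lim: "chan_tendsto d d (\<lambda>k. T ^^ n k) (J \<circ> F)"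
    and inv: "\<forall>t. \<exists>G. channel d d G \<and> (\<forall>X\<in>carrier_mat d d. (T ^^ t) (G X) = J (F X))"
    using per unfolding peripheral_def by blast
  show r: "r \<ge> 1"
  proof (rule ccontr)
    assume "\<not> r \<ge> 1"
    then have "r = 0" by simp
    have "mtrace (F (unit_mat d 0 0)) = mtrace (unit_mat d 0 0)"
      using F unit_mat_carrier unfolding channel_def by blast
    moreover have "mtrace (F (unit_mat d 0 0)) = 0"
      using channel_carrier[OF F unit_mat_carrier, of 0 0] \<open>r = 0\<close> by (simp add: mtrace_def)
    ultimately show False using d by (simp add: mtrace_unit)
  qed
  define M where "M = max_class r \<rho>"
  have M: "M \<ge> 1" unfolding M_def by (rule max_class_pos[OF r])
  have Tn: "channel d d (T ^^ t)" for t by (rule channel_funpow[OF T])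
  have lower_C: "classical_code d (T ^^ t) r 0" for t
  proof -
    obtain G where G: "channel d d G" "\<forall>X\<in>carrier_mat d d. (T ^^ t) (G X) = J (F X)" using inv by blast
    \<comment> \<open>The left side is F J F J on a diagonal unit, whose two indices trivially share
      a label.\<close>
    have "F ((T ^^ t) ((G \<circ> J) (unit_mat r i i))) = unit_mat r i i" if "i < r" for i
      using G(2) channel_carrier[OF J unit_mat_carrier] FJ that by simp
    then have "(\<Sum>i<r. Re (F ((T ^^ t) ((G \<circ> J) (unit_mat r i i))) $$ (i, i))) \<ge> real r"
      by (simp add: unit_mat_entry)
    then show ?thesis unfolding classical_code_0_iff using r channel_comp[OF J G(1)] F by blast
  qed
  have lower_Q: "quantum_code d (T ^^ t) M 0" for t
  proof -
    obtain s where s: "s < r" "card (label_class r \<rho> s) = M"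
      using max_class_attained[OF r] by (auto simp: M_def)
    obtain f where f: "bij_betw f {0..<M} (label_class r \<rho> s)"
      using ex_bij_betw_nat_finite[of "label_class r \<rho> s"] s(2) by auto
    then have f': "inj_on f {..<M}" "f ` {..<M} \<subseteq> {..<r}" and lab: "\<And>a. a < M \<Longrightarrow> f a < r \<and> \<rho> (f a) = \<rho> s"
      by (auto simp: bij_betw_def lessThan_atLeast0)
    obtain E R where E: "channel M r E" and R: "channel r M R" and
      ER: "\<forall>a<M. \<forall>b<M. E (unit_mat M a b) = unit_mat r (f a) (f b) \<and> R (unit_mat r (f a) (f b)) = unit_mat M a b"
      using block_embedding[OF f' M] by blast
    obtain G where G: "channel d d G" "\<forall>X\<in>carrier_mat d d. (T ^^ t) (G X) = J (F X)" using inv by blast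
    have "(R \<circ> F) ((T ^^ t) ((G \<circ> (J \<circ> E)) (unit_mat M a b))) = unit_mat M a b" if ab: "a < M" "b < M" for a b
      using ab ER G(2) channel_carrier[OF J unit_mat_carrier] FJ lab by simp
    then have "(\<Sum>a<M. \<Sum>b<M. Re ((R \<circ> F) ((T ^^ t) ((G \<circ> (J \<circ> E)) (unit_mat M a b))) $$ (a, b))) \<ge> (real M)\<^sup>2"
      by (simp add: unit_mat_entry power2_eq_square del: comp_apply)
    then show ?thesis
      unfolding quantum_code_0_iff[OF Tn]
      using M channel_comp[OF channel_comp[OF E J] G(1)] channel_comp[OF F R] by blast
  qed
  \<comment> \<open>This crude bound keeps the perturbation error, proportional to D, below
    1/2.\<close>
  have dim_C: "D \<le> d" if code: "classical_code d (T ^^ t) D 0" for D t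
  proof -
    obtain E R where ER: "channel D d E" "channel d D R"
      "(\<Sum>i<D. Re (R ((T ^^ t) (E (unit_mat D i i))) $$ (i, i))) \<ge> real D"
      using code unfolding classical_code_0_iff by blast
    have "real D \<le> real d" using classical_success_bound[OF channel_comp[OF ER(1) Tn] ER(2), of t] ER(3) by simp
    then show ?thesis by simp
  qed
  have dim_Q: "D \<le> d" if code: "quantum_code d (T ^^ t) D 0" for D t
  proof -
    obtain E R where ER: "D \<ge> 1" "channel D d E" "channel d D R"
      "(\<Sum>k<D. \<Sum>l<D. Re (R ((T ^^ t) (E (unit_mat D k l))) $$ (k, l))) \<ge> (real D)\<^sup>2"
      using code unfolding quantum_code_0_iff[OF Tn] by blast
    \<comment> \<open>With a constant label, all of the \<open>d \<times> d\<close> matrices form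
      one block of size \<open>d\<close>.\<close>
    have "(\<Sum>k<D. \<Sum>l<D. Re (R ((T ^^ t \<circ> E) (unit_mat D k l)) $$ (k, l))) \<le> real d * real D"
      by (rule quantum_fidelity_bound[OF channel_comp[OF ER(2) Tn] ER(3), of "\<lambda>_. 0"]) auto
    then have "real D * real D \<le> real d * real D" using ER(4) by (simp add: power2_eq_square)
    then show ?thesis using ER(1) by simp
  qed
  \<comment> \<open>The error per term is d^4 \<epsilon> = 1 / (2 d). Over at most d messages this
    adds up to at most 1/2, so that integrality recovers the exact bound.\<close>
  define \<epsilon> where "\<epsilon> = 1 / (2 * real d ^ 5)"
  have \<epsilon>: "\<epsilon> > 0" "real d ^ 4 * \<epsilon> = 1 / (2 * real d)" using d by (auto simp: \<epsilon>_def field_simps eval_nat_numeral)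
  have "\<forall>\<^sub>F k in sequentially. \<forall>x\<in>{..<d} \<times> {..<d} \<times> {..<d} \<times> {..<d}. case x of (p, q, i, j) \<Rightarrow>
      cmod ((T ^^ n k) (unit_mat d p q) $$ (i, j) - (J \<circ> F) (unit_mat d p q) $$ (i, j)) < \<epsilon>"
  proof (rule eventually_ball_finite)
    show "\<forall>x\<in>{..<d} \<times> {..<d} \<times> {..<d} \<times> {..<d}. \<forall>\<^sub>F k in sequentially. case x of (p, q, i, j) \<Rightarrow>
      cmod ((T ^^ n k) (unit_mat d p q) $$ (i, j) - (J \<circ> F) (unit_mat d p q) $$ (i, j)) < \<epsilon>"
      using lim \<epsilon>(1) unfolding chan_tendsto_def tendsto_iff dist_norm by auto
  qed auto
  then obtain k where close: "\<And>p q i j. p < d \<Longrightarrow> q < d \<Longrightarrow> i < d \<Longrightarrow> j < d \<Longrightarrow>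
      cmod ((T ^^ n k) (unit_mat d p q) $$ (i, j) - (J \<circ> F) (unit_mat d p q) $$ (i, j)) \<le> \<epsilon>"
    unfolding eventually_sequentially by (fastforce intro: less_imp_le)
  have JF: "lin_map d d (J \<circ> F)" by (rule channel_lin[OF channel_comp[OF F J]])
  have upper_C: "D \<le> r" if t: "n k \<le> t" and code: "classical_code d (T ^^ t) D 0" for D t
  proof -
    obtain E R where ER: "channel D d E" "channel d D R"
      "(\<Sum>i<D. Re (R ((T ^^ t) (E (unit_mat D i i))) $$ (i, i))) \<ge> real D"
      using code unfolding classical_code_0_iff by blast
    \<comment> \<open>Only the fixed power \<open>T ^^ n k\<close> is close to the limit; the
      surplus steps are absorbed into the encoder.\<close>
    define E' where "E' = T ^^ (t - n k) \<circ> E"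
    have E': "channel D d E'" unfolding E'_def by (rule channel_comp[OF ER(1) Tn])
    have "real D \<le> (\<Sum>i<D. Re (R ((T ^^ n k) (E' (unit_mat D i i))) $$ (i, i)))"
      using ER(3) by (simp add: E'_def funpow_split[OF t])
    also have "\<dots> \<le> (\<Sum>i<D. Re (R ((J \<circ> F) (E' (unit_mat D i i))) $$ (i, i)) + real d ^ 4 * \<epsilon>)"
      by (intro sum_mono channel_perturbation[OF E' ER(2) channel_lin[OF Tn] JF close]) auto
    also have "\<dots> = (\<Sum>i<D. Re ((R \<circ> J) ((F \<circ> E') (unit_mat D i i)) $$ (i, i))) + real D / (2 * real d)"
      by (simp add: sum.distrib \<epsilon>(2))
    also have "\<dots> \<le> real r + real D / (2 * real d)"
      using classical_success_bound[OF channel_comp[OF E' F] channel_comp[OF J ER(2)]] by simp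
    also have "real D / (2 * real d) \<le> 1 / 2" using dim_C[OF code] d by (simp add: divide_simps)
    finally show ?thesis by linarith
  qed
  have upper_Q: "D \<le> M" if t: "n k \<le> t" and code: "quantum_code d (T ^^ t) D 0" for D t
  proof -
    obtain E R where ER: "D \<ge> 1" "channel D d E" "channel d D R"
      "(\<Sum>k<D. \<Sum>l<D. Re (R ((T ^^ t) (E (unit_mat D k l))) $$ (k, l))) \<ge> (real D)\<^sup>2"
      using code unfolding quantum_code_0_iff[OF Tn] by blast
    define E' where "E' = T ^^ (t - n k) \<circ> E"
    have E': "channel D d E'" unfolding E'_def by (rule channel_comp[OF ER(2) Tn])
    have "(real D)\<^sup>2 \<le> (\<Sum>a<D. \<Sum>b<D. Re (R ((T ^^ n k) (E' (unit_mat D a b))) $$ (a, b)))"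
      using ER(4) by (simp add: E'_def funpow_split[OF t])
    also have "\<dots> \<le> (\<Sum>a<D. \<Sum>b<D. Re (R ((J \<circ> F) (E' (unit_mat D a b))) $$ (a, b)) + real d ^ 4 * \<epsilon>)"
      by (intro sum_mono channel_perturbation[OF E' ER(3) channel_lin[OF Tn] JF close]) auto
    also have "\<dots> = (\<Sum>a<D. \<Sum>b<D. Re ((R \<circ> J) ((F \<circ> E') (unit_mat D a b)) $$ (a, b))) + (real D)\<^sup>2 / (2 * real d)"
      by (simp add: sum.distrib \<epsilon>(2) power2_eq_square)
    also have "(\<Sum>a<D. \<Sum>b<D. Re ((R \<circ> J) ((F \<circ> E') (unit_mat D a b)) $$ (a, b))) \<le> real M * real D"
    proof (rule quantum_fidelity_bound[OF channel_comp[OF E' F] channel_comp[OF J ER(3)], of \<rho>])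
      show "(F \<circ> E') X $$ (s, t) = 0" if "X \<in> carrier_mat D D" "s < r" "t < r" "\<rho> s \<noteq> \<rho> t" for X s t
        using blocks channel_carrier[OF E' that(1)] that by simp
      show "card (label_class r \<rho> s) \<le> M" if "s < r" for s
        unfolding M_def by (rule card_class_le[OF that])
    qed
    \<comment> \<open>Dividing by D turns the error D^2 / (2 d) into D / (2 d) <= 1/2, as in the
      classical case.\<close>
    finally have "real D * real D \<le> (real M + real D / (2 * real d)) * real D"
      by (simp add: power2_eq_square algebra_simps)
    then have "real D \<le> real M + real D / (2 * real d)" using ER(1) by simp
    also have "real D / (2 * real d) \<le> 1 / 2" using dim_Q[OF code] d by (simp add: divide_simps)
    finally show ?thesis by linarith
  qed
  have cap: "Sup {log 2 (real D) |D. code D} = log 2 (real N)"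
    if "code N" "N \<ge> 1" "\<And>D. code D \<Longrightarrow> 1 \<le> D \<and> D \<le> N" for code :: "nat \<Rightarrow> bool" and N
  proof (rule cSup_eq_maximum)
    show "log 2 (real N) \<in> {log 2 (real D) |D. code D}" using that(1) by blast
    show "x \<le> log 2 (real N)" if "x \<in> {log 2 (real D) |D. code D}" for x
      using that \<open>\<And>D. code D \<Longrightarrow> 1 \<le> D \<and> D \<le> N\<close> by fastforce
  qed
  have "C_cap 0 d (T ^^ t) = log 2 (real r)" if "n k \<le> t" for t
    unfolding C_cap_def
    by (rule cap[of "\<lambda>D. classical_code d (T ^^ t) D 0", OF lower_C r]) (use upper_C[OF that] in \<open>auto simp: classical_code_def\<close>)
  then have "(\<lambda>t. C_cap 0 d (T ^^ t)) \<longlonglongrightarrow> log 2 (real r)"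
    by (intro tendsto_eventually) (auto simp: eventually_sequentially)
  then show "C_inf 0 d T = log 2 (real r)" unfolding C_inf_def by (rule limI)
  have "Q_cap 0 d (T ^^ t) = log 2 (real M)" if "n k \<le> t" for t
    unfolding Q_cap_def
    by (rule cap[of "\<lambda>D. quantum_code d (T ^^ t) D 0", OF lower_Q M]) (use upper_Q[OF that] in \<open>auto simp: quantum_code_def\<close>)
  then have "(\<lambda>t. Q_cap 0 d (T ^^ t)) \<longlonglongrightarrow> log 2 (real M)"
    by (intro tendsto_eventually) (auto simp: eventually_sequentially)
  then show "Q_inf 0 d T = log 2 (real (max_class r \<rho>))" unfolding Q_inf_def M_def by (rule limI)
qed

theorem theorem2:
  fixes T S :: "complex mat \<Rightarrow> complex mat" and d d' :: nat
  assumes "d \<ge> 1" and "d' \<ge> 1"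
    and "channel d d T" and "channel d' d' S"
  shows "C_inf 0 (d * d') (tensor_chan d d' T S) = C_inf 0 d T + C_inf 0 d' S
       \<and> Q_inf 0 (d * d') (tensor_chan d d' T S) = Q_inf 0 d T + Q_inf 0 d' S"
proof -
  obtain n r \<rho> r' \<rho>' where n: "\<forall>k. k \<le> n k" and T: "peripheral d T n r \<rho>" and S: "peripheral d' S n r' \<rho>'"
    using common_peripheral_exists[OF assms(3,4)] by blast
  note capT = capacities_peripheral[OF assms(1,3) T n[rule_format]]
  note capS = capacities_peripheral[OF assms(2,4) S n[rule_format]]
  have TS: "channel (d * d') (d * d') (tensor_chan d d' T S)"
    unfolding tensor_chan_eq_gtensor by (rule channel_gtensor[OF assms(3,4)])
  have "peripheral (d * d') (tensor_chan d d' T S) n (r * r') (pair_label r' \<rho> \<rho>')"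
    unfolding tensor_chan_eq_gtensor by (rule peripheral_tensor[OF assms(3) T assms(4) S])
  from capacities_peripheral[OF _ TS this n[rule_format]]
  have "C_inf 0 (d * d') (tensor_chan d d' T S) = log 2 (real r * real r')"
    "Q_inf 0 (d * d') (tensor_chan d d' T S) = log 2 (real (max_class r \<rho>) * real (max_class r' \<rho>'))"
    using assms(1,2) max_class_pair[OF capT(1) capS(1)] by simp_all
  then show ?thesis
    using capT capS max_class_pos[OF capT(1), of \<rho>] max_class_pos[OF capS(1), of \<rho>']
    by (simp add: log_mult_pos)
qed

end
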